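(* Let $m\geq 3$. There exists an irreducible $T$-module with dual endpoint $\mu$ and diameter $d$ if and only if $(\mu,d)\in\Upsilon$, where $\Upsilon=\{(\mu,d)\in\mathbb{Z}^2\mid 0\leq d\leq m,\ \tfrac12(m-d)\leq\mu\leq m-d\}$.
   Context: Let $m\geq 3$, $S=\{1,\ldots,2m+1\}$, $X$ the set of $m$-subsets of $S$, and $O_{m+1}$ the Odd graph on $X$ (adjacency = disjointness), a $Q$-polynomial distance-regular graph of diameter $m$ with distance $\partial$. Let $x_0=\{1,\ldots,m\}$, $A_1$ the adjacency matrix, $E^*_i$ ($0\leq i\leq m$) the diagonal matrix with $(y,y)$-entry $1$ iff $\partial(x_0,y)=i$, and $T$ the (Terwilliger) algebra generated by $A_1,E^*_0,\ldots,E^*_m$, acting on $V=\mathbb{C}^X$. Let $E_0,\ldots,E_m$ be the primitive idempotents of the Bose–Mesner algebra of $O_{m+1}$, ordered in a (fixed) $Q$-polynomial ordering. A $T$-module is a subspace $W\subseteq V$ with $TW\subseteq W$; it is irreducible if nonzero with no $T$-submodules besides $0$ and $W$. For an irreducible $T$-module $W$: its endpoint is $\min\{i: E^*_iW\neq0\}$, its diameter is $|\{i:E^*_iW\neq0\}|-1$, and its dual endpoint is $\min\{i:E_iW\neq0\}$. *)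

theory Defs
  imports Complex_Main
begin

text \<open>The Odd graph O_(m+1): vertices are the m-subsets of S = {1..2m+1},
  adjacency is disjointness. Vectors in V = C^X are functions on nat sets
  vanishing outside X; matrices are functions of two vertices; all sums are
  over X.\<close>

type_synonym vec = "nat set \<Rightarrow> complex"
type_synonym mat = "nat set \<Rightarrow> nat set \<Rightarrow> complex"

definition Xset :: "nat \<Rightarrow> nat set set" where
  "Xset m = {A. A \<subseteq> {1..2*m+1} \<and> card A = m}"

definition adjR :: "nat \<Rightarrow> (nat set \<times> nat set) set" where
  "adjR m = {(x, y). x \<in> Xset m \<and> y \<in> Xset m \<and> x \<inter> y = {}}"

definition odist :: "nat \<Rightarrow> nat set \<Rightarrow> nat set \<Rightarrow> nat" where
  "odist m x y = (LEAST n. (x, y) \<in> adjR m ^^ n)"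

definition x0 :: "nat \<Rightarrow> nat set" where
  "x0 m = {1..m}"

definition mmult :: "nat \<Rightarrow> mat \<Rightarrow> mat \<Rightarrow> mat" where
  "mmult m M N = (\<lambda>y z. if y \<in> Xset m \<and> z \<in> Xset m
      then \<Sum>w\<in>Xset m. M y w * N w z else 0)"

definition mvec :: "nat \<Rightarrow> mat \<Rightarrow> vec \<Rightarrow> vec" where
  "mvec m M v = (\<lambda>y. if y \<in> Xset m then \<Sum>z\<in>Xset m. M y z * v z else 0)"

definition hadamard :: "nat \<Rightarrow> mat \<Rightarrow> mat \<Rightarrow> mat" where
  "hadamard m M N = (\<lambda>y z. if y \<in> Xset m \<and> z \<in> Xset m then M y z * N y z else 0)"

definition idm :: "nat \<Rightarrow> mat" where
  "idm m = (\<lambda>y z. if y \<in> Xset m \<and> y = z then 1 else 0)"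

definition Jm :: "nat \<Rightarrow> mat" where
  "Jm m = (\<lambda>y z. if y \<in> Xset m \<and> z \<in> Xset m then 1 else 0)"

definition Adist :: "nat \<Rightarrow> nat \<Rightarrow> mat" where
  "Adist m i = (\<lambda>y z. if y \<in> Xset m \<and> z \<in> Xset m \<and> odist m y z = i then 1 else 0)"

definition Estar :: "nat \<Rightarrow> nat \<Rightarrow> mat" where
  "Estar m i = (\<lambda>y z. if y \<in> Xset m \<and> y = z \<and> odist m (x0 m) y = i then 1 else 0)"

inductive_set Talg :: "nat \<Rightarrow> mat set" for m :: nat where
  gen_A: "Adist m 1 \<in> Talg m"
| gen_Es: "i \<le> m \<Longrightarrow> Estar m i \<in> Talg m"
| add: "M \<in> Talg m \<Longrightarrow> N \<in> Talg m \<Longrightarrow> (\<lambda>y z. M y z + N y z) \<in> Talg m"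
| smult: "M \<in> Talg m \<Longrightarrow> (\<lambda>y z. c * M y z) \<in> Talg m"
| mult: "M \<in> Talg m \<Longrightarrow> N \<in> Talg m \<Longrightarrow> mmult m M N \<in> Talg m"

definition Vspace :: "nat \<Rightarrow> vec set" where
  "Vspace m = {v. \<forall>z. z \<notin> Xset m \<longrightarrow> v z = 0}"

definition is_subspace :: "nat \<Rightarrow> vec set \<Rightarrow> bool" where
  "is_subspace m W \<longleftrightarrow> W \<subseteq> Vspace m \<and> (\<lambda>_. 0) \<in> W
     \<and> (\<forall>v\<in>W. \<forall>w\<in>W. (\<lambda>y. v y + w y) \<in> W)
     \<and> (\<forall>c. \<forall>v\<in>W. (\<lambda>y. c * v y) \<in> W)"

definition T_module :: "nat \<Rightarrow> vec set \<Rightarrow> bool" where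
  "T_module m W \<longleftrightarrow> is_subspace m W \<and> (\<forall>M\<in>Talg m. \<forall>w\<in>W. mvec m M w \<in> W)"

definition irreducible_T_module :: "nat \<Rightarrow> vec set \<Rightarrow> bool" where
  "irreducible_T_module m W \<longleftrightarrow> T_module m W \<and> W \<noteq> {\<lambda>_. 0}
     \<and> (\<forall>W'. T_module m W' \<and> W' \<subseteq> W \<longrightarrow> W' = {\<lambda>_. 0} \<or> W' = W)"

definition acts_nonzero :: "nat \<Rightarrow> mat \<Rightarrow> vec set \<Rightarrow> bool" where
  "acts_nonzero m M W \<longleftrightarrow> (\<exists>w\<in>W. mvec m M w \<noteq> (\<lambda>_. 0))"

definition endpoint :: "nat \<Rightarrow> vec set \<Rightarrow> nat" where
  "endpoint m W = (LEAST i. i \<le> m \<and> acts_nonzero m (Estar m i) W)"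

definition diameter :: "nat \<Rightarrow> vec set \<Rightarrow> nat" where
  "diameter m W = card {i. i \<le> m \<and> acts_nonzero m (Estar m i) W} - 1"

definition dual_endpoint :: "nat \<Rightarrow> (nat \<Rightarrow> mat) \<Rightarrow> vec set \<Rightarrow> nat" where
  "dual_endpoint m E W = (LEAST i. i \<le> m \<and> acts_nonzero m (E i) W)"

definition BM :: "nat \<Rightarrow> mat set" where
  "BM m = {(\<lambda>y z. \<Sum>i\<le>m. c i * Adist m i y z) | c. True}"

definition primitive_idempotents :: "nat \<Rightarrow> (nat \<Rightarrow> mat) \<Rightarrow> bool" where
  "primitive_idempotents m E \<longleftrightarrow>
     (\<forall>i\<le>m. E i \<in> BM m \<and> E i \<noteq> (\<lambda>_ _. 0))
   \<and> (\<forall>i\<le>m. \<forall>j\<le>m. mmult m (E i) (E j) = (if i = j then E i else (\<lambda>_ _. 0)))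
   \<and> (\<lambda>y z. \<Sum>i\<le>m. E i y z) = idm m
   \<and> (\<forall>M\<in>BM m. \<exists>c. M = (\<lambda>y z. \<Sum>i\<le>m. c i * E i y z))"

definition Q_polynomial :: "nat \<Rightarrow> (nat \<Rightarrow> mat) \<Rightarrow> bool" where
  "Q_polynomial m E \<longleftrightarrow> primitive_idempotents m E
   \<and> E 0 = (\<lambda>y z. Jm m y z / of_nat (card (Xset m)))
   \<and> (\<exists>q :: nat \<Rightarrow> nat \<Rightarrow> nat \<Rightarrow> complex.
        (\<forall>i\<le>m. \<forall>j\<le>m. hadamard m (E i) (E j)
            = (\<lambda>y z. (\<Sum>h\<le>m. q h i j * E h y z) / of_nat (card (Xset m))))
      \<and> (\<forall>h\<le>m. \<forall>i\<le>m. \<forall>j\<le>m. (h > i + j \<or> i > h + j \<or> j > h + i) \<longrightarrow> q h i j = 0)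
      \<and> (\<forall>h\<le>m. \<forall>i\<le>m. \<forall>j\<le>m. (h = i + j \<or> i = h + j \<or> j = h + i) \<longrightarrow> q h i j \<noteq> 0))"

end

theory Submission
  imports Defs "HOL-Library.Function_Algebras" "HOL-Combinatorics.Transposition"
begin

text \<open>Split the ground set into the base vertex \<open>P\<^sub>1\<close> of size \<open>m\<close> and its complement \<open>P\<^sub>2\<close> of
  size \<open>m + 1\<close>. A neighbour of \<open>y\<close> is the complement of \<open>y\<close> minus one point \<open>p\<close>, and according to
  whether \<open>p\<close> lies in \<open>P\<^sub>1\<close> or \<open>P\<^sub>2\<close> the adjacency operator splits as \<open>A = F\<^sub>1 + F\<^sub>2\<close>. Up to a function
  of the level, \<open>F\<^sub>1\<^sup>2\<close> and \<open>F\<^sub>2\<^sup>2\<close> are the Casimir operators of two commuting \<open>sl\<^sub>2\<close>-actions; they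
  commute with \<open>T\<close>, hence act on an irreducible module as scalars \<open>-a(m+1-a)\<close> and \<open>-b(m+2-b)\<close>.
  If the bottom level of the module is killed by \<open>F\<^sub>1\<close>, this determines \<open>a\<close>; the Askey-Wilson
  relation between \<open>A\<close> and the level operator, applied to an eigenvector of \<open>A\<close> in the lowest
  nonzero \<open>E\<^sub>\<mu>W\<close>, then forces the other Casimir to have parameter \<open>b = \<mu> - a\<close>. (If it is \<open>F\<^sub>2\<close>, the
  roles are exchanged.) Positivity of \<open>F\<^sub>i\<^sup>2\<close> yields the inequalities and the diameter. Conversely,
  products of differences over disjoint pairs realise every pair \<open>(a, b)\<close>.

  Any \<open>Q\<close>-polynomial ordering has eigenvalues \<open>(-1)\<^sup>j (m + 1 - j)\<close>: the Askey-Wilson relation shows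
  that the eigenspace for \<open>- m\<close> occurs in \<open>E\<^sub>1 \<circ> E\<^sub>1\<close>, so it is \<open>E\<^sub>1\<close> or \<open>E\<^sub>2\<close>; in the first case the
  remaining eigenvalues follow inductively, and the second case is refuted by comparing the
  entries at the distances \<open>0, \<dots>, 3\<close>.\<close>

subsection \<open>Flips, swaps and Casimir operators\<close>

text \<open>The two flips act on the levels \<open>s y = card (P - y)\<close> as reflections,
  \<open>FP\<close> by \<open>s -> n + 1 - s\<close> and \<open>FQ\<close> by
  \<open>s -> n - s\<close>. Alternating them runs through the levels in the order of distance from
  the base vertex, so a module can only break off where one flip kills a level; at the end nearest
  to the base vertex the parity of the distance tells which one, and that half is called
  \<open>P\<close>. The Askey-Wilson relation couples two eigenvectors of \<open>A\<close> through
  the level only if their eigenvalues have sum \<open>1\<close> or \<open>-1\<close>. This makes the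
  eigenvalue list a path: consecutive values have sum \<open>(-1)^j\<close>, and no other pair has
  sum \<open>1\<close> or \<open>-1\<close>. The condition serves twice, to locate the second
  Casimir parameter and to recover the ordering. Two obstacles shape the rest. The idempotents
  \<open>E j\<close> are not generators of \<open>Talg\<close>, so they reach a module only through
  polynomials in \<open>A\<close>. And \<open>E\<close> is an arbitrary Q-polynomial ordering with
  complex coefficients, so its eigenvalues have to be derived; the classification is therefore
  stated in a locale that assumes them.\<close>

definition gr :: "nat \<Rightarrow> nat set" where "gr m = {1..2*m+1}"

definition flip :: "nat \<Rightarrow> nat set \<Rightarrow> vec \<Rightarrow> vec" where
  "flip m P v = (\<lambda>y. if y \<in> Xset m then \<Sum>p\<in>P - y. v (gr m - y - {p}) else 0)"

text \<open>The off-diagonal part of \<open>flip m P\<close> applied twice, see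
  \<open>flip_flip\<close>.\<close>

definition swp :: "nat \<Rightarrow> nat set \<Rightarrow> vec \<Rightarrow> vec" where
  "swp m P v = (\<lambda>y. if y \<in> Xset m then \<Sum>p\<in>P - y. \<Sum>q\<in>P \<inter> y. v (insert p y - {q}) else 0)"

text \<open>The quadratic Casimir element of the \<open>sl\<^sub>2\<close> raising and lowering subsets of \<open>P\<close>, normalised to
  vanish on functions that depend on \<open>y\<close> only through \<open>card (P \<inter> y)\<close>.\<close>

definition casim :: "nat \<Rightarrow> nat set \<Rightarrow> vec \<Rightarrow> vec" where
  "casim m P v = (\<lambda>y. swp m P v y - of_nat (card (P - y)) * of_nat (card (P \<inter> y)) * v y)"

lemma finite_gr: "finite (gr m)" and card_gr: "card (gr m) = 2*m+1"
  by (auto simp: gr_def)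

lemma Xset_iff: "y \<in> Xset m \<longleftrightarrow> y \<subseteq> gr m \<and> card y = m"
  by (simp add: Xset_def gr_def)

lemma Xset_subset: "y \<in> Xset m \<Longrightarrow> y \<subseteq> gr m"
  and Xset_card: "y \<in> Xset m \<Longrightarrow> card y = m"
  by (auto simp: Xset_iff)

lemma Xset_finite_mem: "y \<in> Xset m \<Longrightarrow> finite y"
  using Xset_subset finite_gr finite_subset by blast

lemma finite_Xset: "finite (Xset m)"
  by (rule finite_subset[of _ "Pow (gr m)"]) (auto simp: Xset_iff finite_gr)

lemma Vspace_outside: "v \<in> Vspace m \<Longrightarrow> y \<notin> Xset m \<Longrightarrow> v y = 0"
  by (auto simp: Vspace_def)

lemma card_ground_Diff:
  assumes "y \<in> Xset m" shows "card (gr m - y) = m + 1"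
  using assms by (simp add: card_Diff_subset Xset_subset Xset_finite_mem Xset_card card_gr)

lemma flip_vertex:
  assumes "y \<in> Xset m" "p \<in> gr m - y"
  shows "gr m - y - {p} \<in> Xset m"
  using assms card_ground_Diff[OF assms(1)] by (auto simp: Xset_iff)

lemma swap_vertex:
  assumes "y \<in> Xset m" "p \<in> gr m - y" "q \<in> y"
  shows "insert p y - {q} \<in> Xset m"
  using assms Xset_finite_mem[OF assms(1)] by (auto simp: Xset_iff)

lemma flip_add: "flip m P (\<lambda>y. u y + v y) = (\<lambda>y. flip m P u y + flip m P v y)"
  by (auto simp: flip_def sum.distrib)

lemma flip_diff: "flip m P (\<lambda>y. u y - v y) = (\<lambda>y. flip m P u y - flip m P v y)"
  by (auto simp: flip_def sum_subtractf)

lemma flip_scale: "flip m P (\<lambda>y. c * v y) = (\<lambda>y. c * flip m P v y)"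
  by (auto simp: flip_def sum_distrib_left)

lemma swp_scale: "swp m P (\<lambda>y. c * v y) = (\<lambda>y. c * swp m P v y)"
  by (auto simp: swp_def sum_distrib_left)

lemma swp_add: "swp m P (\<lambda>y. u y + v y) = (\<lambda>y. swp m P u y + swp m P v y)"
  by (auto simp: swp_def sum.distrib)

lemma casim_scale: "casim m P (\<lambda>y. c * v y) = (\<lambda>y. c * casim m P v y)"
  by (auto simp: casim_def swp_scale algebra_simps)

lemma casim_add: "casim m P (\<lambda>y. u y + v y) = (\<lambda>y. casim m P u y + casim m P v y)"
  by (auto simp: casim_def swp_add algebra_simps)

lemma flip_outside: "y \<notin> Xset m \<Longrightarrow> flip m P v y = 0"
  by (simp add: flip_def)

lemma casim_outside: "v \<in> Vspace m \<Longrightarrow> y \<notin> Xset m \<Longrightarrow> casim m P v y = 0"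
  by (simp add: casim_def swp_def Vspace_def)

lemma flip_Un:
  assumes "finite P" "finite Q" "P \<inter> Q = {}"
  shows "flip m (P \<union> Q) v = (\<lambda>y. flip m P v y + flip m Q v y)"
proof
  fix y
  have "(P \<union> Q) - y = (P - y) \<union> (Q - y)" by auto
  then show "flip m (P \<union> Q) v y = flip m P v y + flip m Q v y"
    using assms by (auto simp: flip_def intro!: sum.union_disjoint)
qed

text \<open>Dropping \<open>p\<close> and then \<open>q\<close> from successive complements turns
  \<open>y\<close> into \<open>insert p y - {q}\<close>; the choice \<open>q = p\<close> returns to
  \<open>y\<close> and produces the diagonal term.\<close>

lemma flip_flip:
  assumes P: "P \<subseteq> gr m" and y: "y \<in> Xset m"
  shows "flip m P (flip m P v) y = swp m P v y + of_nat (card (P - y)) * v y"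
proof -
  have "flip m P v (gr m - y - {p}) = v y + (\<Sum>q\<in>P \<inter> y. v (insert p y - {q}))" if p: "p \<in> P - y" for p
  proof -
    let ?z = "gr m - y - {p}"
    have z: "?z \<in> Xset m" using flip_vertex[OF y, of p] p P by auto
    have e1: "P - ?z = insert p (P \<inter> y)" using p P by auto
    have e2: "gr m - ?z = insert p y" using p P Xset_subset[OF y] by auto
    have "finite (P \<inter> y)" using Xset_finite_mem[OF y] by auto
    then have "(\<Sum>q\<in>P - ?z. v (gr m - ?z - {q})) = v (insert p y - {p}) + (\<Sum>q\<in>P \<inter> y. v (insert p y - {q}))"
      unfolding e1 e2 using p by (subst sum.insert) auto
    moreover have "insert p y - {p} = y" using p by auto
    ultimately show ?thesis using z by (simp add: flip_def)
  qed
  then have "flip m P (flip m P v) y = (\<Sum>p\<in>P - y. v y + (\<Sum>q\<in>P \<inter> y. v (insert p y - {q})))"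
    using y by (subst flip_def) (auto intro!: sum.cong)
  then show ?thesis using y by (simp add: swp_def sum.distrib)
qed

text \<open>A flip in \<open>Q\<close> complements \<open>y\<close> inside \<open>P\<close>, so it
  turns the swap of \<open>p\<close> and \<open>q\<close> into the opposite swap; the sum over all
  swaps is unchanged.\<close>

lemma swp_flip_commute:
  assumes P: "P \<subseteq> gr m" and Q: "Q \<subseteq> gr m" and PQ: "P \<inter> Q = {}"
  shows "swp m P (flip m Q v) = flip m Q (swp m P v)"
proof
  fix y
  show "swp m P (flip m Q v) y = flip m Q (swp m P v) y"
  proof (cases "y \<in> Xset m")
    case y: True
    let ?S = "gr m"
    have "swp m P (flip m Q v) y = (\<Sum>p\<in>P - y. \<Sum>q\<in>P \<inter> y. \<Sum>r\<in>Q - y. v (?S - (insert p y - {q}) - {r}))"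
    proof -
      have "flip m Q v (insert p y - {q}) = (\<Sum>r\<in>Q - y. v (?S - (insert p y - {q}) - {r}))"
        if "p \<in> P - y" "q \<in> P \<inter> y" for p q
      proof -
        have "Q - (insert p y - {q}) = Q - y" using that PQ by auto
        then show ?thesis using swap_vertex[OF y, of p q] that P by (auto simp: flip_def)
      qed
      then show ?thesis using y by (simp add: swp_def)
    qed
    also have "\<dots> = (\<Sum>r\<in>Q - y. \<Sum>p\<in>P - y. \<Sum>q\<in>P \<inter> y. v (?S - (insert p y - {q}) - {r}))"
      by (subst sum.swap[of _ "Q - y"], subst (2) sum.swap) simp
    also have "\<dots> = (\<Sum>r\<in>Q - y. swp m P v (?S - y - {r}))"
    proof (rule sum.cong[OF refl])
      fix r assume r: "r \<in> Q - y"
      let ?z = "?S - y - {r}"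
      have z: "?z \<in> Xset m" using flip_vertex[OF y, of r] r Q by auto
      have e: "P - ?z = P \<inter> y" "P \<inter> ?z = P - y" using r P PQ by auto
      have "swp m P v ?z = (\<Sum>q\<in>P \<inter> y. \<Sum>p\<in>P - y. v (insert q ?z - {p}))"
        using z unfolding swp_def e by simp
      also have "\<dots> = (\<Sum>p\<in>P - y. \<Sum>q\<in>P \<inter> y. v (insert q ?z - {p}))"
        by (rule sum.swap)
      also have "\<dots> = (\<Sum>p\<in>P - y. \<Sum>q\<in>P \<inter> y. v (?S - (insert p y - {q}) - {r}))"
      proof (intro sum.cong refl arg_cong[of _ _ v])
        fix p q assume "p \<in> P - y" "q \<in> P \<inter> y"
        then show "insert q ?z - {p} = ?S - (insert p y - {q}) - {r}"
          using r PQ P by auto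
      qed
      finally show "(\<Sum>p\<in>P - y. \<Sum>q\<in>P \<inter> y. v (?S - (insert p y - {q}) - {r})) = swp m P v ?z" by simp
    qed
    also have "\<dots> = flip m Q (swp m P v) y" using y by (simp add: flip_def)
    finally show ?thesis .
  qed (simp add: swp_def flip_def)
qed

subsection \<open>The two halves of the ground set\<close>

text \<open>Both assignments of the halves are allowed, so every result on \<open>P\<close>
  transfers to \<open>Q\<close> through \<open>swap_halves\<close>.\<close>

locale halves =
  fixes m :: nat and P Q :: "nat set"
  assumes halves: "P = {1..m} \<and> Q = {m+1..2*m+1} \<or> P = {m+1..2*m+1} \<and> Q = {1..m}"
begin

abbreviation "A \<equiv> flip m (gr m)"
abbreviation "FP \<equiv> flip m P"
abbreviation "FQ \<equiv> flip m Q"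
abbreviation "X \<equiv> Xset m"
abbreviation "n \<equiv> card P"

definition s :: "nat set \<Rightarrow> nat" where "s y = card (P - y)"

lemma P_sub: "P \<subseteq> gr m" and Q_sub: "Q \<subseteq> gr m"
  and PQ_disj: "P \<inter> Q = {}" and PQ_Un: "P \<union> Q = gr m"
  and finP: "finite P" and finQ: "finite Q"
  and cardPQ: "card P + card Q = 2*m+1" and cardP: "card P = m \<or> card P = m + 1"
  using halves by (auto simp: gr_def)

lemma swap_halves: "halves m Q P"
  using halves by (unfold_locales) auto

lemma A_eq: "A v = (\<lambda>y. FP v y + FQ v y)"
  unfolding PQ_Un[symmetric] by (rule flip_Un[OF finP finQ PQ_disj])

lemma s_le: "s y \<le> n"
  unfolding s_def using finP by (simp add: card_mono)

lemma card_P_Int: "card (P \<inter> y) = n - s y"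
proof -
  have "card (P \<inter> y) + card (P - y) = card P"
    using finP by (metis card_Int_Diff)
  then show ?thesis by (simp add: s_def)
qed

lemma card_Q_Diff:
  assumes "y \<in> X" shows "card (Q - y) + s y = m + 1"
proof -
  have "gr m - y = (P - y) \<union> (Q - y)" using PQ_Un by auto
  then have "card (gr m - y) = card (P - y) + card (Q - y)"
    using finP finQ PQ_disj by (simp add: card_Un_disjoint Diff_Int_distrib2 disjoint_iff)
  then show ?thesis using card_ground_Diff[OF assms] by (simp add: s_def)
qed

lemma card_Q_Int:
  assumes "y \<in> X" shows "card (Q \<inter> y) + n = m + s y"
proof -
  have "card (Q \<inter> y) + card (Q - y) = card Q"
    using finQ by (metis card_Int_Diff)
  then show ?thesis using card_Q_Diff[OF assms] cardPQ by linarith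
qed

text \<open>Complementing turns \<open>s y\<close> into \<open>n - s y\<close>; dropping a point of
  \<open>P\<close> adds one to that, dropping a point of \<open>Q\<close> adds nothing.\<close>

lemma s_flip_P:
  assumes "p \<in> P - y" shows "s (gr m - y - {p}) = n + 1 - s y"
proof -
  have "P - (gr m - y - {p}) = insert p (P \<inter> y)" using assms P_sub by auto
  then show ?thesis using assms finP card_P_Int[of y] s_le[of y]
    by (simp add: s_def)
qed

lemma s_flip_Q:
  assumes "p \<in> Q - y" shows "s (gr m - y - {p}) = n - s y"
proof -
  have "P - (gr m - y - {p}) = (P \<inter> y)" using assms P_sub PQ_disj by auto
  then show ?thesis using card_P_Int[of y] by (simp add: s_def)
qed

lemma FP_level: "FP (\<lambda>y. f (s y) * v y) y = f (n + 1 - s y) * FP v y"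
  by (auto simp: flip_def sum_distrib_left s_flip_P intro!: sum.cong)

lemma FQ_level: "FQ (\<lambda>y. f (s y) * v y) y = f (n - s y) * FQ v y"
  by (auto simp: flip_def sum_distrib_left s_flip_Q intro!: sum.cong)

lemma FP_K: "FP (\<lambda>y. of_nat (s y) * v y) y = (of_nat n + 1 - of_nat (s y)) * FP v y"
  using FP_level[of of_nat v y] s_le[of y] by (simp add: of_nat_diff)

lemma FQ_K: "FQ (\<lambda>y. of_nat (s y) * v y) y = (of_nat n - of_nat (s y)) * FQ v y"
  using FQ_level[of of_nat v y] s_le[of y] by (simp add: of_nat_diff)

lemma FP_local:
  assumes "\<And>z. z \<in> X \<Longrightarrow> s z = n + 1 - s y \<Longrightarrow> u z = v z"
  shows "FP u y = FP v y"
  using assms by (auto simp: flip_def s_flip_P flip_vertex P_sub[THEN subsetD, unfolded One_nat_def] intro!: sum.cong)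

end

context halves begin

lemma FQ_local:
  assumes "\<And>z. z \<in> X \<Longrightarrow> s z = n - s y \<Longrightarrow> u z = v z"
  shows "FQ u y = FQ v y"
  using assms by (auto simp: flip_def s_flip_Q flip_vertex Q_sub[THEN subsetD] intro!: sum.cong)

lemma FP_FP:
  assumes "y \<in> X"
  shows "FP (FP v) y = casim m P v y + of_nat (s y * (n + 1 - s y)) * v y"
proof -
  have "n + 1 - s y = (n - s y) + 1" using s_le[of y] by simp
  then have "of_nat (s y * (n + 1 - s y)) = (of_nat (s y) * of_nat (n - s y) + of_nat (s y) :: complex)"
    by (simp only: of_nat_mult of_nat_add of_nat_1 distrib_left mult_1_right)
  moreover have "card (P - y) = s y" by (simp add: s_def)
  ultimately show ?thesis
    using flip_flip[OF P_sub assms, of v] 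
    by (simp only: casim_def card_P_Int) (simp add: algebra_simps)
qed

lemma FQ_FQ:
  assumes "y \<in> X"
  shows "FQ (FQ v) y = casim m Q v y + of_nat ((m + 1 - s y) * (m + 1 + s y - n)) * v y"
proof -
  have "card (Q - y) = m + 1 - s y" "card (Q \<inter> y) = m + s y - n" "m + 1 + s y - n = (m + s y - n) + 1"
    using card_Q_Diff[OF assms] card_Q_Int[OF assms] by linarith+
  then have "(m + 1 - s y) * (m + 1 + s y - n) = card (Q - y) * card (Q \<inter> y) + card (Q - y)" by simp
  then show ?thesis
    using flip_flip[OF Q_sub assms, of v]
    by (simp add: casim_def algebra_simps)
qed

lemma casim_level: "casim m P (\<lambda>y. f (s y) * v y) y = f (s y) * casim m P v y"
proof (cases "y \<in> X")
  case True
  have "s (insert p y - {q}) = s y" if "p \<in> P - y" "q \<in> P \<inter> y" for p q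
  proof -
    have "P - (insert p y - {q}) = insert q (P - y - {p})" using that by auto
    moreover have "q \<notin> P - y - {p}" "p \<in> P - y" using that by auto
    ultimately show ?thesis using finP card_Suc_Diff1[of "P - y" p] by (simp add: s_def)
  qed
  then have "swp m P (\<lambda>y. f (s y) * v y) y = f (s y) * swp m P v y"
    using True by (simp add: swp_def sum_distrib_left)
  then show ?thesis by (simp add: casim_def algebra_simps)
qed (simp add: casim_def swp_def)

text \<open>The swaps commute with \<open>FQ\<close>, and the diagonal factor
  \<open>s * (n - s)\<close> is invariant under the reflection \<open>s -> n - s\<close>.\<close>

lemma casim_FQ: "casim m P (FQ v) = FQ (casim m P v)"
proof
  fix y
  have "FQ (\<lambda>y. of_nat (card (P - y)) * of_nat (card (P \<inter> y)) * v y) y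
     = of_nat (n - s y) * of_nat (n - (n - s y)) * FQ v y"
    using FQ_level[of "\<lambda>k. of_nat k * of_nat (n - k)" v y]
    by (simp add: s_def[symmetric] card_P_Int)
  then show "casim m P (FQ v) y = FQ (casim m P v) y"
    using fun_cong[OF swp_flip_commute[OF P_sub Q_sub PQ_disj, of v], of y] s_le[of y] 
    by (simp add: casim_def flip_diff card_P_Int s_def[symmetric])
qed

text \<open>\<open>casim\<close> is the square of \<open>FP\<close> minus
  \<open>s * (n + 1 - s)\<close>, and this function is invariant under the reflection
  \<open>s -> n + 1 - s\<close> made by \<open>FP\<close>.\<close>

lemma casim_FP: "casim m P (FP v) = FP (casim m P v)"
proof
  fix y
  show "casim m P (FP v) y = FP (casim m P v) y"
  proof (cases "y \<in> X")
    case True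
    have "FP (FP (FP v)) y = FP (\<lambda>y. casim m P v y + of_nat (s y * (n + 1 - s y)) * v y) y"
      by (rule FP_local) (simp add: FP_FP)
    also have "\<dots> = FP (casim m P v) y + of_nat ((n + 1 - s y) * (n + 1 - (n + 1 - s y))) * FP v y"
      using FP_level[of "\<lambda>k. of_nat (k * (n + 1 - k))" v y] by (simp add: flip_add)
    also have "n + 1 - (n + 1 - s y) = s y" using s_le[of y] by simp
    finally show ?thesis using FP_FP[OF True, of "FP v"] by (simp add: mult.commute)
  qed (simp add: casim_def swp_def flip_def)
qed

lemma casim_A: "casim m P (A v) = A (casim m P v)"
  unfolding A_eq casim_add casim_FP casim_FQ ..

text \<open>Moving \<open>s\<close> past the flips gives \<open>A K + K A = n A + FP\<close>, with
  \<open>K\<close> the multiplication by \<open>s\<close>. Hence modules are closed under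
  \<open>FP\<close>.\<close>

lemma FP_from_A: "FP v = (\<lambda>y. A (\<lambda>y. of_nat (s y) * v y) y + of_nat (s y) * A v y - of_nat n * A v y)"
  by (rule ext, simp only: A_eq FP_K FQ_K, simp add: algebra_simps)

abbreviation "K v \<equiv> (\<lambda>y. of_nat (s y) * v y)"

lemma FP_K': "FP (K v) = (\<lambda>y. (of_nat n + 1) * FP v y - K (FP v) y)"
  by (rule ext, simp only: FP_K, simp add: algebra_simps)

lemma FQ_K': "FQ (K v) = (\<lambda>y. of_nat n * FQ v y - K (FQ v) y)"
  by (rule ext, simp only: FQ_K, simp add: algebra_simps)

text \<open>This is the anticommutator of \<open>A\<close> with \<open>A K + K A = n A + FP\<close>,
  where \<open>A FP + FP A\<close> equals \<open>A^2 + FP^2 - FQ^2\<close>.\<close>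

lemma Askey_Wilson:
  "A (A (K v)) y + 2 * A (K (A v)) y + K (A (A v)) y
    = (2 * of_nat n + 1) * A (A v) y + FP (FP v) y - FQ (FQ v) y"
proof -
  have "FP (FP (K v)) y = (of_nat n + 1) * FP (FP v) y - (of_nat n + 1 - of_nat (s y)) * FP (FP v) y"
    by (simp only: FP_K' flip_diff flip_scale) (simp add: algebra_simps)
  moreover have "FP (FQ (K v)) y = of_nat n * FP (FQ v) y - (of_nat n + 1 - of_nat (s y)) * FP (FQ v) y"
    by (simp only: FQ_K' flip_diff flip_scale FP_K)
  moreover have "FQ (FP (K v)) y = (of_nat n + 1) * FQ (FP v) y - (of_nat n - of_nat (s y)) * FQ (FP v) y"
    by (simp only: FP_K' flip_diff flip_scale FQ_K)
  moreover have "FQ (FQ (K v)) y = of_nat n * FQ (FQ v) y - (of_nat n - of_nat (s y)) * FQ (FQ v) y"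
    by (simp only: FQ_K' flip_diff flip_scale) (simp add: algebra_simps)
  ultimately have "A (A (K v)) y = ((of_nat n + 1) * FP (FP v) y - (of_nat n + 1 - of_nat (s y)) * FP (FP v) y)
    + (of_nat n * FP (FQ v) y - (of_nat n + 1 - of_nat (s y)) * FP (FQ v) y)
    + ((of_nat n + 1) * FQ (FP v) y - (of_nat n - of_nat (s y)) * FQ (FP v) y)
    + (of_nat n * FQ (FQ v) y - (of_nat n - of_nat (s y)) * FQ (FQ v) y)"
    by (simp only: A_eq flip_add ac_simps)
  moreover have "A (K (A v)) y = (of_nat n + 1 - of_nat (s y)) * (FP (FP v) y + FP (FQ v) y)
      + (of_nat n - of_nat (s y)) * (FQ (FP v) y + FQ (FQ v) y)"
    by (simp only: A_eq flip_add FP_K FQ_K ac_simps distrib_left)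
  moreover have "A (A v) y = FP (FP v) y + FP (FQ v) y + FQ (FP v) y + FQ (FQ v) y"
    by (simp only: A_eq flip_add ac_simps)
  ultimately show ?thesis by (simp only:) (simp add: algebra_simps)
qed

text \<open>The terms quadratic in \<open>s\<close> cancel and \<open>s\<close> remains with
  coefficient one, which makes the Askey-Wilson relation linear in the level.\<close>

lemma FP_FP_minus_FQ_FQ:
  assumes "y \<in> X"
  shows "FP (FP v) y - FQ (FQ v) y = casim m P v y - casim m Q v y
     + (of_nat (s y) + of_nat n * (of_nat m + 1) - of_nat (m+1) * of_nat (m+1)) * v y"
proof -
  have "s y \<le> m + 1" "n \<le> m + 1 + s y" using card_Q_Diff[OF assms] card_Q_Int[OF assms] by linarith+
  then have "complex_of_nat (m + 1 - s y) = of_nat m + 1 - of_nat (s y)" 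
    "complex_of_nat (m + 1 + s y - n) = of_nat m + 1 + of_nat (s y) - of_nat n"
    "complex_of_nat (n + 1 - s y) = of_nat n + 1 - of_nat (s y)" 
    using s_le[of y] by (simp_all add: of_nat_diff)
  then show ?thesis unfolding FP_FP[OF assms] FQ_FQ[OF assms] of_nat_mult
    by (simp only:) (simp add: algebra_simps)
qed

end

subsection \<open>Distances and modules\<close>

text \<open>For adjacent \<open>z\<close> and \<open>y\<close> the sets \<open>x \<inter> z\<close>
  and \<open>x \<inter> y\<close> are disjoint and miss at most one point of \<open>x\<close>, so
  the intersection sizes of successive vertices add up to \<open>m\<close> or
  \<open>m - 1\<close>.\<close>

lemma walk_bound:
  assumes "(x, y) \<in> adjR m ^^ k" "x \<in> Xset m"
  shows "y \<in> Xset m \<and> (even k \<longrightarrow> 2 * m \<le> k + 2 * card (x \<inter> y)) \<and> (odd k \<longrightarrow> 2 * card (x \<inter> y) + 1 \<le> k)"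
  using assms(1)
proof (induction k arbitrary: y)
  case 0
  then show ?case using assms(2) by (auto simp: Xset_card)
next
  case (Suc k)
  then obtain z where z: "(x, z) \<in> adjR m ^^ k" "(z, y) \<in> adjR m" by auto
  from z(2) have zy: "z \<in> Xset m" "y \<in> Xset m" "z \<inter> y = {}" by (auto simp: adjR_def)
  note fx = Xset_finite_mem[OF assms(2)]
  have "card (x \<inter> z) + card (x \<inter> y) = card (x \<inter> z \<union> x \<inter> y)"
    using fx zy by (intro card_Un_disjoint[symmetric]) auto
  also have "\<dots> \<le> card x" using fx by (intro card_mono) auto
  finally have 1: "card (x \<inter> z) + card (x \<inter> y) \<le> m" using Xset_card assms by simp
  have "card (z \<union> y) = 2 * m"
    using zy by (simp add: card_Un_disjoint Xset_finite_mem Xset_card)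
  then have "card (gr m - (z \<union> y)) = 1"
    using zy by (subst card_Diff_subset) (auto simp: Xset_finite_mem Xset_subset card_gr)
  moreover have "card (x - (z \<union> y)) \<le> card (gr m - (z \<union> y))"
    using Xset_subset[OF assms(2)] by (intro card_mono) (auto simp: finite_gr)
  moreover have "card x = card (x \<inter> z) + card (x \<inter> y) + card (x - (z \<union> y))"
  proof -
    have "x = (x \<inter> z) \<union> (x \<inter> y) \<union> (x - (z \<union> y))" by auto
    then have "card x = card ((x \<inter> z) \<union> (x \<inter> y) \<union> (x - (z \<union> y)))" by simp
    also have "\<dots> = card ((x \<inter> z) \<union> (x \<inter> y)) + card (x - (z \<union> y))"
      using fx by (intro card_Un_disjoint) auto
    also have "card ((x \<inter> z) \<union> (x \<inter> y)) = card (x \<inter> z) + card (x \<inter> y)"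
      using fx zy by (intro card_Un_disjoint) auto
    finally show ?thesis .
  qed
  ultimately have 2: "m \<le> card (x \<inter> z) + card (x \<inter> y) + 1" using Xset_card assms by simp
  show ?case using Suc.IH[OF z(1)] zy 1 2 by auto
qed

text \<open>Two steps realise the swap of one point of \<open>y - x\<close> for one of
  \<open>x - y\<close>.\<close>

lemma walk_even:
  assumes "x \<in> Xset m" "y \<in> Xset m" "card (x \<inter> y) + k = m"
  shows "(x, y) \<in> adjR m ^^ (2 * k)"
  using assms(2,3)
proof (induction k arbitrary: y)
  case 0
  note f = Xset_finite_mem[OF assms(1)] Xset_finite_mem[OF 0(1)]
  have "x \<inter> y = x"
    by (rule card_subset_eq[OF f(1)]) (use 0 assms(1) in \<open>auto simp: Xset_card\<close>)
  moreover have "x \<inter> y = y"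
    by (rule card_subset_eq[OF f(2)]) (use 0 in \<open>auto simp: Xset_card\<close>)
  ultimately have "x = y" by blast
  then show ?case by simp
next
  case (Suc k)
  note f = Xset_finite_mem[OF assms(1)] Xset_finite_mem[OF Suc.prems(1)]
  have "\<not> x \<subseteq> y"
  proof
    assume "x \<subseteq> y"
    then have "x \<inter> y = x" by blast
    with Suc.prems(2) Xset_card[OF assms(1)] show False by simp
  qed
  then obtain p where p: "p \<in> x" "p \<notin> y" by auto
  have "\<not> y \<subseteq> x"
  proof
    assume "y \<subseteq> x"
    then have "x \<inter> y = y" by blast
    with Suc.prems Xset_card[OF Suc.prems(1)] show False by simp
  qed
  then obtain q where q: "q \<in> y" "q \<notin> x" by auto
  let ?z = "insert p y - {q}"
  have pg: "p \<in> gr m - y" using p Xset_subset[OF assms(1)] by auto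
  have z: "?z \<in> Xset m" by (rule swap_vertex[OF Suc.prems(1) pg q(1)])
  have "x \<inter> ?z = insert p (x \<inter> y)" using p q by auto
  then have "card (x \<inter> ?z) = Suc (card (x \<inter> y))" using p f by simp
  then have "(x, ?z) \<in> adjR m ^^ (2 * k)" using Suc.IH[OF z] Suc.prems(2) by simp
  moreover have w: "gr m - y - {p} \<in> Xset m" by (rule flip_vertex[OF Suc.prems(1) pg])
  then have "(?z, gr m - y - {p}) \<in> adjR m" "(gr m - y - {p}, y) \<in> adjR m"
    using z Suc.prems(1) by (auto simp: adjR_def)
  ultimately show ?case by auto
qed

text \<open>The last step starts from a neighbour of \<open>y\<close> that contains all of
  \<open>x - y\<close>: the point dropped from the complement is chosen outside
  \<open>x\<close>.\<close>

lemma walk_odd: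
  assumes "x \<in> Xset m" "y \<in> Xset m"
  shows "(x, y) \<in> adjR m ^^ (2 * card (x \<inter> y) + 1)"
proof -
  note f = Xset_finite_mem[OF assms(1)] Xset_finite_mem[OF assms(2)]
  have "card (x \<union> y) + card (x \<inter> y) = 2 * m"
    using card_Un_Int[OF f] assms Xset_card by simp
  then have "card (x \<union> y) < card (gr m)" by (simp add: card_gr)
  then have "\<not> gr m \<subseteq> x \<union> y" using f by (meson card_mono finite_UnI leD)
  then obtain p where p: "p \<in> gr m - y" "p \<notin> x" by auto
  let ?z = "gr m - y - {p}"
  have z: "?z \<in> Xset m" by (rule flip_vertex[OF assms(2) p(1)])
  have "x \<inter> ?z = x - y" using p Xset_subset[OF assms(1)] by auto
  moreover have "card (x - y) + card (x \<inter> y) = m"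
    using f Xset_card[OF assms(1)] card_Int_Diff[of x y] by simp
  ultimately have "(x, ?z) \<in> adjR m ^^ (2 * card (x \<inter> y))"
    by (intro walk_even[OF assms(1) z]) simp
  moreover have "(?z, y) \<in> adjR m" using z assms by (auto simp: adjR_def)
  ultimately show ?thesis by auto
qed

lemma odist_eq:
  assumes "x \<in> Xset m" "y \<in> Xset m"
  shows "odist m x y = min (2 * (m - card (x \<inter> y))) (2 * card (x \<inter> y) + 1)"
proof -
  have le: "card (x \<inter> y) \<le> m"
    using assms card_mono[OF Xset_finite_mem[OF assms(1)], of "x \<inter> y"] Xset_card by auto
  show ?thesis unfolding odist_def
  proof (rule Least_equality)
    have "(x, y) \<in> adjR m ^^ (2 * (m - card (x \<inter> y)))" using le assms by (intro walk_even) auto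
    with walk_odd[OF assms]
    show "(x, y) \<in> adjR m ^^ min (2 * (m - card (x \<inter> y))) (2 * card (x \<inter> y) + 1)"
      by (auto simp: min_def)
  next
    fix k assume "(x, y) \<in> adjR m ^^ k"
    from walk_bound[OF this assms(1)] 
    show "min (2 * (m - card (x \<inter> y))) (2 * card (x \<inter> y) + 1) \<le> k"
      by (cases "even k") auto
  qed
qed

text \<open>Inverse of the map from intersection size to distance in
  \<open>odist_eq\<close>.\<close>

definition level_of_dist :: "nat \<Rightarrow> nat \<Rightarrow> nat" where
  "level_of_dist m i = (if even i then m - i div 2 else i div 2)"

lemma level_of_dist_odist:
  assumes "x \<in> Xset m" "y \<in> Xset m"
  shows "level_of_dist m (odist m x y) = card (x \<inter> y)" "odist m x y \<le> m"
proof -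
  have le: "card (x \<inter> y) \<le> m"
    using assms card_mono[OF Xset_finite_mem[OF assms(1)], of "x \<inter> y"] Xset_card by auto
  then show "level_of_dist m (odist m x y) = card (x \<inter> y)" "odist m x y \<le> m"
    unfolding odist_eq[OF assms] level_of_dist_def min_def by auto
qed

lemma x0_in_Xset: "x0 m \<in> Xset m"
  by (auto simp: x0_def Xset_def)

lemma odist_eq_1_iff:
  assumes "x \<in> Xset m" "y \<in> Xset m" "m \<ge> 1"
  shows "odist m x y = 1 \<longleftrightarrow> x \<inter> y = {}"
proof -
  have "odist m x y = 1 \<longleftrightarrow> card (x \<inter> y) = 0" 
    unfolding odist_eq[OF assms(1,2)] using assms(3) by (auto simp: min_def)
  then show ?thesis using Xset_finite_mem[OF assms(1)] by auto
qed

section \<open>Matrices as operators, and a criterion for modules\<close>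

lemma mvec_Adist_1:
  assumes "m \<ge> 1"
  shows "mvec m (Adist m 1) v = flip m (gr m) v"
proof
  fix y
  show "mvec m (Adist m 1) v y = flip m (gr m) v y"
  proof (cases "y \<in> Xset m")
    case y: True
    have eq: "{z \<in> Xset m. y \<inter> z = {}} = (\<lambda>p. gr m - y - {p}) ` (gr m - y)"
    proof (intro equalityI subsetI)
      fix z assume z: "z \<in> {z \<in> Xset m. y \<inter> z = {}}"
      then have sub: "z \<subseteq> gr m - y" using Xset_subset by auto
      have "card (gr m - y - z) = 1"
        using z sub card_ground_Diff[OF y] by (subst card_Diff_subset) (auto simp: Xset_card Xset_finite_mem)
      then obtain p where "gr m - y - z = {p}" by (auto simp: card_1_singleton_iff)
      then have "z = gr m - y - {p}" "p \<in> gr m - y" using sub by auto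
      then show "z \<in> (\<lambda>p. gr m - y - {p}) ` (gr m - y)" by auto
    qed (auto intro: flip_vertex[OF y])
    have "mvec m (Adist m 1) v y = (\<Sum>z\<in>Xset m. if y \<inter> z = {} then v z else 0)"
      using y by (auto simp: mvec_def Adist_def odist_eq_1_iff[OF _ _ assms, simplified] intro!: sum.cong)
    also have "\<dots> = (\<Sum>z\<in>{z \<in> Xset m. y \<inter> z = {}}. v z)"
      by (simp add: sum.inter_filter finite_Xset)
    also have "\<dots> = (\<Sum>p\<in>gr m - y. v (gr m - y - {p}))"
      unfolding eq by (subst sum.reindex) (auto simp: inj_on_def)
    finally show ?thesis using y by (simp add: flip_def)
  qed (simp add: mvec_def flip_def)
qed

lemma mvec_Estar:
  "mvec m (Estar m i) v = (\<lambda>y. if y \<in> Xset m \<and> odist m (x0 m) y = i then v y else 0)"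
proof
  fix y
  have "(\<Sum>z\<in>Xset m. Estar m i y z * v z) = (\<Sum>z\<in>Xset m. if z = y then (if odist m (x0 m) y = i then v y else 0) else 0)"
    if "y \<in> Xset m" using that by (intro sum.cong) (auto simp: Estar_def)
  then show "mvec m (Estar m i) v y = (if y \<in> Xset m \<and> odist m (x0 m) y = i then v y else 0)"
    by (simp add: mvec_def finite_Xset)
qed

lemma mvec_mmult: "mvec m (mmult m M N) v = mvec m M (mvec m N v)"
proof
  fix y
  have "(\<Sum>z\<in>Xset m. (\<Sum>w\<in>Xset m. M y w * N w z) * v z) = (\<Sum>w\<in>Xset m. M y w * (\<Sum>z\<in>Xset m. N w z * v z))"
    unfolding sum_distrib_right sum_distrib_left by (subst sum.swap) (simp add: mult.assoc)
  then show "mvec m (mmult m M N) v y = mvec m M (mvec m N v) y"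
    by (simp add: mvec_def mmult_def)
qed

lemma T_moduleI:
  assumes "m \<ge> 1" and W: "is_subspace m W"
    and A: "\<And>w. w \<in> W \<Longrightarrow> flip m (gr m) w \<in> W"
    and L: "\<And>i w. w \<in> W \<Longrightarrow> (\<lambda>y. if y \<in> Xset m \<and> odist m (x0 m) y = i then w y else 0) \<in> W"
  shows "T_module m W"
proof -
  have "\<forall>w\<in>W. mvec m M w \<in> W" if "M \<in> Talg m" for M
    using that
  proof induction
    case (add M N)
    have "mvec m (\<lambda>y z. M y z + N y z) w = (\<lambda>y. mvec m M w y + mvec m N w y)" for w
      by (auto simp: mvec_def distrib_right sum.distrib)
    then show ?case using add W by (simp add: is_subspace_def)
  next
    case (smult M c)
    have "mvec m (\<lambda>y z. c * M y z) w = (\<lambda>y. c * mvec m M w y)" for w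
      by (auto simp: mvec_def sum_distrib_left mult.assoc)
    then show ?case using smult W by (simp add: is_subspace_def)
  qed (use A L in \<open>auto simp: mvec_Adist_1[OF assms(1), simplified] mvec_Estar mvec_mmult\<close>)
  then show ?thesis using W by (auto simp: T_module_def)
qed

lemma T_module_A: "T_module m W \<Longrightarrow> m \<ge> 1 \<Longrightarrow> w \<in> W \<Longrightarrow> flip m (gr m) w \<in> W"
  using mvec_Adist_1 Talg.gen_A unfolding T_module_def by metis

lemma T_module_add: "T_module m W \<Longrightarrow> v \<in> W \<Longrightarrow> w \<in> W \<Longrightarrow> (\<lambda>y. v y + w y) \<in> W"
  and T_module_scale: "T_module m W \<Longrightarrow> v \<in> W \<Longrightarrow> (\<lambda>y. c * v y) \<in> W"
  and T_module_zero: "T_module m W \<Longrightarrow> (\<lambda>y. 0) \<in> W"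
  and T_module_Vspace: "T_module m W \<Longrightarrow> v \<in> W \<Longrightarrow> v \<in> Vspace m"
  by (auto simp: T_module_def is_subspace_def)

lemma T_module_diff:
  assumes "T_module m W" "v \<in> W" "w \<in> W"
  shows "(\<lambda>y. v y - w y) \<in> W"
  using T_module_add[OF assms(1,2) T_module_scale[OF assms(1,3), of "-1"]] by simp

lemma T_module_sum:
  assumes "T_module m W" "finite I" "\<And>i. i \<in> I \<Longrightarrow> f i \<in> W"
  shows "(\<lambda>y. \<Sum>i\<in>I. f i y) \<in> W"
  using assms(2,3)
  by (induction I) (auto simp: T_module_zero[OF assms(1)] intro: T_module_add[OF assms(1)])

text \<open>The distance determines the intersection size, so a function of the level is a linear
  combination of the \<open>Estar m i\<close>.\<close>

lemma T_module_level:
  assumes W: "T_module m W" and v: "v \<in> W"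
  shows "(\<lambda>y. f (card (x0 m \<inter> y)) * v y) \<in> W"
proof -
  let ?E = "\<lambda>i. mvec m (Estar m i) v"
  have "?E i \<in> W" if "i \<le> m" for i
    using W v Talg.gen_Es[OF that] by (auto simp: T_module_def)
  then have "(\<lambda>y. \<Sum>i\<le>m. f (level_of_dist m i) * ?E i y) \<in> W"
    by (intro T_module_sum[OF W] T_module_scale[OF W]) auto
  also have "(\<lambda>y. \<Sum>i\<le>m. f (level_of_dist m i) * ?E i y) = (\<lambda>y. f (card (x0 m \<inter> y)) * v y)"
  proof
    fix y
    show "(\<Sum>i\<le>m. f (level_of_dist m i) * ?E i y) = f (card (x0 m \<inter> y)) * v y"
    proof (cases "y \<in> Xset m")
      case True
      have "(\<Sum>i\<le>m. f (level_of_dist m i) * ?E i y)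
        = (\<Sum>i\<le>m. if i = odist m (x0 m) y then f (level_of_dist m (odist m (x0 m) y)) * v y else 0)"
        using True by (intro sum.cong) (auto simp: mvec_Estar)
      then show ?thesis using level_of_dist_odist[OF x0_in_Xset True] by simp
    qed (use Vspace_outside[OF T_module_Vspace[OF W v]] in \<open>auto simp: mvec_Estar\<close>)
  qed
  finally show ?thesis .
qed

subsection \<open>Bounds on Casimir eigenvalues\<close>

text \<open>The operator in question is \<open>L^* L\<close>, where \<open>L\<close> maps functions
  on \<open>m\<close>-sets to functions on \<open>(m - 1)\<close>-sets by summing over the ways to
  add a point of \<open>P\<close>; hence it is positive.\<close>

lemma gram_identity:
  assumes P: "P \<subseteq> gr m" and w: "w \<in> Vspace m"
  shows "\<exists>r\<ge>0. (\<Sum>y\<in>Xset m. w y * cnj (of_nat (card (P \<inter> y)) * w y + swp m P w y)) = of_real r"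
proof -
  have finP: "finite P" using P finite_gr finite_subset by blast
  define L where "L z = (\<Sum>q\<in>P - z. w (insert q z))" for z
  let ?Z = "Pow (gr m)"
  have finZ: "finite ?Z" by (simp add: finite_gr)
  have "(\<Sum>z\<in>?Z. L z * cnj (L z)) = (\<Sum>z\<in>?Z. \<Sum>q\<in>P - z. w (insert q z) * cnj (L z))"
    by (simp add: L_def sum_distrib_right)
  also have "\<dots> = (\<Sum>(z,q)\<in>Sigma ?Z (\<lambda>z. P - z). w (insert q z) * cnj (L z))"
    using finP finZ by (intro sum.Sigma) auto
  also have "\<dots> = (\<Sum>(y,q)\<in>Sigma ?Z (\<lambda>y. P \<inter> y). w y * cnj (L (y - {q})))"
    by (rule sum.reindex_bij_witness[of _ "\<lambda>(y,q). (y - {q}, q)" "\<lambda>(z,q). (insert q z, q)"])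
       (use P in \<open>auto simp: insert_absorb\<close>)
  also have "\<dots> = (\<Sum>y\<in>?Z. \<Sum>q\<in>P \<inter> y. w y * cnj (L (y - {q})))"
    using finP finZ by (intro sum.Sigma[symmetric]) auto
  also have "\<dots> = (\<Sum>y\<in>Xset m. \<Sum>q\<in>P \<inter> y. w y * cnj (L (y - {q})))"
    using finZ w by (intro sum.mono_neutral_right) (auto simp: Vspace_def dest: Xset_subset)
  also have "\<dots> = (\<Sum>y\<in>Xset m. w y * cnj (of_nat (card (P \<inter> y)) * w y + swp m P w y))"
  proof (rule sum.cong[OF refl])
    fix y assume y: "y \<in> Xset m"
    have "L (y - {q}) = w y + (\<Sum>p\<in>P - y. w (insert p y - {q}))" if q: "q \<in> P \<inter> y" for q
    proof -
      have "P - (y - {q}) = insert q (P - y)" using q by auto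
      then have "L (y - {q}) = w (insert q (y - {q})) + (\<Sum>p\<in>P - y. w (insert p (y - {q})))"
        unfolding L_def using q finP by simp
      also have "insert q (y - {q}) = y" using q by auto
      also have "(\<Sum>p\<in>P - y. w (insert p (y - {q}))) = (\<Sum>p\<in>P - y. w (insert p y - {q}))"
        using q by (intro sum.cong refl arg_cong[of _ _ w]) auto
      finally show ?thesis .
    qed
    then have "(\<Sum>q\<in>P \<inter> y. L (y - {q})) = (\<Sum>q\<in>P \<inter> y. w y + (\<Sum>p\<in>P - y. w (insert p y - {q})))"
      by (rule sum.cong[OF refl])
    also have "\<dots> = of_nat (card (P \<inter> y)) * w y + swp m P w y"
      using y by (simp add: swp_def sum.distrib) (rule sum.swap)
    finally show "(\<Sum>q\<in>P \<inter> y. w y * cnj (L (y - {q}))) = w y * cnj (of_nat (card (P \<inter> y)) * w y + swp m P w y)"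
      by (simp only: sum_distrib_left[symmetric] cnj_sum[symmetric])
  qed
  finally have "(\<Sum>y\<in>Xset m. w y * cnj (of_nat (card (P \<inter> y)) * w y + swp m P w y)) = of_real (\<Sum>z\<in>?Z. (norm (L z))\<^sup>2)"
    by (simp add: complex_norm_square del: of_real_power)
  moreover have "0 \<le> (\<Sum>z\<in>?Z. (norm (L z))\<^sup>2)" by (intro sum_nonneg) simp
  ultimately show ?thesis by blast
qed

text \<open>The lower bound is positivity of the Gram operator. The upper bound is read off where
  \<open>norm (w y)\<close> is maximal, since \<open>swp\<close> sums only \<open>a * b\<close>
  values there.\<close>

lemma casim_eigenvalue_bounds:
  assumes P: "P \<subseteq> gr m" and w: "w \<in> Vspace m" "w \<noteq> (\<lambda>_. 0)"
    and supp: "\<And>y. y \<in> Xset m \<Longrightarrow> w y \<noteq> 0 \<Longrightarrow> card (P - y) = a \<and> card (P \<inter> y) = b"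
    and eig: "\<And>y. y \<in> Xset m \<Longrightarrow> casim m P w y = of_real c * w y"
  shows "- real b - real a * real b \<le> c" "c \<le> 0"
proof -
  obtain y0 where y0: "w y0 \<noteq> 0" using w(2) by auto
  then have y0X: "y0 \<in> Xset m" using w(1) Vspace_outside by blast
  have swp: "swp m P w y = of_real (c + real a * real b) * w y" if "y \<in> Xset m" "w y \<noteq> 0" for y
    using eig[OF that(1)] supp[OF that] by (simp add: casim_def algebra_simps)
  obtain r where r: "r \<ge> 0" "(\<Sum>y\<in>Xset m. w y * cnj (of_nat (card (P \<inter> y)) * w y + swp m P w y)) = of_real r"
    using gram_identity[OF P w(1)] by blast
  have "(\<Sum>y\<in>Xset m. w y * cnj (of_nat (card (P \<inter> y)) * w y + swp m P w y))
     = (\<Sum>y\<in>Xset m. of_real ((real b + c + real a * real b) * (norm (w y))\<^sup>2))"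
  proof (rule sum.cong[OF refl])
    fix y assume y: "y \<in> Xset m"
    show "w y * cnj (of_nat (card (P \<inter> y)) * w y + swp m P w y) = of_real ((real b + c + real a * real b) * (norm (w y))\<^sup>2)"
    proof (cases "w y = 0")
      case False
      then have "of_nat (card (P \<inter> y)) * w y + swp m P w y = of_real (real b + c + real a * real b) * w y"
        using swp[OF y False] supp[OF y False] by (simp add: algebra_simps)
      then show ?thesis using complex_norm_square[of "w y"]
        by (simp del: of_real_add of_real_power add: mult.left_commute)
    qed simp
  qed
  also have "\<dots> = of_real ((real b + c + real a * real b) * (\<Sum>y\<in>Xset m. (norm (w y))\<^sup>2))"
    by (simp add: sum_distrib_left)
  finally have "(real b + c + real a * real b) * (\<Sum>y\<in>Xset m. (norm (w y))\<^sup>2) \<ge> 0"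
    using r by (metis of_real_eq_iff)
  moreover have "(\<Sum>y\<in>Xset m. (norm (w y))\<^sup>2) > 0"
    by (rule sum_pos2[OF finite_Xset y0X]) (use y0 in auto)
  ultimately show "- real b - real a * real b \<le> c" by (simp add: zero_le_mult_iff)
  define M where "M = Max ((\<lambda>y. norm (w y)) ` Xset m)"
  have M: "norm (w y) \<le> M" for y
  proof (cases "y \<in> Xset m")
    case True then show ?thesis unfolding M_def using finite_Xset by auto
  next
    case False
    have "norm (w y0) \<le> M" unfolding M_def using finite_Xset y0X by auto
    then show ?thesis using False Vspace_outside[OF w(1)] order_trans[OF norm_ge_zero[of "w y0"]] by simp
  qed
  have "M \<in> (\<lambda>y. norm (w y)) ` Xset m" unfolding M_def using finite_Xset y0X by (intro Max_in) auto
  then obtain y where y: "y \<in> Xset m" "norm (w y) = M" by auto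
  have "M > 0" using M[of y0] y0 by (smt (verit) zero_less_norm_iff)
  then have wy: "w y \<noteq> 0" using y by auto
  have "norm (swp m P w y) \<le> (\<Sum>p\<in>P - y. \<Sum>q\<in>P \<inter> y. M)"
    unfolding swp_def if_P[OF y(1)] by (intro sum_norm_le M)
  also have "\<dots> = real a * real b * M" using supp[OF y(1) wy] by simp
  finally have "\<bar>c + real a * real b\<bar> * M \<le> real a * real b * M"
    using swp[OF y(1) wy] y(2) by (simp add: norm_mult del: of_real_add)
  then show "c \<le> 0" using \<open>M > 0\<close> by simp
qed

section \<open>Levels and Casimir eigenspaces in modules\<close>

context halves begin

lemma x0_cases: "P = x0 m \<and> n = m \<or> Q = x0 m \<and> n = m + 1"
  using halves unfolding x0_def by (elim disjE) (intro disjI1, simp, intro disjI2, simp)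

text \<open>If \<open>Q\<close> is the base vertex then \<open>n = m + 1\<close> and
  \<open>card (Q \<inter> y) = s y - 1\<close>, whence the shift by one in the second case.\<close>

definition lev_of_s :: "nat \<Rightarrow> nat" where "lev_of_s k = (if P = x0 m then m - k else k - 1)"
definition s_of_lev :: "nat \<Rightarrow> nat" where "s_of_lev t = (if P = x0 m then m - t else t + 1)"
definition dist_s :: "nat \<Rightarrow> nat" where
  "dist_s k = min (2 * (m - lev_of_s k)) (2 * lev_of_s k + 1)"

lemma P_eq_x0_iff: "P = x0 m \<longleftrightarrow> n = m"
proof
  assume "P = x0 m"
  then have "n = card (x0 m)" by (rule arg_cong)
  then show "n = m" by (simp add: x0_def)
qed (use x0_cases in simp)

lemma lev_s:
  assumes "y \<in> X"
  shows "card (x0 m \<inter> y) = lev_of_s (s y)" "s y = s_of_lev (card (x0 m \<inter> y))"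
proof -
  consider "P = x0 m" "n = m" | "P \<noteq> x0 m" "Q = x0 m" "n = m + 1"
    using x0_cases P_eq_x0_iff by auto
  then have "card (x0 m \<inter> y) = lev_of_s (s y) \<and> s y = s_of_lev (card (x0 m \<inter> y))"
  proof cases
    case 1
    show ?thesis
      unfolding lev_of_s_def s_of_lev_def if_P[OF 1(1)] unfolding 1(1)[symmetric] card_P_Int
      using s_le[of y] 1(2) by simp
  next
    case 2
    then show ?thesis using card_Q_Int[OF assms] by (auto simp: lev_of_s_def s_of_lev_def)
  qed
  then show "card (x0 m \<inter> y) = lev_of_s (s y)" "s y = s_of_lev (card (x0 m \<inter> y))" by blast+
qed

lemma odist_s: "y \<in> X \<Longrightarrow> odist m (x0 m) y = dist_s (s y)"
  using odist_eq[OF x0_in_Xset] lev_s(1) by (simp add: dist_s_def)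

lemma s_odist: "y \<in> X \<Longrightarrow> s y = s_of_lev (level_of_dist m (odist m (x0 m) y))"
  using level_of_dist_odist(1)[OF x0_in_Xset] lev_s(2) by metis

lemma T_module_s:
  assumes "T_module m W" "v \<in> W"
  shows "(\<lambda>y. f (s y) * v y) \<in> W"
proof -
  have "(\<lambda>y. f (s y) * v y) = (\<lambda>y. f (s_of_lev (card (x0 m \<inter> y))) * v y)"
    using Vspace_outside[OF T_module_Vspace[OF assms]] lev_s(2) by (metis mult_zero_right)
  then show ?thesis using T_module_level[OF assms, of "\<lambda>t. f (s_of_lev t)"] by simp
qed

lemma T_module_FP:
  assumes "m \<ge> 1" "T_module m W" "v \<in> W"
  shows "FP v \<in> W"
proof -
  note W = assms(2)
  have "A v \<in> W" by (rule T_module_A[OF W assms(1,3)])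
  moreover have "A (K v) \<in> W" by (rule T_module_A[OF W assms(1) T_module_s[OF W assms(3)]])
  ultimately show ?thesis
    unfolding FP_from_A[of v]
    by (intro T_module_diff[OF W] T_module_add[OF W] T_module_s[OF W] T_module_scale[OF W])
qed

lemma T_module_FQ:
  assumes "m \<ge> 1" "T_module m W" "v \<in> W"
  shows "FQ v \<in> W"
  using halves.T_module_FP[OF swap_halves assms] .

text \<open>The Casimir commutes with \<open>A\<close> and with multiplication by functions of
  \<open>s\<close>, hence with all generators.\<close>

lemma casim_eigenspace_T_module:
  assumes "m \<ge> 1" and W: "T_module m W"
  shows "T_module m {v \<in> W. casim m P v = (\<lambda>y. c * v y)}" (is "T_module m ?U")
proof (rule T_moduleI[OF assms(1)])
  show "is_subspace m ?U"
    unfolding is_subspace_def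
  proof (intro conjI ballI allI)
    show "?U \<subseteq> Vspace m" using T_module_Vspace[OF W] by auto
    show "(\<lambda>_. 0) \<in> ?U" using T_module_zero[OF W] by (auto simp: casim_def swp_def)
    show "(\<lambda>y. v y + w y) \<in> ?U" if "v \<in> ?U" "w \<in> ?U" for v w
      using that T_module_add[OF W] by (auto simp: casim_add distrib_left)
    show "(\<lambda>y. b * v y) \<in> ?U" if "v \<in> ?U" for b v
      using that T_module_scale[OF W] by (auto simp: casim_scale mult.left_commute)
  qed
next
  fix w assume w: "w \<in> ?U"
  then show "A w \<in> ?U" using T_module_A[OF W assms(1)] by (auto simp: casim_A flip_scale)
next
  fix i w assume w: "w \<in> ?U"
  let ?f = "\<lambda>k. if dist_s k = i then 1 else (0::complex)"
  have eq: "(\<lambda>y. if y \<in> X \<and> odist m (x0 m) y = i then w y else 0) = (\<lambda>y. ?f (s y) * w y)"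
    using w Vspace_outside[OF T_module_Vspace[OF W]] by (auto simp: odist_s fun_eq_iff)
  show "(\<lambda>y. if y \<in> X \<and> odist m (x0 m) y = i then w y else 0) \<in> ?U"
    unfolding eq using T_module_s[OF W, of w ?f] w casim_level[of ?f w] by (auto simp: fun_eq_iff)
qed

text \<open>Schur's lemma from one known eigenvector: its eigenspace is a nonzero submodule.\<close>

lemma irreducible_casim:
  assumes "m \<ge> 1" and W: "irreducible_T_module m W"
    and w: "w \<in> W" "w \<noteq> (\<lambda>_. 0)" "casim m P w = (\<lambda>y. c * w y)" and v: "v \<in> W"
  shows "casim m P v = (\<lambda>y. c * v y)"
proof -
  have T: "T_module m W" using W by (simp add: irreducible_T_module_def)
  let ?U = "{v \<in> W. casim m P v = (\<lambda>y. c * v y)}"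
  have "?U = {\<lambda>_. 0} \<or> ?U = W"
    using W casim_eigenspace_T_module[OF assms(1) T] unfolding irreducible_T_module_def by auto
  then show ?thesis using w v by blast
qed

end

subsection \<open>Irreducible modules\<close>

lemma flip_zero [simp]: "flip m P (\<lambda>_. 0) = (\<lambda>_. 0)"
  by (simp add: flip_def fun_eq_iff)

lemma mvec_add: "mvec m M (\<lambda>y. u y + v y) = (\<lambda>y. mvec m M u y + mvec m M v y)"
  by (auto simp: mvec_def distrib_left sum.distrib)

lemma mvec_diff: "mvec m M (\<lambda>y. u y - v y) = (\<lambda>y. mvec m M u y - mvec m M v y)"
  by (auto simp: mvec_def right_diff_distrib sum_subtractf)

lemma mvec_scale: "mvec m M (\<lambda>y. c * v y) = (\<lambda>y. c * mvec m M v y)"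
  by (auto simp: mvec_def sum_distrib_left mult.left_commute)

section \<open>Modules under the expected spectrum\<close>

definition odd_eigenvalue :: "nat \<Rightarrow> nat \<Rightarrow> int" where
  "odd_eigenvalue m j = (-1) ^ j * (int m + 1 - int j)"

lemma odd_eigenvalue_inj:
  assumes "i \<le> m" "j \<le> m" "odd_eigenvalue m i = odd_eigenvalue m j"
  shows "i = j"
  using assms by (cases "even i"; cases "even j") (auto simp: odd_eigenvalue_def)

text \<open>For indices of equal parity the sum has absolute value at least \<open>2\<close>; for
  opposite parity its absolute value is the distance of the indices.\<close>

lemma odd_eigenvalue_sum:
  assumes "i \<le> m" "j \<le> m" "(odd_eigenvalue m i + odd_eigenvalue m j)\<^sup>2 = 1"
  shows "i = j + 1 \<or> j = i + 1"
proof -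
  have "odd_eigenvalue m i + odd_eigenvalue m j = 1 \<or> odd_eigenvalue m i + odd_eigenvalue m j = -1"
    using assms(3) by (simp add: power2_eq_1_iff)
  then show ?thesis using assms(1,2) by (cases "even i"; cases "even j") (auto simp: odd_eigenvalue_def)
qed

text \<open>All that the classification needs from the idempotents;
  \<open>Q_polynomial_odd_spectrum\<close> provides it for every Q-polynomial ordering.\<close>

locale odd_spectrum =
  fixes m :: nat and E :: "nat \<Rightarrow> mat"
  assumes m_pos: "m \<ge> 1"
    and A_E: "j \<le> m \<Longrightarrow> flip m (gr m) (mvec m (E j) v) = (\<lambda>y. of_int (odd_eigenvalue m j) * mvec m (E j) v y)"
    and E_A: "j \<le> m \<Longrightarrow> mvec m (E j) (flip m (gr m) v) = (\<lambda>y. of_int (odd_eigenvalue m j) * mvec m (E j) v y)"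
    and E_sum: "v \<in> Vspace m \<Longrightarrow> (\<lambda>y. \<Sum>j\<le>m. mvec m (E j) v y) = v"
begin

lemma E_eigenvector:
  assumes "flip m (gr m) v = (\<lambda>y. of_int (odd_eigenvalue m i) * v y)" "i \<le> m" "j \<le> m" "j \<noteq> i"
  shows "mvec m (E j) v = (\<lambda>_. 0)"
proof
  fix y
  have "of_int (odd_eigenvalue m j) * mvec m (E j) v y = of_int (odd_eigenvalue m i) * mvec m (E j) v y"
    using E_A[OF assms(3), of v] unfolding assms(1) mvec_scale by metis
  moreover have "odd_eigenvalue m j \<noteq> odd_eigenvalue m i" using odd_eigenvalue_inj assms by blast
  ultimately show "mvec m (E j) v y = 0" by simp
qed

lemma eigenvector_if_E:
  assumes "v \<in> Vspace m" "i \<le> m" "\<And>j. j \<le> m \<Longrightarrow> j \<noteq> i \<Longrightarrow> mvec m (E j) v = (\<lambda>_. 0)"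
  shows "mvec m (E i) v = v" "flip m (gr m) v = (\<lambda>y. of_int (odd_eigenvalue m i) * v y)"
proof -
  have "v = (\<lambda>y. \<Sum>j\<le>m. mvec m (E j) v y)" using E_sum[OF assms(1)] by simp
  also have "\<dots> = (\<lambda>y. \<Sum>j\<le>m. if j = i then mvec m (E i) v y else 0)"
    using assms(3) by (intro ext sum.cong) (auto dest: fun_cong)
  finally show 1: "mvec m (E i) v = v" using assms(2) by (simp add: fun_eq_iff)
  show "flip m (gr m) v = (\<lambda>y. of_int (odd_eigenvalue m i) * v y)"
    using A_E[OF assms(2), of v] unfolding 1 .
qed

text \<open>\<open>mvec m (E i) w\<close> is not in \<open>W\<close> by definition. The product of
  \<open>A - \<theta>_k\<close> over all \<open>k \<noteq> i\<close> is a polynomial in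
  \<open>A\<close>, so it preserves \<open>W\<close>, and it isolates the component of
  \<open>w\<close> at \<open>i\<close>.\<close>

lemma T_module_eigenvector:
  assumes W: "T_module m W" and w: "w \<in> W" and i: "i \<le> m" "mvec m (E i) w \<noteq> (\<lambda>_. 0)"
  shows "\<exists>v\<in>W. v \<noteq> (\<lambda>_. 0) \<and> flip m (gr m) v = (\<lambda>y. of_int (odd_eigenvalue m i) * v y)"
proof -
  have ex: "\<exists>u\<in>W. \<forall>j\<le>m. mvec m (E j) u = (\<lambda>y. (\<Prod>k\<in>F. of_int (odd_eigenvalue m j - odd_eigenvalue m k)) * mvec m (E j) w y)"
    if "finite F" for F
    using that
  proof induction
    case empty
    then show ?case using w by auto
  next
    case (insert k F)
    then obtain u where u: "u \<in> W" "\<forall>j\<le>m. mvec m (E j) u = (\<lambda>y. (\<Prod>k\<in>F. of_int (odd_eigenvalue m j - odd_eigenvalue m k)) * mvec m (E j) w y)"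
      by auto
    let ?u = "\<lambda>y. flip m (gr m) u y - of_int (odd_eigenvalue m k) * u y"
    have "?u \<in> W" using T_module_A[OF W m_pos u(1)] u(1) by (intro T_module_diff[OF W] T_module_scale[OF W])
    moreover have "mvec m (E j) ?u = (\<lambda>y. (\<Prod>k\<in>insert k F. of_int (odd_eigenvalue m j - odd_eigenvalue m k)) * mvec m (E j) w y)"
      if "j \<le> m" for j
      unfolding mvec_diff mvec_scale E_A[OF that] u(2)[rule_format, OF that]
      using insert by (auto simp: algebra_simps)
    ultimately show ?case by blast
  qed
  from ex[of "{..m} - {i}"] obtain u where u: "u \<in> W" "\<forall>j\<le>m. mvec m (E j) u = (\<lambda>y. (\<Prod>k\<in>{..m} - {i}. of_int (odd_eigenvalue m j - odd_eigenvalue m k)) * mvec m (E j) w y)"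
    by auto
  have z: "mvec m (E j) u = (\<lambda>_. 0)" if "j \<le> m" "j \<noteq> i" for j
  proof -
    have "(\<Prod>k\<in>{..m} - {i}. of_int (odd_eigenvalue m j - odd_eigenvalue m k)) = (0::complex)"
      using that by (intro prod_zero) auto
    from u(2)[rule_format, OF that(1), unfolded this] show ?thesis by simp
  qed
  have nz: "(\<Prod>k\<in>{..m} - {i}. of_int (odd_eigenvalue m i - odd_eigenvalue m k)) \<noteq> (0::complex)"
    using odd_eigenvalue_inj i by (auto simp: prod_zero_iff)
  have "mvec m (E i) u = u" "flip m (gr m) u = (\<lambda>y. of_int (odd_eigenvalue m i) * u y)"
    using eigenvector_if_E[OF T_module_Vspace[OF W u(1)] i(1) z] by auto
  moreover have "mvec m (E i) u \<noteq> (\<lambda>_. 0)"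
    using u(2) i nz by (auto simp: fun_eq_iff)
  ultimately show ?thesis using u(1) by metis
qed

end

text \<open>\<open>\<alpha>\<close> marks the level of \<open>W\<close> nearest to the base vertex.
  The range is what minimality of the distance says, and \<open>FP\<close> would send the bottom
  level to \<open>n + 1 - \<alpha>\<close>, just outside it.\<close>

locale module_bottom = halves m P Q + odd_spectrum m E for m P Q E +
  fixes W :: "vec set" and \<alpha> :: nat
  assumes irr: "irreducible_T_module m W"
    and bottom: "\<exists>w\<in>W. \<exists>y\<in>Xset m. s y = \<alpha> \<and> w y \<noteq> 0"
    and range: "\<And>w y. w \<in> W \<Longrightarrow> w y \<noteq> 0 \<Longrightarrow> \<alpha> \<le> s y \<and> s y + \<alpha> \<le> n"
begin

lemma T: "T_module m W" using irr by (simp add: irreducible_T_module_def)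

lemma casim_Q_if_FQ_FQ_zero:
  assumes "z \<in> X" "FQ (FQ v) z = 0"
  shows "casim m Q v z = - (of_nat ((m + 1 - s z) * (m + 1 + s z - n)) * v z)"
  by (rule eq_neg_iff_add_eq_0[THEN iffD2]) (rule trans[OF FQ_FQ[OF assms(1), symmetric] assms(2)])

lemma two_alpha: "2 * \<alpha> \<le> n"
proof -
  obtain w y where w: "w \<in> W" "s y = \<alpha>" "w y \<noteq> 0" using bottom by blast
  show ?thesis using range[OF w(1,3)] w(2) by linarith
qed

lemma bottom_vector:
  obtains w where "w \<in> W" "w \<noteq> (\<lambda>_. 0)" "\<And>y. w y \<noteq> 0 \<Longrightarrow> s y = \<alpha>"
proof -
  obtain w y where w: "w \<in> W" "y \<in> Xset m" "s y = \<alpha>" "w y \<noteq> 0" using bottom by auto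
  let ?w = "\<lambda>y. (if s y = \<alpha> then 1 else 0) * w y"
  have "?w \<in> W" using T_module_s[OF T w(1), of "\<lambda>k. if k = \<alpha> then 1 else 0"] .
  moreover have "?w \<noteq> (\<lambda>_. 0)" using w by (auto simp: fun_eq_iff)
  moreover have "s y = \<alpha>" if "?w y \<noteq> 0" for y using that by (simp split: if_splits)
  ultimately show thesis using that[of ?w] by blast
qed

lemma W_zero: "w \<in> W \<Longrightarrow> s y < \<alpha> \<or> n < s y + \<alpha> \<Longrightarrow> w y = 0"
  using range[of w y] by linarith

lemma casim_P_W:
  assumes "v \<in> W"
  shows "casim m P v = (\<lambda>y. - of_nat (\<alpha> * (n + 1 - \<alpha>)) * v y)"
proof -
  obtain w where w: "w \<in> W" "w \<noteq> (\<lambda>_. 0)" "\<And>y. w y \<noteq> 0 \<Longrightarrow> s y = \<alpha>" using bottom_vector by metis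
  have "FP w y = 0" for y
  proof (cases "s y = n + 1 - \<alpha>")
    case True
    then show ?thesis using W_zero[OF T_module_FP[OF m_pos T w(1)], of y] two_alpha by auto
  next
    case False
    have "FP w y = FP (\<lambda>_. 0) y"
      by (rule FP_local) (use False w(3) s_le[of y] in fastforce)
    then show ?thesis by (simp add: flip_def)
  qed
  then have "FP (FP w) = (\<lambda>_. 0)" by (simp add: flip_def fun_eq_iff)
  then have "casim m P w y = - of_nat (\<alpha> * (n + 1 - \<alpha>)) * w y" if "y \<in> X" for y
    using FP_FP[OF that, of w] w(3)[of y] by (cases "w y = 0") (auto simp: add_eq_0_iff)
  moreover have "casim m P w y = - of_nat (\<alpha> * (n + 1 - \<alpha>)) * w y" if "y \<notin> X" for y
    using that Vspace_outside[OF T_module_Vspace[OF T w(1)]] by (simp add: casim_def swp_def)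
  ultimately have "casim m P w = (\<lambda>y. - of_nat (\<alpha> * (n + 1 - \<alpha>)) * w y)" by blast
  from irreducible_casim[OF m_pos irr w(1,2) this assms] show ?thesis .
qed

text \<open>The bounds come from a vector on the bottom level, where
  \<open>card (Q - y) = m + 1 - \<alpha>\<close> and
  \<open>card (Q \<inter> y) = m + \<alpha> - n\<close>.\<close>

lemma casim_Q_scalar:
  assumes "u \<in> W" "u \<noteq> (\<lambda>_. 0)" "\<And>y. y \<in> X \<Longrightarrow> casim m Q u y = of_real c * u y"
  shows "v \<in> W \<Longrightarrow> casim m Q v = (\<lambda>y. of_real c * v y)"
    and "- (real m + \<alpha> - n) * (real m + 2 - \<alpha>) \<le> c" and "c \<le> 0"
proof -
  have "casim m Q u y = of_real c * u y" if "y \<notin> X" for y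
    using that Vspace_outside[OF T_module_Vspace[OF T assms(1)]] by (simp add: casim_def swp_def)
  then have "casim m Q u = (\<lambda>y. of_real c * u y)" using assms(3) by blast
  note * = halves.irreducible_casim[OF swap_halves m_pos irr assms(1,2) this]
  then show "v \<in> W \<Longrightarrow> casim m Q v = (\<lambda>y. of_real c * v y)" .
  obtain w where w: "w \<in> W" "w \<noteq> (\<lambda>_. 0)" "\<And>y. w y \<noteq> 0 \<Longrightarrow> s y = \<alpha>" using bottom_vector by metis
  obtain y where y: "w y \<noteq> 0" using w(2) by auto
  then have yX: "y \<in> X" using Vspace_outside[OF T_module_Vspace[OF T w(1)]] by blast
  have supp: "card (Q - y) = m + 1 - \<alpha> \<and> card (Q \<inter> y) = m + \<alpha> - n" if "y \<in> X" "w y \<noteq> 0" for y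
    using card_Q_Diff[OF that(1)] card_Q_Int[OF that(1)] w(3)[OF that(2)] by auto
  have le: "n \<le> m + \<alpha>" "\<alpha> \<le> m + 1" using card_Q_Diff[OF yX] card_Q_Int[OF yX] w(3)[OF y] by auto
  have "casim m Q w y = of_real c * w y" if "y \<in> X" for y using *[OF w(1)] by (simp add: fun_eq_iff)
  from casim_eigenvalue_bounds[OF Q_sub T_module_Vspace[OF T w(1)] w(2) supp this]
  have "- real (m + \<alpha> - n) - real (m + 1 - \<alpha>) * real (m + \<alpha> - n) \<le> c" "c \<le> 0" by auto
  then show "- (real m + \<alpha> - n) * (real m + 2 - \<alpha>) \<le> c" "c \<le> 0"
    using le by (simp_all add: of_nat_diff algebra_simps)
qed

lemma alpha_bounds: "n \<le> m + \<alpha>" "\<alpha> \<le> m"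
proof -
  obtain y where "y \<in> Xset m" "s y = \<alpha>" using bottom by auto
  then show "n \<le> m + \<alpha>" using card_Q_Int[of y] by auto
  show "\<alpha> \<le> m" using two_alpha cardP m_pos by auto
qed

text \<open>Descending through the levels in order of distance, the first one on which \<open>v\<close> lives is killed
  by \<open>FP\<close> or \<open>FQ\<close>, which fixes a Casimir eigenvalue incompatible with \<open>\<alpha>\<close> unless it is the bottom level.\<close>

lemma eigenvector_bottom:
  assumes v: "v \<in> W" "v \<noteq> (\<lambda>_. 0)" and eig: "A v = (\<lambda>y. \<theta> * v y)"
  shows "\<exists>y\<in>X. s y = \<alpha> \<and> v y \<noteq> 0"
proof (rule ccontr)
  assume neg: "\<not> (\<exists>y\<in>X. s y = \<alpha> \<and> v y \<noteq> 0)"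
  have outside: "v y = 0" if "y \<notin> X" for y using Vspace_outside[OF T_module_Vspace[OF T v(1)] that] .
  have "\<forall>y. s y < \<alpha> + j \<or> n < s y + \<alpha> + j \<longrightarrow> v y = 0" for j
  proof (induction j)
    case 0
    then show ?case using W_zero[OF v(1)] by auto
  next
    case (Suc j)
    have IH: "v y = 0" if "s y < \<alpha> + j \<or> n < s y + \<alpha> + j" for y using Suc that by blast
    have AP: "FP v y + FQ v y = \<theta> * v y" for y using fun_cong[OF eig, of y] by (simp add: A_eq)
    have c1: "v y = 0" if "s y = \<alpha> + j" for y
    proof (rule ccontr)
      assume vy: "v y \<noteq> 0"
      then have yX: "y \<in> X" using outside by blast
      have j: "j > 0" using neg vy that yX by (cases j) auto
      have jn: "2 * \<alpha> + j \<le> n" using range[OF v(1) vy] that by linarith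
      let ?v = "\<lambda>y. (if s y = \<alpha> + j then 1 else 0) * v y"
      have vW: "?v \<in> W" using T_module_s[OF T v(1), of "\<lambda>k. if k = \<alpha> + j then 1 else 0"] .
      \<comment> \<open>At level \<open>n + 1 - (\<alpha> + j)\<close> both \<open>v\<close> and
        \<open>FQ v\<close> vanish, the latter because it reads level
        \<open>\<alpha> + j - 1\<close>; the eigenvalue equation then leaves
        \<open>FP v = 0\<close>.\<close>
      have "FP ?v z = 0" for z
      proof (cases "s z + \<alpha> + j = n + 1")
        case True
        then have "v z = 0" using IH[of z] by simp
        moreover have "FQ v z = FQ (\<lambda>_. 0) z"
          by (rule FQ_local, rule IH) (use True j jn in auto)
        ultimately have "FP v z = 0" using AP[of z] by simp
        then show ?thesis by (simp add: FP_level[of "\<lambda>k. if k = \<alpha> + j then 1 else 0"])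
      next
        case False
        then show ?thesis using jn s_le[of z] by (auto simp: FP_level[of "\<lambda>k. if k = \<alpha> + j then 1 else 0"])
      qed
      then have "FP ?v = (\<lambda>_. 0)" by blast
      then have "FP (FP ?v) y = 0" by simp
      then have "of_nat ((\<alpha> + j) * (n + 1 - (\<alpha> + j))) * v y - of_nat (\<alpha> * (n + 1 - \<alpha>)) * v y = 0"
        using FP_FP[OF yX, of ?v] fun_cong[OF casim_P_W[OF vW], of y] that
        by (simp del: of_nat_mult of_nat_add of_nat_Suc)
      then have "of_nat (\<alpha> * (n + 1 - \<alpha>)) = (of_nat ((\<alpha> + j) * (n + 1 - (\<alpha> + j))) :: complex)"
        using vy by (simp del: of_nat_mult of_nat_add of_nat_Suc flip: left_diff_distrib)
      then have "\<alpha> * (n + 1 - \<alpha>) = (\<alpha> + j) * (n + 1 - (\<alpha> + j))" by (simp only: of_nat_eq_iff)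
      moreover have "(\<alpha> + j) * (n + 1 - (\<alpha> + j)) = \<alpha> * (n + 1 - \<alpha>) + j * (n + 1 - 2 * \<alpha> - j)"
      proof -
        obtain d where "n = 2 * \<alpha> + j + d" using jn le_Suc_ex by blast
        then show ?thesis by (simp add: algebra_simps)
      qed
      ultimately show False using j jn by simp
    qed
    have c2: "v y = 0" if "s y + \<alpha> + j = n" for y
    proof (rule ccontr)
      assume vy: "v y \<noteq> 0"
      then have yX: "y \<in> X" using outside by blast
      have jn: "2 * \<alpha> + j \<le> n" using range[OF v(1) vy] that by linarith
      let ?v = "\<lambda>y. (if s y = n - (\<alpha> + j) then 1 else 0) * v y"
      have vW: "?v \<in> W" using T_module_s[OF T v(1), of "\<lambda>k. if k = n - (\<alpha> + j) then 1 else 0"] .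
      have "FQ ?v z = 0" for z
      proof (cases "s z = \<alpha> + j")
        case True
        then have "v z = 0" using c1[of z] by simp
        moreover have "FP v z = FP (\<lambda>_. 0) z"
          by (rule FP_local, rule IH) (use True jn in auto)
        ultimately have "FQ v z = 0" using AP[of z] by simp
        then show ?thesis by (simp add: FQ_level[of "\<lambda>k. if k = n - (\<alpha> + j) then 1 else 0"])
      next
        case False
        then show ?thesis using jn s_le[of z] by (auto simp: FQ_level[of "\<lambda>k. if k = n - (\<alpha> + j) then 1 else 0"])
      qed
      then have "FQ ?v = (\<lambda>_. 0)" by blast
      then have QQ: "FQ (FQ ?v) = (\<lambda>_. 0)" by simp
      \<comment> \<open>The negative of the diagonal term of \<open>FQ_FQ\<close> at level
        \<open>n - (\<alpha> + j)\<close>. It lies below the bound of \<open>casim_Q_scalar\<close>,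
        which gives the contradiction.\<close>
      let ?c = "- (real m + 1 + \<alpha> + j - n) * (real m + 1 - \<alpha> - j)"
      have "casim m Q ?v z = of_real ?c * ?v z" if z: "z \<in> X" for z
      proof (cases "s z = n - (\<alpha> + j)")
        case True
        have f: "m + 1 - s z = m + 1 + \<alpha> + j - n" "m + 1 + s z - n = m + 1 - (\<alpha> + j)" "\<alpha> + j \<le> m + 1" "n \<le> m + 1 + \<alpha> + j"
          using True jn card_Q_Diff[OF z] card_Q_Int[OF z] by auto
        have "complex_of_nat (m + 1 - s z) = of_real (real m + 1 + \<alpha> + j - n)"
          unfolding f(1) using f(4) by (simp add: of_nat_diff)
        moreover have "complex_of_nat (m + 1 + s z - n) = of_real (real m + 1 - \<alpha> - j)"
          unfolding f(2) using f(3) by (simp add: of_nat_diff)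
        ultimately have c: "complex_of_nat ((m + 1 - s z) * (m + 1 + s z - n)) = - of_real ?c"
          by (simp only: of_nat_mult of_real_mult of_real_minus minus_mult_left minus_minus)
        have "casim m Q ?v z = - (complex_of_nat ((m + 1 - s z) * (m + 1 + s z - n)) * ?v z)"
          by (rule casim_Q_if_FQ_FQ_zero[OF z]) (simp only: QQ)
        then show ?thesis unfolding c by (simp only: minus_mult_left minus_minus)
      next
        case False
        then show ?thesis using FQ_FQ[OF z, of ?v] QQ by simp
      qed
      moreover have "?v \<noteq> (\<lambda>_. 0)" using vy that jn by (auto simp: fun_eq_iff intro!: exI[of _ y])
      ultimately have "- (real m + \<alpha> - n) * (real m + 2 - \<alpha>) \<le> ?c"
        using casim_Q_scalar(2)[OF vW] by blast
      then have "real j * (real n - 2 * \<alpha> - j) + (real n - 2 * \<alpha> + 1) \<le> 0" by (simp add: algebra_simps)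
      moreover have "real j * (real n - 2 * \<alpha> - j) \<ge> 0" "real n - 2 * \<alpha> + 1 > 0" using jn by auto
      ultimately show False by linarith
    qed
    show ?case
    proof (intro allI impI)
      fix y assume "s y < \<alpha> + Suc j \<or> n < s y + \<alpha> + Suc j"
      then consider "s y < \<alpha> + j \<or> n < s y + \<alpha> + j" | "s y = \<alpha> + j" | "s y + \<alpha> + j = n" by linarith
      then show "v y = 0" using IH c1 c2 by cases auto
    qed
  qed
  from this[of "n + 1"] have "v = (\<lambda>_. 0)" by auto
  then show False using v(2) by simp
qed

end

context odd_spectrum begin

lemma dual_endpoint_props:
  assumes W: "T_module m W" "W \<noteq> {\<lambda>_. 0}"
  shows "dual_endpoint m E W \<le> m" "\<exists>w\<in>W. mvec m (E (dual_endpoint m E W)) w \<noteq> (\<lambda>_. 0)"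
    and "h < dual_endpoint m E W \<Longrightarrow> w \<in> W \<Longrightarrow> mvec m (E h) w = (\<lambda>_. 0)"
proof -
  obtain v where v: "v \<in> W" "v \<noteq> (\<lambda>_. 0)" using W T_module_zero[OF W(1)] by blast
  have "\<exists>j\<le>m. mvec m (E j) v \<noteq> (\<lambda>_. 0)"
  proof (rule ccontr)
    assume "\<not> ?thesis"
    then have "(\<lambda>y. \<Sum>j\<le>m. mvec m (E j) v y) = (\<lambda>_. 0)" by (auto simp: fun_eq_iff)
    then show False using E_sum[OF T_module_Vspace[OF W(1) v(1)]] v(2) by simp
  qed
  then obtain j where j: "j \<le> m \<and> acts_nonzero m (E j) W" using v by (auto simp: acts_nonzero_def)
  from LeastI[of "\<lambda>i. i \<le> m \<and> acts_nonzero m (E i) W", OF j]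
  show le: "dual_endpoint m E W \<le> m" and "\<exists>w\<in>W. mvec m (E (dual_endpoint m E W)) w \<noteq> (\<lambda>_. 0)"
    unfolding dual_endpoint_def by (auto simp: acts_nonzero_def)
  show "mvec m (E h) w = (\<lambda>_. 0)" if "h < dual_endpoint m E W" "w \<in> W"
    using not_less_Least[OF that(1)[unfolded dual_endpoint_def]] that le by (auto simp: acts_nonzero_def)
qed

end

context halves begin

lemma casim_Q_level: "casim m Q (\<lambda>y. f (s y) * v y) y = f (s y) * casim m Q v y"
proof -
  have "s (insert p y - {q}) = s y" if "p \<in> Q - y" "q \<in> Q \<inter> y" for p q
  proof -
    have "P - (insert p y - {q}) = P - y" using that PQ_disj by auto
    then show ?thesis by (simp add: s_def)
  qed
  then have "swp m Q (\<lambda>y. f (s y) * v y) y = f (s y) * swp m Q v y"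
    by (simp add: swp_def sum_distrib_left)
  then show ?thesis by (simp add: casim_def algebra_simps)
qed

end

section \<open>The second Casimir parameter from the dual endpoint\<close>

context module_bottom begin

abbreviation "\<mu> \<equiv> dual_endpoint m E W"

lemma W_nonzero: "W \<noteq> {\<lambda>_. 0}"
  using irr by (simp add: irreducible_T_module_def)

lemmas \<mu>_props = dual_endpoint_props[OF T W_nonzero]

lemma Askey_Wilson_eigenvector:
  fixes t :: "'a :: comm_ring_1"
  assumes "x + 2 * (t * x') + k * (t * (t * v)) = N * (t * (t * v)) + pp - qq"
    "pp - qq = cp - cq + (k + a - b) * v" "cp = - e * v"
  shows "x + 2 * t * x' = (1 - t * t) * (k * v) + ((a - b - e + N * t * t) * v - cq)"
proof -
  have "x + 2 * t * x' = N * (t * (t * v)) - k * (t * (t * v)) + (pp - qq)"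
    using assms(1) by (simp add: algebra_simps)
  then show ?thesis unfolding assms(2,3) by (simp add: algebra_simps)
qed

text \<open>For \<open>h < \<mu>\<close> this is minimality of \<open>\<mu>\<close>. For larger
  \<open>h\<close>, applying \<open>E h\<close> to the Askey-Wilson relation gives
  \<open>((\<theta>_h + \<theta>_\<mu>)^2 - 1) * E_h K v = 0\<close>, and the factor vanishes only
  for neighbours.\<close>

lemma E_K_eigenvector:
  assumes v: "v \<in> W" and eig: "A v = (\<lambda>y. of_int (odd_eigenvalue m \<mu>) * v y)"
    and h: "h \<le> m" "h \<noteq> \<mu>" "h \<noteq> \<mu> + 1"
  shows "mvec m (E h) (K v) = (\<lambda>_. 0)"
proof (cases "h < \<mu>")
  case True
  then show ?thesis using \<mu>_props(3)[OF True T_module_s[OF T v, of of_nat]] by simp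
next
  case False
  let ?t = "complex_of_int (odd_eigenvalue m \<mu>)" and ?h = "complex_of_int (odd_eigenvalue m h)"
  have vV: "v \<in> Vspace m" using T_module_Vspace[OF T v] .
  have Eh: "mvec m (E h) v = (\<lambda>_. 0)" by (rule E_eigenvector[OF eig \<mu>_props(1) h(1,2)])
  \<comment> \<open>\<open>casim m Q\<close> is not yet known to be scalar on \<open>W\<close>;
    commuting with \<open>A\<close> suffices, since \<open>casim m Q v\<close> then has the same
    eigenvalue as \<open>v\<close>.\<close>
  have "A (casim m Q v) = (\<lambda>y. ?t * casim m Q v y)"
    unfolding halves.casim_A[OF swap_halves, symmetric] eig casim_scale ..
  then have EhQ: "mvec m (E h) (casim m Q v) = (\<lambda>_. 0)" by (rule E_eigenvector[OF _ \<mu>_props(1) h(1,2)])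
  let ?c = "of_nat n * (of_nat m + 1) - of_nat (m + 1) * of_nat (m + 1) - of_nat (\<alpha> * (n + 1 - \<alpha>)) + (2 * of_nat n + 1) * ?t * ?t :: complex"
  have eq: "(\<lambda>y. A (A (K v)) y + 2 * ?t * A (K v) y) = (\<lambda>y. (1 - ?t * ?t) * K v y + (?c * v y - casim m Q v y))"
  proof
    fix y
    show "A (A (K v)) y + 2 * ?t * A (K v) y = (1 - ?t * ?t) * K v y + (?c * v y - casim m Q v y)"
    proof (cases "y \<in> X")
      case True
      have 1: "K (\<lambda>y. ?t * v y) = (\<lambda>y. ?t * K v y)" by (auto simp: mult.left_commute)
      have "A (A (K v)) y + 2 * (?t * A (K v) y) + of_nat (s y) * (?t * (?t * v y))
        = (2 * of_nat n + 1) * (?t * (?t * v y)) + FP (FP v) y - FQ (FQ v) y"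
        using Askey_Wilson[of v y] unfolding eig 1 flip_scale by simp
      from Askey_Wilson_eigenvector[OF this FP_FP_minus_FQ_FQ[OF True] fun_cong[OF casim_P_W[OF v]]]
      show ?thesis .
    next
      case False
      then show ?thesis using Vspace_outside[OF vV False] casim_outside[OF vV False] by (simp add: flip_outside)
    qed
  qed
  have a1: "mvec m (E h) (\<lambda>y. A (A (K v)) y + 2 * ?t * A (K v) y) = (\<lambda>y. (?h * ?h + 2 * ?t * ?h) * mvec m (E h) (K v) y)"
    unfolding mvec_add mvec_scale E_A[OF h(1)] by (auto simp: algebra_simps)
  have a2: "mvec m (E h) (\<lambda>y. (1 - ?t * ?t) * K v y + (?c * v y - casim m Q v y)) = (\<lambda>y. (1 - ?t * ?t) * mvec m (E h) (K v) y)"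
    unfolding mvec_add mvec_diff mvec_scale Eh EhQ by simp
  have *: "(?h * ?h + 2 * ?t * ?h) * mvec m (E h) (K v) y = (1 - ?t * ?t) * mvec m (E h) (K v) y" for y
    by (rule fun_cong[OF trans[OF a1[unfolded eq, symmetric] a2]])
  have "(odd_eigenvalue m h + odd_eigenvalue m \<mu>)\<^sup>2 \<noteq> 1"
    using odd_eigenvalue_sum[OF h(1) \<mu>_props(1)] h False by linarith
  then have "(?h + ?t)\<^sup>2 \<noteq> 1" by (metis of_int_add of_int_power of_int_eq_1_iff)
  moreover have "((?h + ?t)\<^sup>2 - 1) * mvec m (E h) (K v) y = 0" for y
    using *[of y] by (simp add: power2_eq_square algebra_simps)
  ultimately show ?thesis by (auto simp: fun_eq_iff)
qed

text \<open>For an eigenvector \<open>v\<close> in \<open>E\<^sub>\<mu>W\<close>, minimality of \<open>\<mu>\<close> leaves \<open>K v\<close> with components in \<open>E\<^sub>\<mu>\<close> and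
  \<open>E\<^sub>\<mu>\<^sub>+\<^sub>1\<close> only, so \<open>A - \<theta>\<^sub>\<mu>\<^sub>+\<^sub>1\<close> maps it to a \<open>\<theta>\<^sub>\<mu>\<close>-eigenvector; comparing \<open>A\<close> on both at the bottom level
  gives the value of \<open>FQ\<^sup>2\<close> there.\<close>

lemma casim_Q_W_eigenvalue:
  shows "v \<in> W \<Longrightarrow> casim m Q v = (\<lambda>y. of_real ((real m + 1 - \<mu>) * (real m + 1 - \<mu> - n + 2 * \<alpha>) - (real m + 1 - \<alpha>) * (real m + 1 + \<alpha> - n)) * v y)"
    and "(int m + 1 - \<mu>) * (int m + 1 - \<mu> - n + 2 * \<alpha>) \<ge> n + 1 - 2 * int \<alpha>"
    and "(int m + 1 - \<mu>) * (int m + 1 - \<mu> - n + 2 * \<alpha>) \<le> (int m + 1 - \<alpha>) * (int m + 1 + \<alpha> - n)"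
proof -
  let ?t = "complex_of_int (odd_eigenvalue m \<mu>)"
  \<comment> \<open>The formula for \<open>odd_eigenvalue m (\<mu> + 1)\<close>. For
    \<open>\<mu> = m\<close> there is no such idempotent and the value is \<open>0\<close>.\<close>
  define t' :: complex where "t' = of_int ((-1) ^ (\<mu> + 1) * (int m - int \<mu>))"
  obtain w where "w \<in> W" "mvec m (E \<mu>) w \<noteq> (\<lambda>_. 0)" using \<mu>_props(2) by auto
  from T_module_eigenvector[OF T this(1) \<mu>_props(1) this(2)]
  obtain v where v: "v \<in> W" "v \<noteq> (\<lambda>_. 0)" and eig: "A v = (\<lambda>y. ?t * v y)" by auto
  have KvW: "K v \<in> W" using T_module_s[OF T v(1), of of_nat] by simp
  let ?u = "\<lambda>y. A (K v) y - t' * K v y"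
  have uW: "?u \<in> W" using T_module_A[OF T m_pos KvW] KvW by (intro T_module_diff[OF T] T_module_scale[OF T])
  have Au: "A ?u = (\<lambda>y. ?t * ?u y)"
  proof (rule eigenvector_if_E(2)[OF T_module_Vspace[OF T uW] \<mu>_props(1)])
    fix h assume h: "h \<le> m" "h \<noteq> \<mu>"
    show "mvec m (E h) ?u = (\<lambda>_. 0)"
    proof (cases "h = \<mu> + 1")
      case True
      then have "t' = of_int (odd_eigenvalue m h)" by (simp add: t'_def odd_eigenvalue_def)
      then show ?thesis unfolding mvec_diff mvec_scale E_A[OF h(1)] by simp
    next
      case False
      then show ?thesis unfolding mvec_diff mvec_scale E_A[OF h(1)] 
        using E_K_eigenvector[OF v(1) eig h False] by simp
    qed
  qed
  \<comment> \<open>With \<open>M = m + 1 - \<mu>\<close> the eigenvalues satisfy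
    \<open>\<theta>^2 = M^2\<close> and \<open>\<theta> * \<theta>' = - M * (M - 1)\<close>;
    inserting this in the coefficient of \<open>FQ (FQ v)\<close> found below gives
    \<open>M * (M - n + 2 * \<alpha>)\<close>.\<close>
  define ev where "ev = (int m + 1 - \<mu>) * (int m + 1 - \<mu> - n + 2 * \<alpha>)"
  have tt: "?t * ?t = of_int ((int m + 1 - \<mu>) * (int m + 1 - \<mu>))"
    "?t * t' = of_int (- (int m + 1 - \<mu>) * (int m - \<mu>))"
    by (cases "even \<mu>"; simp add: odd_eigenvalue_def t'_def algebra_simps)+
  have bottom_FP: "FP u y = 0" if "s y = \<alpha>" "u \<in> W" for u y
  proof -
    have "FP u y = FP (\<lambda>_. 0) y"
      by (rule FP_local, rule W_zero[OF that(2)]) (use that two_alpha in auto)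
    then show ?thesis by simp
  qed
  \<comment> \<open>On the bottom level \<open>A\<close> reduces to \<open>FQ\<close>. The
    eigenvalue equations of \<open>v\<close> and \<open>?u\<close> are two relations there, from
    which \<open>FQ (FP v)\<close> is eliminated.\<close>
  have QQ: "FQ (FQ v) y = of_int ev * v y" if sy: "s y = \<alpha>" for y
  proof -
    let ?a = "complex_of_nat \<alpha>" and ?n = "complex_of_nat n"
    have Qv: "FQ v y = ?t * v y" using fun_cong[OF eig, of y] bottom_FP[OF sy v(1)] by (simp add: A_eq)
    have "FQ (A v) y = ?t * FQ v y" unfolding eig flip_scale ..
    then have QA: "FQ (FP v) y + FQ (FQ v) y = ?t * (?t * v y)" unfolding A_eq flip_add Qv by simp
    have QK: "FQ (K v) y = (?n - ?a) * (?t * v y)" using FQ_K[of v y] Qv sy by simp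
    have QQK: "FQ (FQ (K v)) y = ?a * FQ (FQ v) y"
      unfolding FQ_K' flip_diff flip_scale using sy by (simp add: algebra_simps)
    have QPK: "FQ (FP (K v)) y = (?a + 1) * FQ (FP v) y"
      unfolding FP_K' flip_diff flip_scale FQ_K using sy by (simp add: algebra_simps)
    have u: "?u y = (?n - ?a) * (?t * v y) - t' * (?a * v y)"
      using bottom_FP[OF sy KvW] QK sy by (simp add: A_eq)
    have "FQ ?u y = ?t * ?u y" using fun_cong[OF Au, of y] bottom_FP[OF sy uW] unfolding A_eq[of ?u] by simp
    moreover have "FQ ?u y = FQ (FP (K v)) y + FQ (FQ (K v)) y - t' * FQ (K v) y"
      unfolding A_eq flip_diff flip_add flip_scale ..
    ultimately have e: "(?a + 1) * FQ (FP v) y + ?a * FQ (FQ v) y - t' * ((?n - ?a) * (?t * v y)) = ?t * ((?n - ?a) * (?t * v y) - t' * (?a * v y))"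
      unfolding QQK QPK QK u by simp
    have QP: "FQ (FP v) y = ?t * (?t * v y) - FQ (FQ v) y" using QA by (simp add: algebra_simps)
    have "FQ (FQ v) y = ((?a + 1) * (?t * ?t) - (?n - ?a) * (?t * t') - (?n - ?a) * (?t * ?t) + ?a * (?t * t')) * v y"
      using e unfolding QP by (simp add: algebra_simps)
    also have "(?a + 1) * (?t * ?t) - (?n - ?a) * (?t * t') - (?n - ?a) * (?t * ?t) + ?a * (?t * t') = of_int ev"
      unfolding tt ev_def by (simp add: algebra_simps)
    finally show ?thesis .
  qed
  let ?c = "of_int ev - (real m + 1 - \<alpha>) * (real m + 1 + \<alpha> - n)"
  let ?v = "\<lambda>y. (if s y = \<alpha> then 1 else 0) * v y"
  have vW: "?v \<in> W" using T_module_s[OF T v(1), of "\<lambda>k. if k = \<alpha> then 1 else 0"] .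
  obtain y where y: "y \<in> X" "s y = \<alpha>" "v y \<noteq> 0" using eigenvector_bottom[OF v eig] by auto
  then have vnz: "?v \<noteq> (\<lambda>_. 0)" by (auto simp: fun_eq_iff)
  have "casim m Q ?v y = of_real ?c * ?v y" if y: "y \<in> X" for y
  proof -
    have c: "casim m Q ?v y = (if s y = \<alpha> then 1 else 0) * casim m Q v y"
      by (rule casim_Q_level)
    show ?thesis
    proof (cases "s y = \<alpha>")
      case True
      have "complex_of_nat ((m + 1 - s y) * (m + 1 + s y - n)) = of_real ((real m + 1 - \<alpha>) * (real m + 1 + \<alpha> - n))"
        using True alpha_bounds by (simp add: of_nat_diff ac_simps)
      then have "casim m Q v y = of_int ev * v y - of_real ((real m + 1 - \<alpha>) * (real m + 1 + \<alpha> - n)) * v y"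
        using FQ_FQ[OF y, of v] QQ[OF True] by (simp only: eq_diff_eq)
      then show ?thesis unfolding c using True by (simp add: left_diff_distrib)
    qed (simp add: c)
  qed
  then have *: "\<And>v. v \<in> W \<Longrightarrow> casim m Q v = (\<lambda>y. of_real ?c * v y)"
    "- (real m + \<alpha> - n) * (real m + 2 - \<alpha>) \<le> ?c" "?c \<le> 0"
    using casim_Q_scalar[OF vW vnz] by blast+
  show "casim m Q v = (\<lambda>y. of_real ((real m + 1 - \<mu>) * (real m + 1 - \<mu> - n + 2 * \<alpha>) - (real m + 1 - \<alpha>) * (real m + 1 + \<alpha> - n)) * v y)"
    if "v \<in> W" for v
    using *(1)[OF that] by (simp add: ev_def)
  have "real_of_int (n + 1 - 2 * int \<alpha>) \<le> of_int ev" using *(2) by (simp add: algebra_simps)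
  then show "(int m + 1 - \<mu>) * (int m + 1 - \<mu> - n + 2 * \<alpha>) \<ge> n + 1 - 2 * int \<alpha>"
    unfolding ev_def by (simp only: of_int_le_iff)
  have "of_int ev \<le> real_of_int ((int m + 1 - \<alpha>) * (int m + 1 + \<alpha> - n))" using *(3) by simp
  then show "(int m + 1 - \<mu>) * (int m + 1 - \<mu> - n + 2 * \<alpha>) \<le> (int m + 1 - \<alpha>) * (int m + 1 + \<alpha> - n)"
    unfolding ev_def by (simp only: of_int_le_iff)
qed

end

context module_bottom begin

text \<open>Nonpositivity of the second Casimir reads \<open>b * (2 * m + 2 - n - b) \<ge> 0\<close>
  for \<open>b = \<mu> - \<alpha>\<close>; the Gram bound makes
  \<open>M * (M - n + 2 * \<alpha>)\<close> positive for \<open>M = m + 1 - \<mu>\<close>.\<close>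

lemma dual_endpoint_bounds: "\<alpha> \<le> \<mu>" "\<mu> + n \<le> 2 * \<alpha> + m"
proof -
  let ?M = "int m + 1 - \<mu>" and ?b = "int \<mu> - \<alpha>"
  have M: "?M \<ge> 1" using \<mu>_props(1) by simp
  have "?M * (?M - n + 2 * \<alpha>) \<ge> n + 1 - 2 * int \<alpha>" by (rule casim_Q_W_eigenvalue(2))
  then have "?M * (?M - n + 2 * \<alpha>) > 0" using two_alpha by linarith
  then have "?M - n + 2 * \<alpha> > 0" using M by (simp add: zero_less_mult_iff)
  then show "\<mu> + n \<le> 2 * \<alpha> + m" by simp
  have "?b * (2 * int m + 2 - n - ?b) \<ge> 0"
    using casim_Q_W_eigenvalue(3) by (simp add: algebra_simps)
  moreover have "2 * int m + 2 - n - ?b > 0" using \<mu>_props(1) cardP by auto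
  ultimately show "\<alpha> \<le> \<mu>" by (simp add: zero_le_mult_iff)
qed

definition \<beta> :: nat where "\<beta> = \<mu> - \<alpha>"

lemma \<mu>_eq: "\<mu> = \<alpha> + \<beta>" and \<beta>_le: "\<beta> + n \<le> \<alpha> + m"
  using dual_endpoint_bounds by (auto simp: \<beta>_def)

text \<open>Since \<open>card Q = 2 * m + 1 - n\<close>, this has the same shape as the scalar for
  \<open>P\<close>.\<close>

lemma casim_Q_W:
  assumes "v \<in> W"
  shows "casim m Q v = (\<lambda>y. - of_nat (\<beta> * (2 * m + 2 - n - \<beta>)) * v y)"
proof -
  have "n + \<beta> \<le> 2 * m + 2" using \<beta>_le alpha_bounds by linarith
  then have "real (\<beta> * (2 * m + 2 - n - \<beta>)) = real \<beta> * (2 * real m + 2 - n - \<beta>)"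
    by (simp add: of_nat_diff)
  then have "(real m + 1 - \<mu>) * (real m + 1 - \<mu> - n + 2 * \<alpha>) - (real m + 1 - \<alpha>) * (real m + 1 + \<alpha> - n)
     = - real (\<beta> * (2 * m + 2 - n - \<beta>))"
    unfolding \<mu>_eq by (simp add: algebra_simps)
  then show ?thesis using casim_Q_W_eigenvalue(1)[OF assms] by simp
qed

section \<open>Levels occupied by an irreducible module, and its diameter\<close>

definition levels :: "nat set" where "levels = {s y | y. \<exists>w\<in>W. w y \<noteq> 0}"

lemma level_vector:
  assumes "\<sigma> \<in> levels"
  obtains w y where "w \<in> W" "y \<in> X" "w y \<noteq> 0" "s y = \<sigma>" "\<And>z. w z \<noteq> 0 \<Longrightarrow> s z = \<sigma>"
proof -
  obtain w y where w: "w \<in> W" "w y \<noteq> 0" "s y = \<sigma>" using assms by (auto simp: levels_def)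
  let ?w = "\<lambda>y. (if s y = \<sigma> then 1 else 0) * w y"
  have "?w \<in> W" using T_module_s[OF T w(1), of "\<lambda>k. if k = \<sigma> then 1 else 0"] .
  moreover have "y \<in> X" using w Vspace_outside[OF T_module_Vspace[OF T w(1)]] by blast
  moreover have "?w y \<noteq> 0" using w by simp
  moreover have "s z = \<sigma>" if "?w z \<noteq> 0" for z using that by (simp split: if_splits)
  ultimately show thesis using w(3) that by blast
qed

text \<open>On level \<open>\<sigma>\<close> the square of \<open>FQ\<close> is \<open>(m + 1 -
  \<sigma> - \<beta>) * (m + 1 + \<sigma> - n - \<beta>)\<close>. By \<open>\<beta>_le\<close> this
  is nonzero on the whole range, so \<open>FQ\<close> kills no level.\<close>

lemma levels_FQ:
  assumes "\<sigma> \<in> levels"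
  shows "n - \<sigma> \<in> levels"
proof -
  obtain w y where w: "w \<in> W" "y \<in> X" "w y \<noteq> 0" "s y = \<sigma>" "\<And>z. w z \<noteq> 0 \<Longrightarrow> s z = \<sigma>"
    using level_vector[OF assms] by blast
  have b: "\<alpha> \<le> \<sigma>" "\<sigma> + \<alpha> \<le> n" using range[OF w(1,3)] w(4) by auto
  have le: "\<beta> + n < m + 1 + \<sigma>" "\<beta> + \<sigma> < m + 1" using b \<beta>_le by linarith+
  have "FQ (FQ w) y = (of_nat ((m + 1 - \<sigma>) * (m + 1 + \<sigma> - n)) - of_nat (\<beta> * (2 * m + 2 - n - \<beta>))) * w y"
    using FQ_FQ[OF w(2), of w] casim_Q_W[OF w(1)] w(4) by (simp add: left_diff_distrib del: of_nat_mult)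
  moreover have "(m + 1 - \<sigma>) * (m + 1 + \<sigma> - n) = \<beta> * (2 * m + 2 - n - \<beta>) + (m + 1 - \<sigma> - \<beta>) * (m + 1 + \<sigma> - n - \<beta>)"
  proof -
    obtain x where x: "m + 1 = \<sigma> + \<beta> + x" using le(2) by (metis add.commute less_imp_le le_Suc_ex)
    obtain z where z: "m + 1 + \<sigma> = n + \<beta> + z" using le(1) by (metis add.commute less_imp_le le_Suc_ex)
    have "m + 1 - \<sigma> = \<beta> + x" "m + 1 + \<sigma> - n = \<beta> + z" "2 * m + 2 - n - \<beta> = \<beta> + x + z"
      "m + 1 - \<sigma> - \<beta> = x" "m + 1 + \<sigma> - n - \<beta> = z" using x z by linarith+
    then show ?thesis by (simp only:) (simp add: algebra_simps)
  qed
  ultimately have "FQ (FQ w) y = of_nat ((m + 1 - \<sigma> - \<beta>) * (m + 1 + \<sigma> - n - \<beta>)) * w y"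
    by (simp only: of_nat_add) simp
  moreover have "(m + 1 - \<sigma> - \<beta>) * (m + 1 + \<sigma> - n - \<beta>) \<noteq> 0" using le by auto
  ultimately have "FQ (FQ w) y \<noteq> 0" using w(3) by (simp del: of_nat_mult)
  then have "FQ w \<noteq> (\<lambda>_. 0)" by auto
  then obtain z where z: "FQ w z \<noteq> 0" by auto
  have "s z = n - \<sigma>"
  proof (rule ccontr)
    assume "s z \<noteq> n - \<sigma>"
    then have "FQ w z = FQ (\<lambda>_. 0) z"
      by (intro FQ_local) (use w(5) s_le[of z] in fastforce)
    then show False using z by simp
  qed
  then show ?thesis using z T_module_FQ[OF m_pos T w(1)] by (auto simp: levels_def intro!: exI[of _ z])
qed

text \<open>Here the scalar is \<open>(\<sigma> - \<alpha>) * (n + 1 - \<sigma> - \<alpha>)\<close>,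
  which vanishes in the range only at the bottom level.\<close>

lemma levels_FP:
  assumes "\<sigma> \<in> levels" "\<alpha> < \<sigma>"
  shows "n + 1 - \<sigma> \<in> levels"
proof -
  obtain w y where w: "w \<in> W" "y \<in> X" "w y \<noteq> 0" "s y = \<sigma>" "\<And>z. w z \<noteq> 0 \<Longrightarrow> s z = \<sigma>"
    using level_vector[OF assms(1)] by blast
  have b: "\<sigma> + \<alpha> \<le> n" using range[OF w(1,3)] w(4) by auto
  have "FP (FP w) y = (of_nat (\<sigma> * (n + 1 - \<sigma>)) - of_nat (\<alpha> * (n + 1 - \<alpha>))) * w y"
    using FP_FP[OF w(2), of w] casim_P_W[OF w(1)] w(4) by (simp add: left_diff_distrib del: of_nat_mult)
  moreover have "\<sigma> * (n + 1 - \<sigma>) = \<alpha> * (n + 1 - \<alpha>) + (\<sigma> - \<alpha>) * (n + 1 - \<sigma> - \<alpha>)"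
  proof -
    obtain x where x: "\<sigma> = \<alpha> + x" using assms(2) by (metis less_imp_le le_Suc_ex)
    obtain z where z: "n = \<sigma> + \<alpha> + z" using b le_Suc_ex by blast
    have "n + 1 - \<sigma> = \<alpha> + z + 1" "n + 1 - \<alpha> = \<alpha> + x + z + 1" "n + 1 - \<sigma> - \<alpha> = z + 1" "\<sigma> - \<alpha> = x"
      using x z by linarith+
    then show ?thesis by (simp only: x) (simp add: algebra_simps)
  qed
  ultimately have "FP (FP w) y = of_nat ((\<sigma> - \<alpha>) * (n + 1 - \<sigma> - \<alpha>)) * w y"
    by (simp only: of_nat_add) simp
  moreover have "(\<sigma> - \<alpha>) * (n + 1 - \<sigma> - \<alpha>) \<noteq> 0" using assms(2) b by auto
  ultimately have "FP (FP w) y \<noteq> 0" using w(3) by (simp del: of_nat_mult)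
  then have "FP w \<noteq> (\<lambda>_. 0)" by auto
  then obtain z where z: "FP w z \<noteq> 0" by auto
  have "s z = n + 1 - \<sigma>"
  proof (rule ccontr)
    assume "s z \<noteq> n + 1 - \<sigma>"
    then have "FP w z = FP (\<lambda>_. 0) z"
      by (intro FP_local) (use w(5) s_le[of z] in fastforce)
    then show False using z by simp
  qed
  then show ?thesis using z T_module_FP[OF m_pos T w(1)] by (auto simp: levels_def intro!: exI[of _ z])
qed

lemma levels_eq: "levels = {\<alpha>..n - \<alpha>}"
proof
  show "levels \<subseteq> {\<alpha>..n - \<alpha>}"
  proof
    fix \<sigma> assume "\<sigma> \<in> levels"
    then obtain w y where "w \<in> W" "w y \<noteq> 0" "s y = \<sigma>" by (auto simp: levels_def)
    then show "\<sigma> \<in> {\<alpha>..n - \<alpha>}" using range[of w y] by auto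
  qed
  \<comment> \<open>\<open>FQ\<close> leads from \<open>\<alpha> + j\<close> to
    \<open>n - (\<alpha> + j)\<close>, and \<open>FP\<close> from there to
    \<open>\<alpha> + j + 1\<close>.\<close>
  have step: "\<alpha> + j \<in> levels" if "2 * \<alpha> + j \<le> n" for j
    using that
  proof (induction j)
    case 0
    then show ?case using bottom by (auto simp: levels_def)
  next
    case (Suc j)
    have "n - (\<alpha> + j) \<in> levels" using Suc levels_FQ by simp
    then have "n + 1 - (n - (\<alpha> + j)) \<in> levels" using Suc.prems by (intro levels_FP) auto
    moreover have "n + 1 - (n - (\<alpha> + j)) = \<alpha> + Suc j" using Suc.prems by simp
    ultimately show ?case by simp
  qed
  show "{\<alpha>..n - \<alpha>} \<subseteq> levels"
  proof
    fix \<sigma> assume "\<sigma> \<in> {\<alpha>..n - \<alpha>}"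
    then show "\<sigma> \<in> levels" using step[of "\<sigma> - \<alpha>"] two_alpha by auto
  qed
qed

lemma diameter_eq: "diameter m W = n - 2 * \<alpha>"
proof -
  have level_mem: "\<exists>y\<in>X. s y = \<sigma>" if "\<sigma> \<in> levels" for \<sigma>
    using level_vector[OF that] by metis
  have "{i. i \<le> m \<and> acts_nonzero m (Estar m i) W} = dist_s ` levels"
  proof (intro equalityI subsetI)
    fix i assume "i \<in> {i. i \<le> m \<and> acts_nonzero m (Estar m i) W}"
    then obtain w y where "w \<in> W" "y \<in> X" "odist m (x0 m) y = i" "w y \<noteq> 0"
      by (auto simp: acts_nonzero_def mvec_Estar fun_eq_iff split: if_splits)
    then show "i \<in> dist_s ` levels" by (auto simp: levels_def odist_s)
  next
    fix i assume "i \<in> dist_s ` levels"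
    then obtain \<sigma> where "\<sigma> \<in> levels" "i = dist_s \<sigma>" by auto
    then obtain w y where w: "w \<in> W" "y \<in> X" "w y \<noteq> 0" "odist m (x0 m) y = i"
      using level_vector[of \<sigma>] odist_s by metis
    then have "mvec m (Estar m i) w y \<noteq> 0" by (simp add: mvec_Estar)
    then show "i \<in> {i. i \<le> m \<and> acts_nonzero m (Estar m i) W}"
      using w level_of_dist_odist(2)[OF x0_in_Xset w(2)] by (auto simp: acts_nonzero_def fun_eq_iff)
  qed
  moreover have "inj_on dist_s levels"
  proof (rule inj_on_inverseI)
    fix \<sigma> assume "\<sigma> \<in> levels"
    then obtain y where y: "y \<in> X" "s y = \<sigma>" using level_mem by blast
    show "s_of_lev (level_of_dist m (dist_s \<sigma>)) = \<sigma>"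
      using s_odist[OF y(1)] odist_s[OF y(1)] y(2) by simp
  qed
  ultimately show ?thesis
    using two_alpha by (simp add: diameter_def card_image levels_eq)
qed

end

context odd_spectrum begin

text \<open>The parity of the least distance occurring in \<open>W\<close> decides the roles: if it
  is even, the base vertex is \<open>P\<close>, \<open>\<alpha> = a\<close> and
  \<open>\<beta> = b\<close>; if it is odd, the complement is \<open>P\<close>,
  \<open>\<alpha> = b\<close> and \<open>\<beta> = a\<close>.\<close>

theorem irreducible_classification:
  assumes "irreducible_T_module m W"
  obtains a b where "2 * a \<le> m" "2 * b \<le> m + 1"
    "\<And>v. v \<in> W \<Longrightarrow> casim m {1..m} v = (\<lambda>y. - of_nat (a * (m + 1 - a)) * v y)"
    "\<And>v. v \<in> W \<Longrightarrow> casim m {m+1..2*m+1} v = (\<lambda>y. - of_nat (b * (m + 2 - b)) * v y)"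
    "dual_endpoint m E W = a + b"
    "diameter m W = (if b \<le> a then m - 2 * a else m + 1 - 2 * b)"
proof -
  have T: "T_module m W" using assms by (simp add: irreducible_T_module_def)
  let ?P = "\<lambda>k. \<exists>y\<in>Xset m. \<exists>w\<in>W. w y \<noteq> 0 \<and> odist m (x0 m) y = k"
  have in_X: "y \<in> Xset m" if "w \<in> W" "w y \<noteq> 0" for w y
    using that Vspace_outside[OF T_module_Vspace[OF T that(1)]] by blast
  have "\<exists>w\<in>W. w \<noteq> (\<lambda>_. 0)" using assms T_module_zero[OF T] unfolding irreducible_T_module_def by blast
  then obtain w y where "w \<in> W" "w y \<noteq> 0" by (auto simp: fun_eq_iff)
  then have ex: "?P (odist m (x0 m) y)" using in_X by blast
  obtain y1 w1 where y1: "y1 \<in> Xset m" "w1 \<in> W" "w1 y1 \<noteq> 0"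
    and d1: "odist m (x0 m) y1 = (LEAST k. ?P k)" using LeastI[of ?P, OF ex] by blast
  define t1 where "t1 = card (x0 m \<inter> y1)"
  have t_le: "card (x0 m \<inter> y) \<le> m" if "y \<in> Xset m" for y
    using card_mono[of "x0 m" "x0 m \<inter> y"] by (simp add: x0_def)
  have min: "min (2 * (m - t1)) (2 * t1 + 1) \<le> min (2 * (m - card (x0 m \<inter> y))) (2 * card (x0 m \<inter> y) + 1)"
    if "w \<in> W" "w y \<noteq> 0" for w y
  proof -
    have "y \<in> Xset m" using in_X that by blast
    moreover have "odist m (x0 m) y1 \<le> odist m (x0 m) y"
      unfolding d1 using that calculation by (intro Least_le) blast
    ultimately show ?thesis using odist_eq[OF x0_in_Xset] y1(1) unfolding t1_def by simp
  qed
  let ?P1 = "{1..m}" and ?P2 = "{m+1..2*m+1}"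
  show thesis
  proof (cases "2 * (m - t1) \<le> 2 * t1 + 1")
    case True
    interpret H: halves m ?P1 ?P2 by unfold_locales auto
    have sl: "H.s y = m - card (x0 m \<inter> y)" if "y \<in> Xset m" for y
      using H.lev_s(2)[OF that] unfolding H.s_of_lev_def x0_def by (simp only: refl if_True)
    interpret B: module_bottom m ?P1 ?P2 E W "m - t1"
    proof unfold_locales
      show "\<exists>w\<in>W. \<exists>y\<in>Xset m. H.s y = m - t1 \<and> w y \<noteq> 0" using y1 sl t1_def by blast
      fix w y assume w: "w \<in> W" "w y \<noteq> 0"
      show "m - t1 \<le> H.s y \<and> H.s y + (m - t1) \<le> card ?P1"
        using min[OF w] True sl[OF in_X[OF w]] t_le[OF in_X[OF w]] by (auto simp: min_def split: if_splits)
    qed (fact assms)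
    show thesis
    proof (rule that[of "m - t1" B.\<beta>])
      show "2 * (m - t1) \<le> m" using B.two_alpha by simp
      have le: "B.\<beta> \<le> m - t1" using B.\<beta>_le by simp
      then show "2 * B.\<beta> \<le> m + 1" using B.two_alpha by simp
      show "dual_endpoint m E W = m - t1 + B.\<beta>" by (rule B.\<mu>_eq)
      show "diameter m W = (if B.\<beta> \<le> m - t1 then m - 2 * (m - t1) else m + 1 - 2 * B.\<beta>)"
        using B.diameter_eq le by simp
      show "casim m ?P1 v = (\<lambda>y. - of_nat ((m - t1) * (m + 1 - (m - t1))) * v y)" if "v \<in> W" for v
        using B.casim_P_W[OF that] by simp
      show "casim m ?P2 v = (\<lambda>y. - of_nat (B.\<beta> * (m + 2 - B.\<beta>)) * v y)" if "v \<in> W" for v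
        using B.casim_Q_W[OF that] by simp
    qed
  next
    case False
    interpret H: halves m ?P2 ?P1 by unfold_locales auto
    have P2: "?P2 \<noteq> x0 m" using card_atLeastAtMost by (auto simp: x0_def dest!: arg_cong[of _ _ card])
    have sl: "H.s y = card (x0 m \<inter> y) + 1" if "y \<in> Xset m" for y
      using H.lev_s(2)[OF that] unfolding H.s_of_lev_def if_not_P[OF P2] .
    interpret B: module_bottom m ?P2 ?P1 E W "t1 + 1"
    proof unfold_locales
      show "\<exists>w\<in>W. \<exists>y\<in>Xset m. H.s y = t1 + 1 \<and> w y \<noteq> 0" using y1 sl t1_def by blast
      fix w y assume w: "w \<in> W" "w y \<noteq> 0"
      show "t1 + 1 \<le> H.s y \<and> H.s y + (t1 + 1) \<le> card ?P2"
        using min[OF w] False sl[OF in_X[OF w]] t_le[OF in_X[OF w]] by (auto simp: min_def split: if_splits)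
    qed (fact assms)
    show thesis
    proof (rule that[of B.\<beta> "t1 + 1"])
      show "2 * (t1 + 1) \<le> m + 1" using B.two_alpha by simp
      have le: "B.\<beta> < t1 + 1" using B.\<beta>_le by simp
      then show "2 * B.\<beta> \<le> m" using B.two_alpha by simp
      show "dual_endpoint m E W = B.\<beta> + (t1 + 1)" using B.\<mu>_eq by simp
      show "diameter m W = (if t1 + 1 \<le> B.\<beta> then m - 2 * B.\<beta> else m + 1 - 2 * (t1 + 1))"
        using B.diameter_eq le by simp
      show "casim m ?P2 v = (\<lambda>y. - of_nat ((t1 + 1) * (m + 2 - (t1 + 1))) * v y)" if "v \<in> W" for v
        using B.casim_P_W[OF that] by simp
      show "casim m ?P1 v = (\<lambda>y. - of_nat (B.\<beta> * (m + 1 - B.\<beta>)) * v y)" if "v \<in> W" for v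
        using B.casim_Q_W[OF that] by simp
    qed
  qed
qed

end

subsection \<open>Existence\<close>

interpretation vec: vector_space "\<lambda>(c::complex) (v::vec) y. c * v y"
  by unfold_locales (auto simp: fun_eq_iff algebra_simps)

lemma is_subspace_iff: "is_subspace m W \<longleftrightarrow> W \<subseteq> Vspace m \<and> vec.subspace W"
  by (auto simp: is_subspace_def vec.subspace_def plus_fun_def zero_fun_def)

lemma Vspace_span: "Vspace m \<subseteq> vec.span ((\<lambda>x y. if y = x then 1 else 0) ` Xset m)"
proof
  fix v assume v: "v \<in> Vspace m"
  let ?d = "\<lambda>x y. if y = x then 1 else (0::complex)"
  have "v = (\<Sum>x\<in>Xset m. (\<lambda>y. v x * ?d x y))"
  proof
    fix y
    have "(\<Sum>x\<in>Xset m. (\<lambda>y. v x * ?d x y)) y = (\<Sum>x\<in>Xset m. v x * ?d x y)"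
      using finite_Xset[of m] by induction auto
    also have "\<dots> = (\<Sum>x\<in>Xset m. if x = y then v y else 0)" by (intro sum.cong) auto
    also have "\<dots> = v y" using Vspace_outside[OF v] by (simp add: finite_Xset)
    finally show "v y = (\<Sum>x\<in>Xset m. (\<lambda>y. v x * ?d x y)) y" by simp
  qed
  also have "\<dots> \<in> vec.span (?d ` Xset m)"
    by (intro vec.span_sum vec.span_scale vec.span_base) auto
  finally show "v \<in> vec.span (?d ` Xset m)" .
qed

lemma subspace_dim_less:
  assumes W: "is_subspace m W" and W': "is_subspace m W'" and lt: "W \<subset> W'"
  shows "vec.dim W < vec.dim W'"
proof -
  obtain B where B: "B \<subseteq> W" "vec.independent B" "W \<subseteq> vec.span B" "card B = vec.dim W"
    using vec.basis_exists by blast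
  obtain B' where B': "B \<subseteq> B'" "B' \<subseteq> W'" "vec.independent B'" "W' \<subseteq> vec.span B'"
    using vec.maximal_independent_subset_extend[of B W'] B lt by blast
  have "finite ((\<lambda>x y. if y = x then 1 else (0::complex)) ` Xset m)" using finite_Xset by blast
  from vec.independent_span_bound[OF this B'(3)] have "finite B'"
    using B'(2) W' Vspace_span unfolding is_subspace_iff by blast
  moreover have "B \<noteq> B'"
  proof
    assume "B = B'"
    then have "W' \<subseteq> vec.span W" using B'(4) vec.span_mono[OF B(1)] by blast
    also have "vec.span W = W" using W vec.span_eq_iff unfolding is_subspace_iff by blast
    finally show False using lt by blast
  qed
  ultimately have "card B < card B'" using B'(1) by (intro psubset_card_mono) auto
  then show ?thesis using B(4) vec.basis_card_eq_dim[OF B'(2,4,3)] by simp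
qed

text \<open>A nonzero submodule of least dimension is irreducible.\<close>

lemma ex_irreducible_submodule:
  assumes U: "T_module m U" "U \<noteq> {\<lambda>_. 0}"
  obtains W where "W \<subseteq> U" "irreducible_T_module m W"
proof -
  let ?P = "\<lambda>W. T_module m W \<and> W \<noteq> {\<lambda>_. 0} \<and> W \<subseteq> U"
  define W where "W = (ARG_MIN vec.dim W. ?P W)"
  have W: "?P W" and min: "\<And>W'. ?P W' \<Longrightarrow> vec.dim W \<le> vec.dim W'"
    unfolding W_def using arg_min_nat_lemma[of ?P U vec.dim] U by blast+
  have "W' = W" if "T_module m W'" "W' \<subseteq> W" "W' \<noteq> {\<lambda>_. 0}" for W'
  proof (rule ccontr)
    assume "W' \<noteq> W"
    then have "vec.dim W' < vec.dim W"
      using that W by (intro subspace_dim_less) (auto simp: T_module_def)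
    then show False using min[of W'] that W by auto
  qed
  then have "irreducible_T_module m W" using W by (auto simp: irreducible_T_module_def)
  then show thesis using that W by blast
qed

text \<open>A product of differences over disjoint pairs is an eigenvector of the swap operator:
  swaps exchanging a pair contribute a sign, and swaps that break up a pair contribute zero.\<close>

locale disjoint_pairs =
  fixes P :: "nat set" and a :: nat and l r :: "nat \<Rightarrow> nat"
  assumes fin: "finite P"
    and inj_l: "inj_on l {..<a}" and inj_r: "inj_on r {..<a}"
    and disj: "l ` {..<a} \<inter> r ` {..<a} = {}"
    and sub: "l ` {..<a} \<subseteq> P" "r ` {..<a} \<subseteq> P"
begin

definition sgnprod :: "nat set \<Rightarrow> complex" where
  "sgnprod x = (\<Prod>i<a. of_bool (l i \<in> x) - of_bool (r i \<in> x))"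

lemma l_eq: "i < a \<Longrightarrow> j < a \<Longrightarrow> l i = l j \<longleftrightarrow> i = j" 
  and r_eq: "i < a \<Longrightarrow> j < a \<Longrightarrow> r i = r j \<longleftrightarrow> i = j"
  and lr: "i < a \<Longrightarrow> j < a \<Longrightarrow> l i \<noteq> r j"
  using inj_l inj_r disj by (auto simp: inj_on_def)

lemma sgnprod_transpose:
  assumes "i < a"
  shows "sgnprod (transpose (l i) (r i) ` x) = - sgnprod x"
proof -
  let ?t = "transpose (l i) (r i)"
  have mem: "p \<in> ?t ` x \<longleftrightarrow> ?t p \<in> x" for p by (metis image_iff transpose_involutory)
  let ?g = "\<lambda>x j. of_bool (l j \<in> x) - of_bool (r j \<in> x) :: complex"
  have "sgnprod (?t ` x) = ?g (?t ` x) i * (\<Prod>j\<in>{..<a}-{i}. ?g (?t ` x) j)"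
    unfolding sgnprod_def using assms by (subst prod.remove[of _ i]) auto
  also have "?g (?t ` x) i = - ?g x i" unfolding mem by simp
  also have "(\<Prod>j\<in>{..<a}-{i}. ?g (?t ` x) j) = (\<Prod>j\<in>{..<a}-{i}. ?g x j)"
    unfolding mem using assms l_eq r_eq lr by (intro prod.cong refl) (auto simp: transpose_def lr[symmetric])
  also have "- ?g x i * (\<Prod>j\<in>{..<a}-{i}. ?g x j) = - sgnprod x"
    unfolding sgnprod_def using assms by (subst (2) prod.remove[of _ i]) auto
  finally show ?thesis .
qed

text \<open>Transposing the points of the pair fixes \<open>y\<close>, permutes the swaps and
  negates each summand, so the sum is its own negative.\<close>

lemma swap_sum_broken_pair:
  assumes i: "i < a" and broken: "l i \<in> y \<longleftrightarrow> r i \<in> y"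
  shows "(\<Sum>p\<in>P - y. \<Sum>q\<in>P \<inter> y. sgnprod (insert p y - {q})) = 0"
proof -
  let ?t = "transpose (l i) (r i)"
  have ty: "?t ` y = y" using broken by (auto simp: transpose_def image_iff) 
  have lP: "l i \<in> P" "r i \<in> P" using i sub by auto
  have mem: "?t p \<in> y \<longleftrightarrow> p \<in> y" for p using broken by (auto simp: transpose_def)
  have memP: "?t p \<in> P \<longleftrightarrow> p \<in> P" for p using lP by (auto simp: transpose_def)
  let ?S = "\<Sum>p\<in>P - y. \<Sum>q\<in>P \<inter> y. sgnprod (insert p y - {q})"
  have bij: "bij_betw ?t (P - y) (P - y)" "bij_betw ?t (P \<inter> y) (P \<inter> y)"
    by (rule bij_betw_byWitness[where f' = ?t]; use mem memP in auto)+
  have "?S = (\<Sum>p\<in>P - y. \<Sum>q\<in>P \<inter> y. sgnprod (insert (?t p) y - {?t q}))"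
    by (subst sum.reindex_bij_betw[OF bij(1), symmetric], subst sum.reindex_bij_betw[OF bij(2), symmetric]) simp
  also have "\<dots> = (\<Sum>p\<in>P - y. \<Sum>q\<in>P \<inter> y. - sgnprod (insert p y - {q}))"
  proof (intro sum.cong refl)
    fix p q
    have "insert (?t p) y - {?t q} = ?t ` (insert p y - {q})"
      by (simp add: image_set_diff[OF inj_on_subset[OF inj_transpose subset_UNIV]] ty)
    then show "sgnprod (insert (?t p) y - {?t q}) = - sgnprod (insert p y - {q})"
      using sgnprod_transpose[OF i] by simp
  qed
  also have "\<dots> = - ?S" by (simp add: sum_negf)
  finally show ?thesis by simp
qed

lemma sgnprod_broken: "i < a \<Longrightarrow> l i \<in> y \<longleftrightarrow> r i \<in> y \<Longrightarrow> sgnprod y = 0"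
  unfolding sgnprod_def by (rule prod_zero) auto

lemma sgnprod_cong:
  assumes "\<And>i. i < a \<Longrightarrow> (l i \<in> x \<longleftrightarrow> l i \<in> y) \<and> (r i \<in> x \<longleftrightarrow> r i \<in> y)"
  shows "sgnprod x = sgnprod y"
  unfolding sgnprod_def using assms by (intro prod.cong refl) auto

lemma swap_sum:
  "(\<Sum>p\<in>P - y. \<Sum>q\<in>P \<inter> y. sgnprod (insert p y - {q}))
    = ((of_nat (card (P \<inter> y)) - of_nat a) * (of_nat (card (P - y)) - of_nat a) - of_nat a) * sgnprod y"
proof (cases "\<exists>i<a. l i \<in> y \<longleftrightarrow> r i \<in> y")
  case True
  then obtain i where "i < a" "l i \<in> y \<longleftrightarrow> r i \<in> y" by blast
  then show ?thesis using swap_sum_broken_pair sgnprod_broken by simp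
next
  case False
  then have split: "l i \<in> y \<longleftrightarrow> r i \<notin> y" if "i < a" for i using that by blast
  \<comment> \<open>\<open>c i\<close> and \<open>u i\<close> are the members of pair
    \<open>i\<close> inside and outside \<open>y\<close>. The swap of \<open>u i\<close> for
    \<open>c i\<close> counts \<open>-1\<close>, a swap of points belonging to no pair counts
    \<open>1\<close>, and every other swap breaks a pair.\<close>
  define c where "c i = (if l i \<in> y then l i else r i)" for i
  define u where "u i = (if l i \<in> y then r i else l i)" for i
  let ?C = "c ` {..<a}" and ?U = "u ` {..<a}"
  have pair: "{l i, r i} = {c i, u i}" for i by (auto simp: c_def u_def)
  have cy: "c i \<in> P \<inter> y" and uy: "u i \<in> P - y" if "i < a" for i
    using sub that split[OF that] by (auto simp: c_def u_def)
  have c_eq: "c i = c j \<longleftrightarrow> i = j" and u_eq: "u i = u j \<longleftrightarrow> i = j" if "i < a" "j < a" for i j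
    using l_eq[OF that] r_eq[OF that] lr[OF that] lr[OF that(2,1)] by (auto simp: c_def u_def)
  have cardC: "card ?C = a" and cardU: "card ?U = a"
    using c_eq u_eq by (auto intro!: card_image[THEN trans] simp: inj_on_def)
  have C: "?C \<subseteq> P \<inter> y" and U: "?U \<subseteq> P - y" using cy uy by auto
  have val_pair: "sgnprod (insert (u i) y - {q}) = (if q = c i then - sgnprod y else 0)"
    if i: "i < a" and q: "q \<in> P \<inter> y" for i q
  proof (cases "q = c i")
    case True
    have "insert (u i) y - {c i} = transpose (l i) (r i) ` y"
    proof (cases "l i \<in> y")
      case True
      then show ?thesis using split[OF i] lr[OF i i]
        by (auto simp: c_def u_def transpose_def image_iff)
    next
      case False
      then show ?thesis using split[OF i] lr[OF i i]
        by (auto simp: c_def u_def transpose_def image_iff)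
    qed
    then show ?thesis using True sgnprod_transpose[OF i] by simp
  next
    case False
    have "l i \<in> insert (u i) y - {q}" "r i \<in> insert (u i) y - {q}"
      using False q split[OF i] uy[OF i] by (auto simp: c_def u_def split: if_splits)
    then show ?thesis using False sgnprod_broken[OF i] by simp
  qed
  have val_free: "sgnprod (insert p y - {q}) = (if q \<in> ?C then 0 else sgnprod y)"
    if p: "p \<in> P - y - ?U" and q: "q \<in> P \<inter> y" for p q
  proof (cases "q \<in> ?C")
    case True
    then obtain i where i: "i < a" "q = c i" by auto
    have "p \<noteq> u i" using p i by auto
    then have "l i \<notin> insert p y - {q}" "r i \<notin> insert p y - {q}"
      using i p split[OF i(1)] by (auto simp: c_def u_def split: if_splits)
    then have "sgnprod (insert p y - {q}) = 0" by (intro sgnprod_broken[OF i(1)]) blast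
    then show ?thesis using True by simp
  next
    case False
    have "sgnprod (insert p y - {q}) = sgnprod y"
    proof (rule sgnprod_cong)
      fix i assume i: "i < a"
      have "p \<noteq> u i" "q \<noteq> c i" using p False i by auto
      then show "(l i \<in> insert p y - {q} \<longleftrightarrow> l i \<in> y) \<and> (r i \<in> insert p y - {q} \<longleftrightarrow> r i \<in> y)"
        using p q split[OF i] by (auto simp: c_def u_def split: if_splits)
    qed
    then show ?thesis using False by simp
  qed
  have fin': "finite (P - y)" "finite (P \<inter> y)" using fin by auto
  have "(\<Sum>p\<in>P - y. \<Sum>q\<in>P \<inter> y. sgnprod (insert p y - {q}))
    = (\<Sum>p\<in>P - y - ?U. \<Sum>q\<in>P \<inter> y. sgnprod (insert p y - {q})) + (\<Sum>p\<in>?U. \<Sum>q\<in>P \<inter> y. sgnprod (insert p y - {q}))"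
    by (rule sum.subset_diff[OF U fin'(1)])
  also have "(\<Sum>p\<in>?U. \<Sum>q\<in>P \<inter> y. sgnprod (insert p y - {q})) = (\<Sum>i<a. \<Sum>q\<in>P \<inter> y. sgnprod (insert (u i) y - {q}))"
    using u_eq by (subst sum.reindex) (auto simp: inj_on_def)
  also have "\<dots> = (\<Sum>i<a. - sgnprod y)"
  proof (rule sum.cong[OF refl])
    fix i assume "i \<in> {..<a}"
    then have i: "i < a" by simp
    have "(\<Sum>q\<in>P \<inter> y. sgnprod (insert (u i) y - {q})) = (\<Sum>q\<in>P \<inter> y. if q = c i then - sgnprod y else 0)"
      using val_pair[OF i] by (rule sum.cong[OF refl])
    then show "(\<Sum>q\<in>P \<inter> y. sgnprod (insert (u i) y - {q})) = - sgnprod y"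
      using cy[OF i] fin' by simp
  qed
  also have "(\<Sum>p\<in>P - y - ?U. \<Sum>q\<in>P \<inter> y. sgnprod (insert p y - {q}))
    = (\<Sum>p\<in>P - y - ?U. \<Sum>q\<in>P \<inter> y. if q \<in> ?C then 0 else sgnprod y)"
    using val_free by (intro sum.cong refl)
  also have "\<dots> = of_nat (card (P - y - ?U)) * (of_nat (card (P \<inter> y - ?C)) * sgnprod y)"
  proof -
    have "(\<Sum>q\<in>P \<inter> y. if q \<in> ?C then 0 else sgnprod y) = (\<Sum>q\<in>P \<inter> y - ?C. sgnprod y)"
      by (rule sum.mono_neutral_cong_right) (use fin' in auto)
    then show ?thesis by simp
  qed
  also have "card (P - y - ?U) = card (P - y) - a" using card_Diff_subset[OF _ U] cardU by simp
  also have "card (P \<inter> y - ?C) = card (P \<inter> y) - a" using card_Diff_subset[OF _ C] cardC by simp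
  also have "complex_of_nat (card (P - y) - a) = of_nat (card (P - y)) - of_nat a"
    using card_mono[OF fin'(1) U] cardU by (simp add: of_nat_diff)
  also have "complex_of_nat (card (P \<inter> y) - a) = of_nat (card (P \<inter> y)) - of_nat a"
    using card_mono[OF fin'(2) C] cardC by (simp add: of_nat_diff)
  finally show ?thesis by (simp add: algebra_simps)
qed

end

context disjoint_pairs begin

text \<open>A set containing every \<open>l i\<close> and avoiding every \<open>r i\<close> makes
  each factor \<open>1\<close>.\<close>

lemma sgnprod_nonzero_exists:
  assumes "a \<le> k" "k + a \<le> card P"
  obtains Y where "Y \<subseteq> P" "card Y = k" "sgnprod Y \<noteq> 0"
proof -
  have L: "card (l ` {..<a}) = a" and R: "card (r ` {..<a}) = a"
    using inj_l inj_r by (simp_all add: card_image)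
  have "card (P - r ` {..<a}) = card P - a"
    using R sub(2) by (simp add: card_Diff_subset)
  moreover have "l ` {..<a} \<subseteq> P - r ` {..<a}" using sub disj by blast
  ultimately obtain Y where Y: "l ` {..<a} \<subseteq> Y" "Y \<subseteq> P - r ` {..<a}" "card Y = k"
    using exists_subset_between[of "l ` {..<a}" k "P - r ` {..<a}"] assms L fin by fastforce
  have "sgnprod Y = (\<Prod>i<a. 1)"
    unfolding sgnprod_def using Y by (intro prod.cong refl) auto
  then show thesis using that[of Y] Y by auto
qed

text \<open>\<open>g\<close> carries the dependence on the other half. Removing
  \<open>card (P - y) * card (P \<inter> y)\<close> from the factor in \<open>swap_sum\<close>
  leaves \<open>a^2 - a * card P - a\<close>, whatever the level.\<close>

lemma casim_sgnprod:
  assumes P: "P \<subseteq> gr m"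
    and g: "\<And>p q y. p \<in> P \<Longrightarrow> q \<in> P \<Longrightarrow> g (insert p y - {q}) = (g y :: complex)"
    and w: "\<And>y. w y = (if y \<in> Xset m \<and> card (P \<inter> y) = k then sgnprod y * g y else 0)"
    and a: "a \<le> card P"
  shows "casim m P w = (\<lambda>y. - of_nat (a * (card P + 1 - a)) * w y)"
proof
  fix y
  show "casim m P w y = - of_nat (a * (card P + 1 - a)) * w y"
  proof (cases "y \<in> Xset m")
    case y: True
    have card_swap: "card (P \<inter> (insert p y - {q})) = card (P \<inter> y)" if "p \<in> P - y" "q \<in> P \<inter> y" for p q
    proof -
      have "P \<inter> (insert p y - {q}) = insert p (P \<inter> y - {q})" using that by auto
      then show ?thesis using that fin card_Suc_Diff1[of "P \<inter> y" q] by simp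
    qed
    have inX: "insert p y - {q} \<in> Xset m" if "p \<in> P - y" "q \<in> P \<inter> y" for p q
      using swap_vertex[OF y, of p q] that P by auto
    show ?thesis
    proof (cases "card (P \<inter> y) = k")
      case True
      have "swp m P w y = (\<Sum>p\<in>P - y. \<Sum>q\<in>P \<inter> y. sgnprod (insert p y - {q}) * g y)"
        unfolding swp_def if_P[OF y]
        by (intro sum.cong refl) (auto simp: w inX card_swap True g)
      also have "\<dots> = (\<Sum>p\<in>P - y. \<Sum>q\<in>P \<inter> y. sgnprod (insert p y - {q})) * g y"
        by (simp only: sum_distrib_right)
      finally have "swp m P w y = ((of_nat (card (P \<inter> y)) - of_nat a) * (of_nat (card (P - y)) - of_nat a) - of_nat a) * w y"
        unfolding swap_sum using True y by (simp add: w)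
      moreover have "complex_of_nat (card (P - y)) = of_nat (card P) - of_nat (card (P \<inter> y))"
        using card_Int_Diff[OF fin, of y] by simp
      moreover have "complex_of_nat (a * (card P + 1 - a)) = of_nat a * (of_nat (card P) + 1 - of_nat a)"
        using a by (simp add: of_nat_diff)
      ultimately show ?thesis unfolding casim_def by (simp only:) (simp add: algebra_simps)
    next
      case False
      then have "swp m P w y = 0"
        unfolding swp_def if_P[OF y] by (intro sum.neutral ballI) (simp add: w card_swap)
      then show ?thesis using False by (simp add: casim_def w)
    qed
  qed (simp add: casim_def swp_def w)
qed

end

section \<open>Realising all Casimir parameters and all pairs of the theorem\<close>

lemma ex_casim_eigenvector:
  assumes ab: "2 * a \<le> m" "2 * b \<le> m + 1"
  obtains w where "w \<in> Vspace m" "w \<noteq> (\<lambda>_. 0)"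
    "casim m {1..m} w = (\<lambda>y. - of_nat (a * (m + 1 - a)) * w y)"
    "casim m {m+1..2*m+1} w = (\<lambda>y. - of_nat (b * (m + 2 - b)) * w y)"
proof -
  \<comment> \<open>Both products can be nonzero on level \<open>t\<close> if
    \<open>a \<le> t \<le> m - a\<close> and \<open>b \<le> m - t \<le> m + 1 - b\<close>; this is
    the least such \<open>t\<close>.\<close>
  define t where "t = max a (b - 1)"
  have t: "a \<le> t" "t + a \<le> m" "b \<le> t + 1" "t + b \<le> m"
    unfolding t_def using ab by auto
  let ?P = "{1..m}" and ?Q = "{m+1..2*m+1}"
  interpret H: halves m ?P ?Q by unfold_locales auto
  interpret D1: disjoint_pairs ?P a "\<lambda>i. 2 * i + 1" "\<lambda>i. 2 * i + 2"
    using ab by unfold_locales (auto simp: inj_on_def, presburger)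
  interpret D2: disjoint_pairs ?Q b "\<lambda>i. m + 2 * i + 1" "\<lambda>i. m + 2 * i + 2"
    using ab by unfold_locales (auto simp: inj_on_def, presburger)
  let ?S1 = "disjoint_pairs.sgnprod a (\<lambda>i. 2 * i + 1) (\<lambda>i. 2 * i + 2)"
  let ?S2 = "disjoint_pairs.sgnprod b (\<lambda>i. m + 2 * i + 1) (\<lambda>i. m + 2 * i + 2)"
  define w where "w y = (if y \<in> Xset m \<and> card (?P \<inter> y) = t then ?S1 y * ?S2 y else 0)" for y
  have cong1: "?S1 x = ?S1 y" if "?P \<inter> x = ?P \<inter> y" for x y
    using that D1.sub by (intro D1.sgnprod_cong) blast
  have cong2: "?S2 x = ?S2 y" if "?Q \<inter> x = ?Q \<inter> y" for x y
    using that D2.sub by (intro D2.sgnprod_cong) blast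
  have c1: "casim m ?P w = (\<lambda>y. - of_nat (a * (card ?P + 1 - a)) * w y)"
  proof (rule D1.casim_sgnprod[where k = t and g = ?S2])
    show "?S2 (insert p y - {q}) = ?S2 y" if "p \<in> ?P" "q \<in> ?P" for p q y
      by (rule cong2) (use that in auto)
  qed (use ab H.P_sub in \<open>auto simp: w_def\<close>)
  have c2: "casim m ?Q w = (\<lambda>y. - of_nat (b * (card ?Q + 1 - b)) * w y)"
  proof (rule D2.casim_sgnprod[where k = "m - t" and g = ?S1])
    show "?S1 (insert p y - {q}) = ?S1 y" if "p \<in> ?Q" "q \<in> ?Q" for p q y
      by (rule cong1) (use that in auto)
    show "w y = (if y \<in> Xset m \<and> card (?Q \<inter> y) = m - t then ?S2 y * ?S1 y else 0)" for y
    proof (cases "y \<in> Xset m")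
      case True
      have "card (?P \<inter> y) + card (?Q \<inter> y) = m"
        using H.card_Q_Int[OF True] H.card_P_Int[of y] H.s_le[of y] by simp
      then have "card (?P \<inter> y) = t \<longleftrightarrow> card (?Q \<inter> y) = m - t" using t by linarith
      then show ?thesis by (simp add: w_def)
    qed (simp add: w_def)
  qed (use ab H.Q_sub in auto)
  obtain Y1 where Y1: "Y1 \<subseteq> ?P" "card Y1 = t" "?S1 Y1 \<noteq> 0"
    using D1.sgnprod_nonzero_exists[OF t(1)] t(2) by (metis card_atLeastAtMost diff_Suc_1)
  have "b \<le> m - t" "m - t + b \<le> card ?Q" using t by auto
  from D2.sgnprod_nonzero_exists[OF this]
  obtain Y2 where Y2: "Y2 \<subseteq> ?Q" "card Y2 = m - t" "?S2 Y2 \<noteq> 0" .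
  have fin: "finite Y1" "finite Y2" using Y1(1) Y2(1) finite_subset by blast+
  have i1: "?P \<inter> (Y1 \<union> Y2) = Y1" and i2: "?Q \<inter> (Y1 \<union> Y2) = Y2" and "Y1 \<inter> Y2 = {}"
    using Y1(1) Y2(1) H.PQ_disj by blast+
  then have "card (Y1 \<union> Y2) = m" using Y1(2) Y2(2) fin t by (simp add: card_Un_disjoint)
  moreover have "Y1 \<union> Y2 \<subseteq> gr m" using Y1(1) Y2(1) H.P_sub H.Q_sub by blast
  moreover have "?S1 (Y1 \<union> Y2) = ?S1 Y1" "?S2 (Y1 \<union> Y2) = ?S2 Y2"
    using i1 i2 by (intro cong1 cong2; blast)+
  ultimately have "w (Y1 \<union> Y2) \<noteq> 0"
    using Y1 Y2 i1 by (simp add: w_def Xset_iff)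
  then have "w \<noteq> (\<lambda>_. 0)" by auto
  moreover have "w \<in> Vspace m" by (auto simp: Vspace_def w_def)
  ultimately show thesis using that[of w] c1 c2 by simp
qed

lemma T_module_Vspace_all:
  assumes "m \<ge> 1" shows "T_module m (Vspace m)"
  by (rule T_moduleI[OF assms]) (auto simp: is_subspace_def Vspace_def flip_def)

lemma ex_irreducible_casim:
  assumes "m \<ge> 1" "2 * a \<le> m" "2 * b \<le> m + 1"
  obtains W where "irreducible_T_module m W"
    "\<And>v. v \<in> W \<Longrightarrow> casim m {1..m} v = (\<lambda>y. - of_nat (a * (m + 1 - a)) * v y)"
    "\<And>v. v \<in> W \<Longrightarrow> casim m {m+1..2*m+1} v = (\<lambda>y. - of_nat (b * (m + 2 - b)) * v y)"
proof -
  let ?P = "{1..m}" and ?Q = "{m+1..2*m+1}"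
  interpret H: halves m ?P ?Q by unfold_locales auto
  interpret H': halves m ?Q ?P by unfold_locales auto
  let ?U1 = "{v \<in> Vspace m. casim m ?P v = (\<lambda>y. - of_nat (a * (m + 1 - a)) * v y)}"
  let ?U2 = "{v \<in> ?U1. casim m ?Q v = (\<lambda>y. - of_nat (b * (m + 2 - b)) * v y)}"
  have "T_module m ?U2"
    by (intro H.casim_eigenspace_T_module H'.casim_eigenspace_T_module T_module_Vspace_all assms)
  moreover obtain w where "w \<in> ?U2" "w \<noteq> (\<lambda>_. 0)"
    using ex_casim_eigenvector[OF assms(2,3)] by blast
  ultimately obtain W where "W \<subseteq> ?U2" "irreducible_T_module m W"
    using ex_irreducible_submodule[of m ?U2] by blast
  then show thesis using that[of W] by blast
qed

text \<open>The difference of the two values factors as \<open>(x - y) * (c - x - y)\<close>. This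
  recovers \<open>a\<close> and \<open>b\<close> from the Casimir scalars.\<close>

lemma quadratic_inj:
  fixes x y c :: nat
  assumes "x * (c - x) = y * (c - y)" "x + y < c"
  shows "x = y"
proof -
  have "(int x - int y) * (int c - int x - int y) = 0"
  proof -
    have "int x * (int c - int x) = int y * (int c - int y)"
      using assms by (metis add_lessD1 add.commute less_imp_le of_nat_diff of_nat_mult)
    then show ?thesis by (simp add: algebra_simps)
  qed
  then show ?thesis using assms(2) by auto
qed

context odd_spectrum begin

lemma ex_irreducible_params:
  assumes ab: "2 * a \<le> m" "2 * b \<le> m + 1"
  shows "\<exists>W. irreducible_T_module m W \<and> dual_endpoint m E W = a + b
    \<and> diameter m W = (if b \<le> a then m - 2 * a else m + 1 - 2 * b)"
proof -
  obtain W where W: "irreducible_T_module m W"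
    "\<And>v. v \<in> W \<Longrightarrow> casim m {1..m} v = (\<lambda>y. - of_nat (a * (m + 1 - a)) * v y)"
    "\<And>v. v \<in> W \<Longrightarrow> casim m {m+1..2*m+1} v = (\<lambda>y. - of_nat (b * (m + 2 - b)) * v y)"
    using ex_irreducible_casim[OF m_pos ab] by blast
  obtain a' b' where ab': "2 * a' \<le> m" "2 * b' \<le> m + 1"
    "\<And>v. v \<in> W \<Longrightarrow> casim m {1..m} v = (\<lambda>y. - of_nat (a' * (m + 1 - a')) * v y)"
    "\<And>v. v \<in> W \<Longrightarrow> casim m {m+1..2*m+1} v = (\<lambda>y. - of_nat (b' * (m + 2 - b')) * v y)"
    "dual_endpoint m E W = a' + b'"
    "diameter m W = (if b' \<le> a' then m - 2 * a' else m + 1 - 2 * b')"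
    using irreducible_classification[OF W(1)] by blast
  obtain v y where v: "v \<in> W" "v y \<noteq> 0"
    using W(1) T_module_zero[of m W] unfolding irreducible_T_module_def by fastforce
  have "of_nat (a * (m + 1 - a)) = (of_nat (a' * (m + 1 - a')) :: complex)"
    using fun_cong[OF W(2)[OF v(1)], of y] fun_cong[OF ab'(3)[OF v(1)], of y] v(2)
    by (simp del: of_nat_mult)
  then have "a * (m + 1 - a) = a' * (m + 1 - a')" by (simp only: of_nat_eq_iff)
  then have a: "a = a'" by (rule quadratic_inj) (use ab ab' in linarith)
  have "of_nat (b * (m + 2 - b)) = (of_nat (b' * (m + 2 - b')) :: complex)"
    using fun_cong[OF W(3)[OF v(1)], of y] fun_cong[OF ab'(4)[OF v(1)], of y] v(2)
    by (simp del: of_nat_mult)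
  then have "b * (m + 2 - b) = b' * (m + 2 - b')" by (simp only: of_nat_eq_iff)
  then have b: "b = b'" by (rule quadratic_inj) (use ab ab' in linarith)
  show ?thesis using W(1) ab' a b by auto
qed

theorem irreducible_iff:
  "(\<exists>W. irreducible_T_module m W \<and> int (dual_endpoint m E W) = \<mu> \<and> int (diameter m W) = d)
     \<longleftrightarrow> 0 \<le> d \<and> d \<le> int m \<and> int m - d \<le> 2 * \<mu> \<and> \<mu> \<le> int m - d" (is "?L \<longleftrightarrow> ?R")
proof
  assume ?L
  then obtain W where W: "irreducible_T_module m W" "int (dual_endpoint m E W) = \<mu>" "int (diameter m W) = d"
    by blast
  obtain a b where "2 * a \<le> m" "2 * b \<le> m + 1" "dual_endpoint m E W = a + b"
    "diameter m W = (if b \<le> a then m - 2 * a else m + 1 - 2 * b)"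
    by (rule irreducible_classification[OF W(1)]) blast
  then show ?R using W(2,3) by (auto split: if_splits)
next
  assume R: ?R
  define e where "e = nat (int m - d)"
  define u where "u = nat \<mu>"
  have e: "int e = int m - d" "int u = \<mu>" "e \<le> m" "e \<le> 2 * u" "u \<le> e" using R by (auto simp: e_def u_def)
  \<comment> \<open>By the diameter formula \<open>m - d\<close> is \<open>2 * a\<close> if
    \<open>b \<le> a\<close> and \<open>2 * b - 1\<close> otherwise, so its parity selects the case
    and fixes one parameter; \<open>\<mu> = a + b\<close> gives the other.\<close>
  define a where "a = (if even e then e div 2 else u - (e + 1) div 2)"
  define b where "b = (if even e then u - e div 2 else (e + 1) div 2)"
  have ab: "2 * a \<le> m" "2 * b \<le> m + 1" "a + b = u" "(if b \<le> a then m - 2 * a else m + 1 - 2 * b) = m - e"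
    using e by (auto simp: a_def b_def elim!: evenE oddE)
  obtain W where "irreducible_T_module m W" "dual_endpoint m E W = u" "diameter m W = m - e"
    using ex_irreducible_params[OF ab(1,2)] unfolding ab(3,4) by blast
  moreover have "int (m - e) = d" using e by linarith
  ultimately show ?L using e(2) by auto
qed

end

subsection \<open>Uniqueness of the ordering\<close>

text \<open>Columns at \<open>x0 m\<close> of Bose-Mesner matrices have this form, so questions on
  \<open>E\<close> reduce to functions on \<open>0..m\<close>.\<close>

definition levfun :: "nat \<Rightarrow> (nat \<Rightarrow> complex) \<Rightarrow> vec" where
  "levfun m f = (\<lambda>y. if y \<in> Xset m then f (card (x0 m \<inter> y)) else 0)"

lemma level_le: "card (x0 m \<inter> y) \<le> m"
  using card_mono[of "x0 m" "x0 m \<inter> y"] by (simp add: x0_def)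

lemma ex_level:
  assumes "t \<le> m"
  obtains y where "y \<in> Xset m" "card (x0 m \<inter> y) = t"
proof -
  let ?y = "{1..t} \<union> {m+1..2*m-t}"
  have "card ?y = t + (m - t)"
    using assms by (subst card_Un_disjoint) auto
  moreover have "x0 m \<inter> ?y = {1..t}" using assms by (auto simp: x0_def)
  moreover have "?y \<subseteq> {1..2*m+1}" using assms by (intro Un_least) auto
  ultimately show thesis using that[of ?y] assms by (simp add: Xset_def)
qed

text \<open>Dropping one of the \<open>t + 1\<close> points outside the base vertex leads to level
  \<open>m - t\<close>, dropping one of the \<open>m - t\<close> points inside it to level
  \<open>m - 1 - t\<close>. The truncation at \<open>t = m\<close> is harmless, as its coefficient
  is \<open>0\<close>.\<close>

lemma flip_levfun:
  assumes y: "y \<in> Xset m" and t: "card (x0 m \<inter> y) = t"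
  shows "flip m (gr m) (levfun m f) y = (of_nat t + 1) * f (m - t) + of_nat (m - t) * f (m - 1 - t)"
proof -
  interpret H: halves m "{1..m}" "{m+1..2*m+1}" by unfold_locales auto
  let ?P = "{1..m}" and ?Q = "{m+1..2*m+1}"
  have P: "x0 m = ?P" by (simp add: x0_def)
  have s: "H.s y = m - t" using H.card_P_Int[of y] H.s_le[of y] t unfolding P by simp
  have t_le: "t \<le> m" using level_le[of m y] t by simp
  have lev: "card (x0 m \<inter> z) = m - H.s z" for z using H.card_P_Int[of z] unfolding P by simp
  have "flip m ?P (levfun m f) y = (\<Sum>p\<in>?P - y. f (m - 1 - t))"
    unfolding flip_def if_P[OF y]
  proof (rule sum.cong[OF refl])
    fix p assume p: "p \<in> ?P - y"
    have "gr m - y - {p} \<in> Xset m" using flip_vertex[OF y, of p] p H.P_sub by blast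
    moreover have "m - H.s (gr m - y - {p}) = m - 1 - t" using H.s_flip_P[OF p] s t_le by simp
    ultimately show "levfun m f (gr m - y - {p}) = f (m - 1 - t)" by (simp add: levfun_def lev)
  qed
  moreover have "flip m ?Q (levfun m f) y = (\<Sum>p\<in>?Q - y. f (m - t))"
    unfolding flip_def if_P[OF y]
  proof (rule sum.cong[OF refl])
    fix p assume p: "p \<in> ?Q - y"
    have "gr m - y - {p} \<in> Xset m" using flip_vertex[OF y, of p] p H.Q_sub by blast
    moreover have "m - H.s (gr m - y - {p}) = m - t" using H.s_flip_Q[OF p] s t_le by simp
    ultimately show "levfun m f (gr m - y - {p}) = f (m - t)" by (simp add: levfun_def lev)
  qed
  moreover have "card (?P - y) = m - t" using s unfolding H.s_def .
  moreover have "card (?Q - y) = t + 1" using H.card_Q_Diff[OF y] s t_le by linarith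
  ultimately show ?thesis using fun_cong[OF H.A_eq, of "levfun m f" y] by (simp add: add.commute)
qed

lemma casim_levfun:
  assumes "halves m P Q"
  shows "casim m P (levfun m f) = (\<lambda>_. 0)"
proof
  interpret H: halves m P Q by fact
  fix y
  show "casim m P (levfun m f) y = 0"
  proof (cases "y \<in> Xset m")
    case y: True
    have "levfun m f (insert p y - {q}) = levfun m f y" if "p \<in> P - y" "q \<in> P \<inter> y" for p q
    proof -
      have X: "insert p y - {q} \<in> Xset m" using swap_vertex[OF y, of p q] that H.P_sub by blast
      have "P - (insert p y - {q}) = insert q (P - y - {p})" using that by auto
      moreover have "q \<notin> P - y - {p}" "p \<in> P - y" using that by auto
      ultimately have "H.s (insert p y - {q}) = H.s y"
        using H.finP card_Suc_Diff1[of "P - y" p] by (simp add: H.s_def)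
      then show ?thesis using X y H.lev_s(1)[OF X] H.lev_s(1)[OF y] by (simp add: levfun_def)
    qed
    then have "swp m P (levfun m f) y = (\<Sum>p\<in>P - y. \<Sum>q\<in>P \<inter> y. levfun m f y)"
      unfolding swp_def if_P[OF y] by (intro sum.cong refl)
    then show ?thesis by (simp add: casim_def)
  qed (simp add: casim_def swp_def levfun_def)
qed

text \<open>Bilinear without conjugation: the matrices in play are symmetric, but neither their
  entries nor their eigenvalues are assumed to be real.\<close>

definition bil :: "nat \<Rightarrow> vec \<Rightarrow> vec \<Rightarrow> complex" where
  "bil m u v = (\<Sum>y\<in>Xset m. u y * v y)"

lemma odist_sym: "x \<in> Xset m \<Longrightarrow> y \<in> Xset m \<Longrightarrow> odist m x y = odist m y x"
  by (simp add: odist_eq Int_commute)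

lemma bil_flip:
  assumes "m \<ge> 1"
  shows "bil m (flip m (gr m) u) v = bil m u (flip m (gr m) v)"
proof -
  have "bil m (flip m (gr m) u) v = (\<Sum>y\<in>Xset m. \<Sum>z\<in>Xset m. Adist m 1 y z * u z * v y)"
    unfolding bil_def mvec_Adist_1[OF assms, symmetric] by (simp add: mvec_def sum_distrib_right)
  also have "\<dots> = (\<Sum>z\<in>Xset m. \<Sum>y\<in>Xset m. Adist m 1 y z * u z * v y)" by (rule sum.swap)
  also have "\<dots> = (\<Sum>z\<in>Xset m. \<Sum>y\<in>Xset m. u z * (Adist m 1 z y * v y))"
    by (intro sum.cong refl) (auto simp: Adist_def odist_sym)
  also have "\<dots> = bil m u (flip m (gr m) v)"
    unfolding bil_def mvec_Adist_1[OF assms, symmetric] by (simp add: mvec_def sum_distrib_left)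
  finally show ?thesis .
qed

lemma bil_scale_left: "bil m (\<lambda>y. c * u y) v = c * bil m u v"
  and bil_scale_right: "bil m u (\<lambda>y. c * v y) = c * bil m u v"
  and bil_add_right: "bil m u (\<lambda>y. v y + w y) = bil m u v + bil m u w"
  by (simp_all add: bil_def sum_distrib_left algebra_simps sum.distrib)

abbreviation lev_mult :: "nat \<Rightarrow> vec \<Rightarrow> vec" where
  "lev_mult m v \<equiv> (\<lambda>y. of_nat (card (x0 m \<inter> y)) * v y)"

text \<open>Pairing with \<open>u\<close> turns each outer \<open>A\<close> into the scalar
  \<open>\<theta>\<close>. With \<open>n = m + 1\<close> the constant in
  \<open>FP_FP_minus_FQ_FQ\<close> is \<open>0\<close> and \<open>s\<close> is the level plus
  one.\<close>

lemma (in halves) Askey_Wilson_bil: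
  assumes n: "n = m + 1" and m: "m \<ge> 1" and u: "A u = (\<lambda>y. \<theta> * u y)"
    and v: "A v = (\<lambda>y. \<theta>' * v y)" "casim m P v = (\<lambda>_. 0)" "casim m Q v = (\<lambda>_. 0)"
  shows "((\<theta> + \<theta>')\<^sup>2 - 1) * (bil m u (lev_mult m v) + bil m u v) = (2 * of_nat m + 3) * \<theta>'\<^sup>2 * bil m u v"
proof -
  have "P \<noteq> x0 m" using n P_eq_x0_iff by simp
  then have s: "s y = card (x0 m \<inter> y) + 1" if "y \<in> X" for y
    using lev_s(2)[OF that] unfolding s_of_lev_def by (simp only: if_False)
  have bil_s: "bil m u (K v) = bil m u (lev_mult m v) + bil m u v"
    unfolding bil_def sum.distrib[symmetric] by (intro sum.cong refl) (simp add: s algebra_simps)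
  have eq: "A (A (K v)) y + 2 * \<theta>' * A (K v) y = (1 - \<theta>' * \<theta>') * K v y + (2 * of_nat m + 3) * \<theta>' * \<theta>' * v y"
    if y: "y \<in> X" for y
  proof -
    have 1: "K (\<lambda>y. \<theta>' * v y) = (\<lambda>y. \<theta>' * K v y)" by (auto simp: mult.left_commute)
    have "A (A (K v)) y + 2 * (\<theta>' * A (K v) y) + of_nat (s y) * (\<theta>' * (\<theta>' * v y))
      = (2 * of_nat n + 1) * (\<theta>' * (\<theta>' * v y)) + FP (FP v) y - FQ (FQ v) y"
      using Askey_Wilson[of v y] unfolding v(1) 1 flip_scale by simp
    moreover have "FP (FP v) y - FQ (FQ v) y = of_nat (s y) * v y"
      using FP_FP_minus_FQ_FQ[OF y, of v] unfolding v(2,3) n by (simp add: algebra_simps)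
    ultimately show ?thesis unfolding n by (simp add: algebra_simps)
  qed
  have "bil m u (\<lambda>y. A (A (K v)) y + 2 * \<theta>' * A (K v) y)
      = bil m u (\<lambda>y. (1 - \<theta>' * \<theta>') * K v y + (2 * of_nat m + 3) * \<theta>' * \<theta>' * v y)"
    unfolding bil_def by (intro sum.cong refl) (simp only: eq)
  then have "\<theta> * (\<theta> * bil m u (K v)) + 2 * \<theta>' * (\<theta> * bil m u (K v))
      = (1 - \<theta>' * \<theta>') * bil m u (K v) + (2 * of_nat m + 3) * \<theta>' * \<theta>' * bil m u v"
    unfolding bil_add_right bil_scale_right bil_flip[OF m, symmetric] u bil_scale_left flip_scale .
  then show ?thesis unfolding bil_s by (simp add: power2_eq_square algebra_simps)
qed

lemma Askey_Wilson_level: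
  assumes m: "m \<ge> 1" and u: "flip m (gr m) u = (\<lambda>y. \<theta> * u y)"
    and v: "flip m (gr m) (levfun m f) = (\<lambda>y. \<theta>' * levfun m f y)"
  shows "((\<theta> + \<theta>')\<^sup>2 - 1) * (bil m u (lev_mult m (levfun m f)) + bil m u (levfun m f))
    = (2 * of_nat m + 3) * \<theta>'\<^sup>2 * bil m u (levfun m f)"
proof -
  have H: "halves m {m+1..2*m+1} {1..m}" and H': "halves m {1..m} {m+1..2*m+1}" by unfold_locales auto
  show ?thesis
    by (rule halves.Askey_Wilson_bil[OF H _ m u v casim_levfun[OF H] casim_levfun[OF H']]) simp
qed

definition odd_recurrence :: "nat \<Rightarrow> complex \<Rightarrow> (nat \<Rightarrow> complex) \<Rightarrow> bool" where
  "odd_recurrence m \<theta> f \<longleftrightarrow>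
     (\<forall>t\<le>m. (of_nat t + 1) * f (m - t) + of_nat (m - t) * f (m - 1 - t) = \<theta> * f t)"

lemma eigen_levfun_iff:
  "flip m (gr m) (levfun m f) = (\<lambda>y. \<theta> * levfun m f y) \<longleftrightarrow> odd_recurrence m \<theta> f"
proof
  assume L: "flip m (gr m) (levfun m f) = (\<lambda>y. \<theta> * levfun m f y)"
  show "odd_recurrence m \<theta> f"
    unfolding odd_recurrence_def
  proof (intro allI impI)
    fix t assume "t \<le> m"
    then obtain y where y: "y \<in> Xset m" "card (x0 m \<inter> y) = t" by (rule ex_level)
    show "(of_nat t + 1) * f (m - t) + of_nat (m - t) * f (m - 1 - t) = \<theta> * f t"
      using flip_levfun[OF y, of f] fun_cong[OF L, of y] y by (simp add: levfun_def)
  qed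
next
  assume R: "odd_recurrence m \<theta> f"
  show "flip m (gr m) (levfun m f) = (\<lambda>y. \<theta> * levfun m f y)"
  proof
    fix y
    show "flip m (gr m) (levfun m f) y = \<theta> * levfun m f y"
    proof (cases "y \<in> Xset m")
      case True
      then show ?thesis
        using flip_levfun[OF True refl, of f] R level_le[of m y] by (simp add: odd_recurrence_def levfun_def)
    qed (simp add: flip_def levfun_def)
  qed
qed

text \<open>In the order of levels \<open>m, 0, m - 1, 1, ...\<close>, which is that of distance,
  the recurrence computes each value from the two before it.\<close>

lemma odd_recurrence_zero:
  assumes R: "odd_recurrence m \<theta> f" and 0: "f m = 0" and t: "t \<le> m"
  shows "f t = 0"
proof -
  have rec: "(of_nat t + 1) * f (m - t) + of_nat (m - t) * f (m - 1 - t) = \<theta> * f t" if "t \<le> m" for t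
    using R that by (simp add: odd_recurrence_def)
  have "k \<le> m \<longrightarrow> f (m - k) = 0 \<and> f k = 0" for k
  proof (induction k)
    case 0
    have "of_nat m + 1 \<noteq> (0::complex)" by (metis of_nat_Suc of_nat_eq_0_iff nat.simps(3) add.commute)
    then show ?case using rec[of m] \<open>f m = 0\<close> by simp
  next
    case (Suc k)
    show ?case
    proof
      assume k: "Suc k \<le> m"
      then have IH: "f (m - k) = 0" "f k = 0" using Suc by auto
      have nz: "complex_of_nat (m - k) \<noteq> 0" using k by simp
      have 1: "f (m - Suc k) = 0" using rec[of k] IH k nz by simp
      have "m - (m - Suc k) = Suc k" "m - 1 - (m - Suc k) = k" "complex_of_nat (m - Suc k) + 1 = of_nat (m - k)"
        using k by (simp_all add: of_nat_diff)
      then have "of_nat (m - k) * f (Suc k) = 0" using rec[of "m - Suc k"] IH 1 by simp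
      then show "f (m - Suc k) = 0 \<and> f (Suc k) = 0" using 1 nz by simp
    qed
  qed
  then show ?thesis using t by blast
qed

text \<open>For this eigenvalue the signs alternate along the order of distance, as they would on a
  bipartite graph; continued up to \<open>k = m\<close> this reads
  \<open>f m = - f m\<close>.\<close>

lemma odd_recurrence_bipartite:
  assumes R: "odd_recurrence m (- (of_nat m + 1)) f"
  shows "f m = 0"
proof -
  have rec: "(of_nat t + 1) * f (m - t) + of_nat (m - t) * f (m - 1 - t) = - (of_nat m + 1) * f t" if "t \<le> m" for t
    using R that by (simp add: odd_recurrence_def)
  have "k \<le> m \<longrightarrow> f (m - k) = f m \<and> f k = - f m" for k
  proof (induction k)
    case 0
    have "of_nat m + 1 \<noteq> (0::complex)" by (metis of_nat_Suc of_nat_eq_0_iff nat.simps(3) add.commute)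
    moreover have "(of_nat m + 1) * (f 0 + f m) = 0" using rec[of m] by (simp add: algebra_simps)
    ultimately show ?case by (simp add: eq_neg_iff_add_eq_0)
  next
    case (Suc k)
    show ?case
    proof
      assume k: "Suc k \<le> m"
      then have IH: "f (m - k) = f m" "f k = - f m" using Suc by auto
      have nz: "complex_of_nat (m - k) \<noteq> 0" using k by simp
      have mk: "complex_of_nat m = of_nat k + of_nat (m - k)" using k by (simp flip: of_nat_add)
      have "of_nat (m - k) * (f (m - Suc k) - f m) = 0" using rec[of k] IH k unfolding mk by (simp add: algebra_simps)
      then have 1: "f (m - Suc k) = f m" using nz by simp
      have e: "m - (m - Suc k) = Suc k" "m - 1 - (m - Suc k) = k" "complex_of_nat (m - Suc k) + 1 = of_nat (m - k)"
        using k by (simp_all add: of_nat_diff)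
      have "of_nat (m - k) * (f (Suc k) + f m) = 0" 
        using rec[of "m - Suc k"] IH 1 unfolding e mk by (simp add: algebra_simps)
      then show "f (m - Suc k) = f m \<and> f (Suc k) = - f m" using 1 nz by (simp add: eq_neg_iff_add_eq_0)
    qed
  qed
  from this[of m] have "f 0 = f m" "f m = - f m" by auto
  then show ?thesis by simp
qed

section \<open>Bose-Mesner matrices as functions of the intersection size\<close>

lemma BM_entry:
  assumes "M \<in> BM m"
  shows "\<exists>f. \<forall>y z. M y z = (if y \<in> Xset m \<and> z \<in> Xset m then f (card (y \<inter> z)) else 0)"
proof -
  obtain c where M: "M = (\<lambda>y z. \<Sum>i\<le>m. c i * Adist m i y z)" using assms by (auto simp: BM_def)
  have "M y z = (if y \<in> Xset m \<and> z \<in> Xset m then c (min (2 * (m - card (y \<inter> z))) (2 * card (y \<inter> z) + 1)) else 0)" for y z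
  proof (cases "y \<in> Xset m \<and> z \<in> Xset m")
    case True
    then have "M y z = (\<Sum>i\<le>m. if i = odist m y z then c i else 0)"
      unfolding M by (intro sum.cong) (auto simp: Adist_def)
    also have "\<dots> = c (odist m y z)" using level_of_dist_odist(2) True by simp
    finally show ?thesis using True by (simp add: odist_eq)
  qed (auto simp: M Adist_def)
  then show ?thesis by (intro exI[of _ "\<lambda>t. c (min (2 * (m - t)) (2 * t + 1))"]) simp
qed

lemma BM_intersection:
  "(\<lambda>y z. if y \<in> Xset m \<and> z \<in> Xset m then f (card (y \<inter> z)) else 0) \<in> BM m"
proof -
  have "(\<lambda>y z. if y \<in> Xset m \<and> z \<in> Xset m then f (card (y \<inter> z)) else 0)
    = (\<lambda>y z. \<Sum>i\<le>m. f (level_of_dist m i) * Adist m i y z)"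
  proof (intro ext)
    fix y z
    show "(if y \<in> Xset m \<and> z \<in> Xset m then f (card (y \<inter> z)) else 0) = (\<Sum>i\<le>m. f (level_of_dist m i) * Adist m i y z)"
    proof (cases "y \<in> Xset m \<and> z \<in> Xset m")
      case True
      then have "(\<Sum>i\<le>m. f (level_of_dist m i) * Adist m i y z) = (\<Sum>i\<le>m. if i = odist m y z then f (level_of_dist m i) else 0)"
        by (intro sum.cong) (auto simp: Adist_def)
      also have "\<dots> = f (card (y \<inter> z))" using level_of_dist_odist True by simp
      finally show ?thesis using True by simp
    qed (auto simp: Adist_def)
  qed
  then show ?thesis unfolding BM_def by (intro CollectI exI[of _ "\<lambda>i. f (level_of_dist m i)"]) simp
qed

lemma Adist_in_BM:
  assumes "i \<le> m" shows "Adist m i \<in> BM m"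
proof -
  have "Adist m i = (\<lambda>y z. \<Sum>k\<le>m. (if k = i then 1 else 0) * Adist m k y z)"
    using assms by (simp add: if_distrib[of "\<lambda>x. x * _"] cong: if_cong)
  then show ?thesis unfolding BM_def by (intro CollectI exI[of _ "\<lambda>k. if k = i then 1 else 0"]) simp
qed

lemma mmult_sum_left:
  "mmult m (\<lambda>y z. \<Sum>i\<le>k. c i * F i y z) N = (\<lambda>y z. \<Sum>i\<le>k. c i * mmult m (F i) N y z)"
proof (intro ext)
  fix y z
  have "(\<Sum>w\<in>Xset m. (\<Sum>i\<le>k. c i * F i y w) * N w z) = (\<Sum>i\<le>k. c i * (\<Sum>w\<in>Xset m. F i y w * N w z))"
    unfolding sum_distrib_right sum_distrib_left by (subst sum.swap) (simp add: mult.assoc)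
  then show "mmult m (\<lambda>y z. \<Sum>i\<le>k. c i * F i y z) N y z = (\<Sum>i\<le>k. c i * mmult m (F i) N y z)"
    by (auto simp: mmult_def)
qed

lemma mmult_sum_right:
  "mmult m N (\<lambda>y z. \<Sum>i\<le>k. c i * F i y z) = (\<lambda>y z. \<Sum>i\<le>k. c i * mmult m N (F i) y z)"
proof (intro ext)
  fix y z
  have "(\<Sum>w\<in>Xset m. N y w * (\<Sum>i\<le>k. c i * F i w z)) = (\<Sum>i\<le>k. c i * (\<Sum>w\<in>Xset m. N y w * F i w z))"
    unfolding sum_distrib_left by (subst sum.swap) (simp add: mult.left_commute)
  then show "mmult m N (\<lambda>y z. \<Sum>i\<le>k. c i * F i y z) y z = (\<Sum>i\<le>k. c i * mmult m N (F i) y z)"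
    by (auto simp: mmult_def)
qed

section \<open>Primitive idempotents and their columns at the base vertex\<close>

locale odd_idempotents =
  fixes m :: nat and E :: "nat \<Rightarrow> mat"
  assumes m_pos: "m \<ge> 1" and prim: "primitive_idempotents m E"
    and E_0: "E 0 = (\<lambda>y z. Jm m y z / of_nat (card (Xset m)))"
begin

abbreviation "A \<equiv> flip m (gr m)"
abbreviation "X \<equiv> Xset m"
abbreviation "x \<equiv> x0 m"

definition g :: "nat \<Rightarrow> nat \<Rightarrow> complex" where
  "g j = (SOME f. \<forall>y z. E j y z = (if y \<in> X \<and> z \<in> X then f (card (y \<inter> z)) else 0))"

definition \<theta> :: "nat \<Rightarrow> complex" where
  "\<theta> = (SOME c. Adist m 1 = (\<lambda>y z. \<Sum>i\<le>m. c i * E i y z))"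

definition e :: "nat \<Rightarrow> vec" where "e j = levfun m (g j)"

lemma E_in_BM: "j \<le> m \<Longrightarrow> E j \<in> BM m" and E_nonzero: "j \<le> m \<Longrightarrow> E j \<noteq> (\<lambda>_ _. 0)"
  and E_mult: "i \<le> m \<Longrightarrow> j \<le> m \<Longrightarrow> mmult m (E i) (E j) = (if i = j then E i else (\<lambda>_ _. 0))"
  and E_sum_idm: "(\<lambda>y z. \<Sum>i\<le>m. E i y z) = idm m"
  and E_span: "M \<in> BM m \<Longrightarrow> \<exists>c. M = (\<lambda>y z. \<Sum>i\<le>m. c i * E i y z)"
  using prim unfolding primitive_idempotents_def by blast+

lemma E_g: "j \<le> m \<Longrightarrow> E j y z = (if y \<in> X \<and> z \<in> X then g j (card (y \<inter> z)) else 0)"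
  using someI_ex[OF BM_entry[OF E_in_BM[of j]]] unfolding g_def by blast

lemma E_sym: "j \<le> m \<Longrightarrow> E j y z = E j z y"
  by (simp add: E_g Int_commute)

lemma e_E: "j \<le> m \<Longrightarrow> e j y = E j y x"
  by (simp add: e_def levfun_def E_g x0_in_Xset Int_commute)

lemma A_expand: "Adist m 1 = (\<lambda>y z. \<Sum>i\<le>m. \<theta> i * E i y z)"
  using someI_ex[OF E_span[OF Adist_in_BM[OF m_pos]]] unfolding \<theta>_def .

lemma A_mmult_E: "j \<le> m \<Longrightarrow> mmult m (Adist m 1) (E j) = (\<lambda>y z. \<theta> j * E j y z)"
  and E_mmult_A: "j \<le> m \<Longrightarrow> mmult m (E j) (Adist m 1) = (\<lambda>y z. \<theta> j * E j y z)"
  unfolding A_expand mmult_sum_left mmult_sum_right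
  by (auto simp: E_mult fun_eq_iff if_distrib[of "\<lambda>f. f _ _"] if_distrib[of "\<lambda>x. _ * x"] cong: if_cong)

lemma mvec_scale_matrix: "mvec m (\<lambda>y z. c * M y z) v = (\<lambda>y. c * mvec m M v y)"
  by (auto simp: mvec_def sum_distrib_left mult.assoc)

lemma A_mvec_E: "j \<le> m \<Longrightarrow> A (mvec m (E j) v) = (\<lambda>y. \<theta> j * mvec m (E j) v y)"
  unfolding mvec_Adist_1[OF m_pos, symmetric] mvec_mmult[symmetric] A_mmult_E mvec_scale_matrix ..

lemma mvec_E_A: "j \<le> m \<Longrightarrow> mvec m (E j) (A v) = (\<lambda>y. \<theta> j * mvec m (E j) v y)"
  unfolding mvec_Adist_1[OF m_pos, symmetric] mvec_mmult[symmetric] E_mmult_A mvec_scale_matrix ..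

lemma mvec_E_sum:
  assumes "v \<in> Vspace m" shows "(\<lambda>y. \<Sum>j\<le>m. mvec m (E j) v y) = v"
proof
  fix y
  show "(\<Sum>j\<le>m. mvec m (E j) v y) = v y"
  proof (cases "y \<in> X")
    case True
    have "(\<Sum>j\<le>m. mvec m (E j) v y) = (\<Sum>z\<in>X. (\<Sum>j\<le>m. E j y z) * v z)"
      using True by (simp add: mvec_def sum_distrib_right) (rule sum.swap)
    also have "\<dots> = (\<Sum>z\<in>X. if z = y then v y else 0)"
      using fun_cong[OF fun_cong[OF E_sum_idm]] True by (intro sum.cong) (auto simp: idm_def)
    finally show ?thesis using True by (simp add: finite_Xset)
  qed (simp add: mvec_def Vspace_outside[OF assms])
qed

lemma A_e: "j \<le> m \<Longrightarrow> A (e j) = (\<lambda>y. \<theta> j * e j y)"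
proof
  fix y assume j: "j \<le> m"
  show "A (e j) y = \<theta> j * e j y"
  proof (cases "y \<in> X")
    case True
    have "A (e j) y = mmult m (Adist m 1) (E j) y x"
      using True x0_in_Xset[of m] unfolding mvec_Adist_1[OF m_pos, symmetric]
      by (simp add: mvec_def mmult_def e_E[OF j])
    then show ?thesis by (simp add: A_mmult_E[OF j] e_E[OF j] del: One_nat_def)
  qed (simp add: flip_def e_def levfun_def)
qed

lemma rec_g: "j \<le> m \<Longrightarrow> odd_recurrence m (\<theta> j) (g j)"
  using A_e eigen_levfun_iff unfolding e_def by blast

text \<open>For symmetric matrices the pairing of two columns is an entry of the matrix
  product.\<close>

lemma bil_e:
  assumes "i \<le> m" "j \<le> m"
  shows "bil m (e i) (e j) = (if i = j then g i m else 0)"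
proof -
  have gm: "E i x x = g i m" using E_g[OF assms(1)] x0_in_Xset[of m] by (simp add: x0_def)
  have "bil m (e i) (e j) = mmult m (E i) (E j) x x"
    unfolding bil_def mmult_def using x0_in_Xset assms E_sym by (auto simp: e_E intro!: sum.cong)
  then show ?thesis using E_mult[OF assms] gm by auto
qed

lemma g_m_nonzero: assumes "j \<le> m" shows "g j m \<noteq> 0"
proof
  assume "g j m = 0"
  then have "g j t = 0" if "t \<le> m" for t using odd_recurrence_zero[OF rec_g[OF assms] _ that] by blast
  moreover have "card (y \<inter> z) \<le> m" if "y \<in> X" for y z
    using card_mono[OF Xset_finite_mem[OF that], of "y \<inter> z"] Xset_card[OF that] by simp
  ultimately have "E j = (\<lambda>_ _. 0)" by (auto simp: E_g[OF assms] fun_eq_iff)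
  then show False using E_nonzero[OF assms] by blast
qed

lemma e_x: "e j x = g j m"
  using x0_in_Xset[of m] by (simp add: e_def levfun_def) (simp add: x0_def)

text \<open>Two solutions of one recurrence are proportional, which contradicts orthogonality of
  distinct columns.\<close>

lemma \<theta>_inj:
  assumes "i \<le> m" "j \<le> m" "\<theta> i = \<theta> j" shows "i = j"
proof (rule ccontr)
  assume ij: "i \<noteq> j"
  let ?f = "\<lambda>t. g j m * g i t - g i m * g j t"
  have "odd_recurrence m (\<theta> i) ?f"
    unfolding odd_recurrence_def
  proof (intro allI impI)
    fix t assume t: "t \<le> m"
    have 1: "(of_nat t + 1) * g i (m - t) + of_nat (m - t) * g i (m - 1 - t) = \<theta> i * g i t"
      and 2: "(of_nat t + 1) * g j (m - t) + of_nat (m - t) * g j (m - 1 - t) = \<theta> i * g j t"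
      using rec_g[OF assms(1)] rec_g[OF assms(2)] t assms(3) by (simp_all add: odd_recurrence_def)
    have "(of_nat t + 1) * ?f (m - t) + of_nat (m - t) * ?f (m - 1 - t)
      = g j m * ((of_nat t + 1) * g i (m - t) + of_nat (m - t) * g i (m - 1 - t))
        - g i m * ((of_nat t + 1) * g j (m - t) + of_nat (m - t) * g j (m - 1 - t))"
      by (simp add: algebra_simps)
    also have "\<dots> = \<theta> i * ?f t" unfolding 1 2 by (simp add: algebra_simps)
    finally show "(of_nat t + 1) * ?f (m - t) + of_nat (m - t) * ?f (m - 1 - t) = \<theta> i * ?f t" .
  qed
  then have "?f t = 0" if "t \<le> m" for t using odd_recurrence_zero[of m "\<theta> i" ?f t] that by simp
  then have "(\<lambda>y. g j m * e i y) = (\<lambda>y. g i m * e j y)"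
    using level_le[of m] by (auto simp: e_def levfun_def fun_eq_iff)
  then have "bil m (e i) (\<lambda>y. g j m * e i y) = bil m (e i) (\<lambda>y. g i m * e j y)" by simp
  then have "g j m * g i m = 0" using bil_e assms ij by (simp add: bil_scale_right)
  then show False using g_m_nonzero assms by simp
qed

lemma card_X_nonzero: "card X \<noteq> 0"
  using x0_in_Xset[of m] finite_Xset[of m] by auto

lemma e_0: "e 0 = (\<lambda>y. if y \<in> X then 1 / of_nat (card X) else 0)"
  using x0_in_Xset[of m] by (auto simp: fun_eq_iff e_E[of 0] E_0 Jm_def)

lemma g_0_m: "g 0 m = 1 / of_nat (card X)"
  using e_x[of 0] e_0 x0_in_Xset[of m] by simp

lemma \<theta>_0: "\<theta> 0 = of_nat m + 1"
proof -
  have "A (e 0) x = \<theta> 0 * e 0 x" using A_e[of 0] by simp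
  moreover have "e 0 = levfun m (\<lambda>_. 1 / of_nat (card X))" by (simp add: e_0 levfun_def)
  moreover have "card (x \<inter> x) = m" by (simp add: x0_def)
  ultimately have "(of_nat m + 1) * e 0 x = \<theta> 0 * e 0 x"
    using flip_levfun[OF x0_in_Xset, of m m "\<lambda>_. 1 / of_nat (card X)"] x0_in_Xset[of m] by (auto simp: levfun_def)
  then show ?thesis using e_x[of 0] g_m_nonzero[of 0] by simp
qed

lemma \<theta>_neq_bipartite: "j \<le> m \<Longrightarrow> \<theta> j \<noteq> - (of_nat m + 1)"
  using odd_recurrence_bipartite[of m "g j"] rec_g g_m_nonzero by metis

text \<open>Up to scaling, the matrix of multiplication by the level in the columns
  \<open>e j\<close>.\<close>

definition T :: "nat \<Rightarrow> nat \<Rightarrow> complex" where "T i j = bil m (e i) (lev_mult m (e j))"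

text \<open>Orthogonality of the columns kills the right-hand side of the paired Askey-Wilson
  relation.\<close>

lemma T_offdiag:
  assumes "i \<le> m" "j \<le> m" "i \<noteq> j" "T i j \<noteq> 0"
  shows "(\<theta> i + \<theta> j)\<^sup>2 = 1"
  using Askey_Wilson_level[OF m_pos A_e[OF assms(1)], of "g j" "\<theta> j"] A_e[OF assms(2)] assms bil_e[OF assms(1,2)]
  by (simp add: T_def e_def[symmetric])

lemma T_diag:
  assumes "j \<le> m"
  shows "(4 * (\<theta> j)\<^sup>2 - 1) * (T j j + g j m) = (2 * of_nat m + 3) * (\<theta> j)\<^sup>2 * g j m"
  using Askey_Wilson_level[OF m_pos A_e[OF assms(1)], of "g j" "\<theta> j"] A_e[OF assms] bil_e[OF assms assms]
  by (simp add: T_def e_def[symmetric] power2_eq_square algebra_simps)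

text \<open>In the ordering to be established, \<open>s = 1\<close>.\<close>

lemma level_expansion:
  obtains s \<gamma> where "s \<le> m" "s \<noteq> 0" "\<theta> s = - of_nat m" "\<gamma> \<noteq> 0"
    "\<And>y. y \<in> X \<Longrightarrow> of_nat (card (x \<inter> y)) = of_nat m ^ 2 / (2 * of_nat m + 1) + \<gamma> * e s y"
proof -
  let ?k = "levfun m of_nat"
  obtain c where c: "(\<lambda>y z. if y \<in> X \<and> z \<in> X then of_nat (card (y \<inter> z)) else 0) = (\<lambda>y z. \<Sum>i\<le>m. c i * E i y z)"
    using E_span[OF BM_intersection[of m of_nat]] by blast
  have k: "?k y = (\<Sum>i\<le>m. c i * e i y)" for y
    using fun_cong[OF fun_cong[OF c, of y], of x] x0_in_Xset[of m] by (auto simp: levfun_def e_E Int_commute split: if_splits)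
  have bil_k: "bil m (e h) ?k = c h * g h m" if h: "h \<le> m" for h
  proof -
    have "bil m (e h) ?k = (\<Sum>i\<le>m. c i * bil m (e h) (e i))"
      unfolding bil_def k sum_distrib_left by (subst sum.swap) (simp add: mult.left_commute)
    also have "\<dots> = (\<Sum>i\<le>m. if i = h then c h * g h m else 0)"
      using bil_e[OF h] by (intro sum.cong) auto
    finally show ?thesis using h by simp
  qed
  let ?one = "\<lambda>y. of_nat (card X) * e 0 y"
  have one: "?one y = 1" if "y \<in> X" for y using that card_X_nonzero by (simp add: e_0)
  \<comment> \<open>\<open>A\<close> sends the level to \<open>m^2\<close> minus \<open>m\<close>
    times the level, so the level minus the constant \<open>m^2 / (2 * m + 1)\<close> is an
    eigenvector for \<open>- m\<close>.\<close>
  have Ak: "A ?k y = of_nat m * (of_nat m * ?one y) - of_nat m * ?k y" for y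
  proof (cases "y \<in> X")
    case True
    let ?t = "card (x \<inter> y)"
    have t: "?t \<le> m" by (rule level_le)
    have "A ?k y = (of_nat ?t + 1) * of_nat (m - ?t) + of_nat (m - ?t) * of_nat (m - 1 - ?t)"
      by (rule flip_levfun[OF True refl])
    also have "\<dots> = of_nat (m - ?t) * of_nat m"
    proof (cases "?t = m")
      case False
      then have "complex_of_nat (m - 1 - ?t) = of_nat m - 1 - of_nat ?t" "complex_of_nat (m - ?t) = of_nat m - of_nat ?t"
        using t by (simp_all add: of_nat_diff)
      then show ?thesis by (simp only:) (simp add: algebra_simps)
    qed simp
    also have "\<dots> = of_nat m * (of_nat m * 1) - of_nat m * ?k y"
      using True t by (simp add: levfun_def of_nat_diff algebra_simps)
    finally show ?thesis unfolding one[OF True] .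
  qed (simp add: flip_def levfun_def e_0)
  have *: "\<theta> h * (c h * g h m) = of_nat m * (of_nat m * (of_nat (card X) * bil m (e h) (e 0))) - of_nat m * (c h * g h m)"
    if h: "h \<le> m" for h
  proof -
    have "\<theta> h * bil m (e h) ?k = bil m (e h) (A ?k)"
      unfolding bil_flip[OF m_pos, symmetric] A_e[OF h] bil_scale_left ..
    also have "A ?k = (\<lambda>y. of_nat m * (of_nat m * ?one y) + (- of_nat m) * ?k y)" using Ak by (simp add: fun_eq_iff)
    finally show ?thesis unfolding bil_add_right bil_scale_right bil_k[OF h] by simp
  qed
  have off: "c h = 0 \<or> \<theta> h = - of_nat m" if "h \<le> m" "h \<noteq> 0" for h
  proof -
    have "(\<theta> h + of_nat m) * (c h * g h m) = 0"
      using *[OF that(1)] bil_e[OF that(1), of 0] that by (simp add: algebra_simps)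
    then show ?thesis using g_m_nonzero[OF that(1)] by (auto simp: eq_neg_iff_add_eq_0)
  qed
  have "of_nat m * of_nat m = (2 * of_nat m + 1) * (c 0 * g 0 m)"
  proof -
    have b: "of_nat (card X) * bil m (e 0) (e 0) = 1" using bil_e[of 0 0] card_X_nonzero by (simp add: g_0_m)
    show ?thesis using *[of 0] unfolding b \<theta>_0 by (simp add: algebra_simps)
  qed
  moreover have nz: "2 * of_nat m + 1 \<noteq> (0::complex)"
    by (metis of_nat_Suc of_nat_mult of_nat_numeral of_nat_eq_0_iff nat.simps(3) add.commute)
  ultimately have c0: "c 0 * g 0 m = of_nat m ^ 2 / (2 * of_nat m + 1)" by (simp add: power2_eq_square field_simps)
  have e0: "e 0 y = g 0 m" if "y \<in> X" for y using that by (simp add: e_0 g_0_m)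
  have "\<exists>s\<le>m. s \<noteq> 0 \<and> c s \<noteq> 0"
  proof (rule ccontr)
    assume "\<not> ?thesis"
    then have "?k y = (\<Sum>i\<le>m. if i = 0 then c 0 * e 0 y else 0)" for y unfolding k by (intro sum.cong) auto
    then have const: "?k y = c 0 * g 0 m" if "y \<in> X" for y using e0[OF that] by simp
    obtain y where y: "y \<in> X" "card (x \<inter> y) = 0" using ex_level[of 0 m] by auto
    obtain z where z: "z \<in> X" "card (x \<inter> z) = m" using ex_level[of m m] by auto
    have "?k y = ?k z" using const y z by simp
    then show False using y z m_pos by (simp add: levfun_def)
  qed
  then obtain s where s: "s \<le> m" "s \<noteq> 0" "c s \<noteq> 0" by blast
  have ts: "\<theta> s = - of_nat m" using off[OF s(1,2)] s(3) by blast
  have rest: "c h = 0" if "h \<le> m" "h \<noteq> 0" "h \<noteq> s" for h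
    using off[OF that(1,2)] \<theta>_inj[OF that(1) s(1)] ts that(3) by auto
  show thesis
  proof (rule that[OF s(1,2) ts s(3)])
    fix y assume y: "y \<in> X"
    have "?k y = (\<Sum>i\<in>{0, s}. c i * e i y)"
      unfolding k using s rest by (intro sum.mono_neutral_right) auto
    also have "\<dots> = c 0 * g 0 m + c s * e s y" using s e0[OF y] by simp
    finally show "of_nat (card (x \<inter> y)) = of_nat m ^ 2 / (2 * of_nat m + 1) + c s * e s y"
      using y c0 by (simp add: levfun_def)
  qed
qed

end

text \<open>If \<open>E\<^sub>2\<close> is affine in the level, then \<open>E\<^sub>1 \<circ> E\<^sub>1\<close> lies in the span of \<open>E\<^sub>0, E\<^sub>1, E\<^sub>2\<close> only if the
  normalised entries \<open>1, x, y, z\<close> of \<open>E\<^sub>1\<close> at the levels \<open>m, 0, m - 1, 1\<close> (distances \<open>0, 1, 2, 3\<close>) lie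
  on a parabola.\<close>

lemma parabola_elim:
  fixes M x y z a b C :: complex
  assumes "1 = C + a + b * M" "x\<^sup>2 = C + a * x" "y\<^sup>2 = C + a * y + b * (M - 1)" "z\<^sup>2 = C + a * z + b"
  shows "1 - x\<^sup>2 - M * (1 - y\<^sup>2) = a * (1 - x - M * (1 - y))"
    and "1 - y\<^sup>2 - z\<^sup>2 + x\<^sup>2 = a * (1 - y - z + x)"
proof -
  have "C = (C + a + b * M) - a - b * M" by simp
  then have C: "C = 1 - a - b * M" by (simp only: assms(1)[symmetric])
  show "1 - x\<^sup>2 - M * (1 - y\<^sup>2) = a * (1 - x - M * (1 - y))"
    unfolding assms(2,3) C by (simp add: algebra_simps)
  show "1 - y\<^sup>2 - z\<^sup>2 + x\<^sup>2 = a * (1 - y - z + x)"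
    unfolding assms(2,3,4) C by (simp add: algebra_simps)
qed

text \<open>\<open>rec\<close> is the recurrence at levels \<open>m, 0, m - 1\<close>, and the
  values of \<open>\<theta>\<close> are candidates for the first eigenvalue in
  \<open>eigenvalues_odd\<close>. Eliminating \<open>a\<close> leaves polynomials in
  \<open>M\<close> with roots among \<open>1/2, 1, 2, -2\<close>.\<close>

lemma parabola_contradiction:
  fixes M x y z a b C \<theta> :: complex
  assumes M: "M = of_nat m" "m \<ge> 3" and \<theta>: "\<theta> = M - 1 \<or> \<theta> = 1 \<or> \<theta> = -1"
    and rec: "(M + 1) * x = \<theta>" "1 + M * y = \<theta> * x" "M * z + x = \<theta> * y"
    and par: "1 = C + a + b * M" "x\<^sup>2 = C + a * x" "y\<^sup>2 = C + a * y + b * (M - 1)" "z\<^sup>2 = C + a * z + b"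
  shows False
proof -
  have M_neq: "M \<noteq> of_nat k" if "k < 3" for k using that M by (simp only: of_nat_eq_iff)
  have nz: "M \<noteq> 0" "M \<noteq> 1" "M \<noteq> 2" using M_neq[of 0] M_neq[of 1] M_neq[of 2] by simp_all
  have Mpos: "M + of_nat k \<noteq> 0" if "k > 0" for k
    unfolding M(1) of_nat_add[symmetric] using that by (simp only: of_nat_eq_0_iff)
  have nz': "M + 1 \<noteq> 0" "M + 2 \<noteq> 0" using Mpos[of 1] Mpos[of 2] by simp_all
  note e = parabola_elim[OF par]
  consider "\<theta> = M - 1" | "\<theta> = 1" | "\<theta> = -1" using \<theta> by blast
  then show False
  proof cases
    case 1
    have x: "(M + 1) * x = M - 1" using rec(1) 1 by simp
    have "M * ((M + 1) * y - (M - 3)) = 0" using rec(2) x 1 by algebra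
    then have y: "(M + 1) * y = M - 3" using nz by simp
    have z: "M * (M + 1) * z = (M - 1) * (M - 4)" using rec(3) x y 1 by algebra
    have a: "(M + 1) * a * (2 - 4 * M) = 12 * M - 8 * M\<^sup>2" using e(1) x y by algebra
    have "M\<^sup>2 * (M + 1)\<^sup>2 - M\<^sup>2 * (M - 3)\<^sup>2 - ((M - 1) * (M - 4))\<^sup>2 + M\<^sup>2 * (M - 1)\<^sup>2 = (M + 1) * a * M * (8 * M - 4)"
      using e(2) x y z by algebra
    then have "8 * ((2 * M - 1) * (M - 2)) = 0" using a by algebra
    moreover have "2 * M - 1 \<noteq> 0"
    proof
      assume "2 * M - 1 = 0"
      then have "of_nat (2 * m) = (of_nat 1 :: complex)" by (simp add: M(1))
      then have "2 * m = 1" by (simp only: of_nat_eq_iff)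
      then show False by presburger
    qed
    ultimately show False using nz by simp
  next
    case 2
    have x: "(M + 1) * x = 1" using rec(1) 2 by simp
    have "M * ((M + 1) * y + 1) = 0" using rec(2) x 2 by algebra
    then have y: "(M + 1) * y = -1" using nz by (simp add: eq_neg_iff_add_eq_0)
    have z: "M * (M + 1) * z = -2" using rec(3) x y 2 by algebra
    have "M * ((M + 1)\<^sup>2 * a - (M - 1) * (M + 2)) = 0" using e(1) x y by algebra
    then have a: "(M + 1)\<^sup>2 * a = (M - 1) * (M + 2)" using nz by simp
    have "M\<^sup>2 * (M + 1)\<^sup>2 - 4 = (M + 1) * a * M * (M * (M + 1) + 2 * M + 2)"
      using e(2) x y z by algebra
    then have "(M - 1) * (M + 2) * (M - 2) = 0" using a by algebra
    then show False using nz nz' by simp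
  next
    case 3
    have x: "(M + 1) * x = -1" using rec(1) 3 by simp
    have "M * ((M + 1) * y + 1) = 0" using rec(2) x 3 by algebra
    then have y: "(M + 1) * y = -1" using nz by (simp add: eq_neg_iff_add_eq_0)
    have z: "M * (M + 1) * z = 2" using rec(3) x y 3 by algebra
    have "(M - 1) * (M + 2) * ((M + 1) * a - M) = 0" using e(1) x y by algebra
    then have a: "(M + 1) * a = M" using nz nz' by simp
    have "M\<^sup>2 * (M + 1)\<^sup>2 - 4 = (M + 1) * a * M * (M * (M + 1) - 2)"
      using e(2) x y z by algebra
    then have "(M + 2) * (M - 1) * (M + 2) = 0" using a by algebra
    then show False using nz nz' by simp
  qed
qed

text \<open>Entries at distances \<open>0, 1, 2\<close> in \<open>E\<^sub>1 \<circ> E\<^sub>2 = a E\<^sub>1 + b E\<^sub>3\<close>, for the eigenvalues \<open>\<theta>\<close>, \<open>- M\<close> and \<open>\<epsilon> - \<theta>\<close>.\<close>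

lemma cosine_product:
  fixes M x y x2 y2 xk yk a b \<theta> \<epsilon> :: complex
  assumes M: "M \<noteq> 0" "2 * M + 1 \<noteq> 0" and \<epsilon>: "\<epsilon>\<^sup>2 = 1"
    and "(M + 1) * x = \<theta>" "1 + M * y = \<theta> * x"
    and "(M + 1) * x2 = - M" "1 + M * y2 = - M * x2"
    and "(M + 1) * xk = \<epsilon> - \<theta>" "1 + M * yk = (\<epsilon> - \<theta>) * xk"
    and "1 = a + b" "x * x2 = a * x + b * xk" "y * y2 = a * y + b * yk"
    and D: "M + 1 \<noteq> 0"
  shows "(\<theta> - \<epsilon> * (M + 1)) * (\<theta> + \<epsilon>) = 0"
proof -
  have b: "b = 1 - a" using assms(10) by algebra
  \<comment> \<open>Distance \<open>1\<close> determines \<open>a\<close>; inserted at distance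
    \<open>2\<close>, it leaves a quadratic equation for \<open>\<theta>\<close>.\<close>
  have 1: "(M + 1) * a * (2 * \<theta> - \<epsilon>) = \<theta> - \<epsilon> * (M + 1)"
  proof -
    have "(M + 1)\<^sup>2 * (x * x2) = (M + 1)\<^sup>2 * (a * x + b * xk)" unfolding assms(11) ..
    then have "- M * \<theta> = (M + 1) * (a * \<theta> + (1 - a) * (\<epsilon> - \<theta>))" using assms(4,6,8) b by algebra
    then show ?thesis by algebra
  qed
  have second: "M * (M + 1) * y' = t\<^sup>2 - (M + 1)" if "(M + 1) * x' = t" "1 + M * y' = t * x'" for x' y' t
  proof -
    have "M * (M + 1) * y' = (M + 1) * (1 + M * y') - (M + 1)" by (simp add: algebra_simps)
    also have "\<dots> = t * ((M + 1) * x') - (M + 1)" unfolding that(2) by (simp only: mult_ac)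
    finally show ?thesis unfolding that(1) power2_eq_square .
  qed
  note y = second[OF assms(4,5)] and y2 = second[OF assms(6,7), unfolded power2_minus] and yk = second[OF assms(8,9)]
  have "(M * (M + 1))\<^sup>2 * (y * y2) = (M * (M + 1))\<^sup>2 * (a * y + b * yk)" unfolding assms(12) ..
  then have "(\<theta>\<^sup>2 - (M + 1)) * (M\<^sup>2 - (M + 1)) = M * (M + 1) * (a * (\<theta>\<^sup>2 - (M + 1)) + (1 - a) * ((\<epsilon> - \<theta>)\<^sup>2 - (M + 1)))"
    using y y2 yk b by algebra
  then have "(2 * M + 1) * ((\<theta> - \<epsilon> * (M + 1)) * (\<theta> + \<epsilon>)) = 0"
    using 1 \<epsilon> by algebra
  then show ?thesis using M by simp
qed

section \<open>Eigenvalues of an arbitrary Q-polynomial ordering\<close>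

locale odd_Q_polynomial = odd_idempotents m E for m E +
  fixes q :: "nat \<Rightarrow> nat \<Rightarrow> nat \<Rightarrow> complex"
  assumes m3: "m \<ge> 3"
    and krein: "i \<le> m \<Longrightarrow> j \<le> m \<Longrightarrow>
      hadamard m (E i) (E j) = (\<lambda>y z. (\<Sum>h\<le>m. q h i j * E h y z) / of_nat (card (Xset m)))"
    and krein_zero: "h \<le> m \<Longrightarrow> i \<le> m \<Longrightarrow> j \<le> m \<Longrightarrow> h > i + j \<or> i > h + j \<or> j > h + i \<Longrightarrow> q h i j = 0"
    and krein_nonzero: "h \<le> m \<Longrightarrow> i \<le> m \<Longrightarrow> j \<le> m \<Longrightarrow> h = i + j \<or> i = h + j \<or> j = h + i \<Longrightarrow> q h i j \<noteq> 0"
begin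

definition c :: "nat \<Rightarrow> nat \<Rightarrow> nat \<Rightarrow> complex" where "c h i j = q h i j / of_nat (card X)"

lemma c_nonzero_iff: "c h i j \<noteq> 0 \<longleftrightarrow> q h i j \<noteq> 0"
  using card_X_nonzero by (simp add: c_def)

lemma e_mult:
  assumes "i \<le> m" "j \<le> m" "y \<in> X"
  shows "e i y * e j y = (\<Sum>h\<le>m. c h i j * e h y)"
proof -
  have "e i y * e j y = hadamard m (E i) (E j) y x"
    using assms x0_in_Xset[of m] by (simp add: hadamard_def e_E)
  also have "\<dots> = (\<Sum>h\<le>m. c h i j * e h y)"
    unfolding krein[OF assms(1,2)] c_def sum_divide_distrib by (intro sum.cong refl) (simp add: e_E)
  finally show ?thesis .
qed

text \<open>Symmetric in its indices, hence by \<open>triple_c\<close> the source of the symmetry of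
  Krein parameters.\<close>

definition triple :: "nat \<Rightarrow> nat \<Rightarrow> nat \<Rightarrow> complex" where
  "triple i j h = (\<Sum>y\<in>X. e i y * e j y * e h y)"

lemma triple_c:
  assumes "i \<le> m" "j \<le> m" "h \<le> m"
  shows "triple i j h = c h i j * g h m"
proof -
  have "triple i j h = (\<Sum>y\<in>X. \<Sum>k\<le>m. c k i j * (e h y * e k y))"
    unfolding triple_def by (intro sum.cong refl) (simp only: e_mult[OF assms(1,2)] sum_distrib_right, simp add: mult_ac)
  also have "\<dots> = (\<Sum>k\<le>m. c k i j * bil m (e h) (e k))"
    by (subst sum.swap) (simp add: bil_def sum_distrib_left)
  also have "\<dots> = (\<Sum>k\<le>m. if k = h then c h i j * g h m else 0)"
    using bil_e[OF assms(3)] by (intro sum.cong) auto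
  finally show ?thesis using assms by simp
qed

lemma eigenvalues_odd:
  assumes "j \<le> m" shows "\<theta> j = of_int (odd_eigenvalue m j)"
proof -
  let ?M = "of_nat m :: complex"
  obtain s \<gamma> where s: "s \<le> m" "s \<noteq> 0" "\<theta> s = - ?M" "\<gamma> \<noteq> 0"
    and lev: "\<And>y. y \<in> X \<Longrightarrow> of_nat (card (x \<inter> y)) = ?M ^ 2 / (2 * ?M + 1) + \<gamma> * e s y"
    by (rule level_expansion) blast
  define \<gamma>0 where "\<gamma>0 = ?M ^ 2 / (2 * ?M + 1)"
  have M2: "2 * ?M + 1 \<noteq> 0"
    by (metis of_nat_Suc of_nat_mult of_nat_numeral of_nat_eq_0_iff nat.simps(3) add.commute)
  have M1: "?M + 1 \<noteq> 0" by (metis of_nat_Suc of_nat_eq_0_iff nat.simps(3) add.commute)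
  have M0: "?M \<noteq> 0" using m3 by simp
  have \<gamma>0: "(2 * ?M + 1) * \<gamma>0 = ?M\<^sup>2" using M2 by (simp add: \<gamma>0_def)
  \<comment> \<open>The level is affine in \<open>e s\<close>, so the matrix \<open>T\<close>
    computes the Krein parameters with index \<open>s\<close>.\<close>
  have T: "\<gamma> * triple s i h = T i h - \<gamma>0 * bil m (e i) (e h)" for i h
    unfolding triple_def T_def bil_def sum_distrib_left sum_subtractf[symmetric]
  proof (intro sum.cong refl)
    fix y assume y: "y \<in> X"
    have "\<gamma> * e s y = of_nat (card (x \<inter> y)) - \<gamma>0" using lev[OF y] by (simp add: \<gamma>0_def)
    moreover have "\<gamma> * (e s y * e i y * e h y) = (\<gamma> * e s y) * (e i y * e h y)" by (simp add: mult_ac)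
    ultimately show "\<gamma> * (e s y * e i y * e h y) = e i y * (of_nat (card (x \<inter> y)) * e h y) - \<gamma>0 * (e i y * e h y)"
      by (simp only: left_diff_distrib right_diff_distrib mult_ac)
  qed
  have T_off: "(\<theta> i + \<theta> h)\<^sup>2 = 1" if "c h s i \<noteq> 0" "i \<le> m" "h \<le> m" "i \<noteq> h" for h i
  proof -
    have "triple s i h \<noteq> 0" using triple_c[OF s(1) that(2,3)] that(1) g_m_nonzero[OF that(3)] by simp
    then have "T i h \<noteq> 0" using T[of i h] bil_e[OF that(2,3)] that(4) s(4) by auto
    then show ?thesis using T_offdiag that by blast
  qed
  have m1: "1 \<le> m" "2 \<le> m" using m3 by auto
  \<comment> \<open>Otherwise \<open>T 1 1\<close> would be \<open>\<gamma>0 * g 1 m\<close>, and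
    \<open>T_diag\<close> would collapse to \<open>\<theta>_1^2 = (m + 1)^2\<close>; both signs are
    excluded.\<close>
  have c_s11: "c s 1 1 \<noteq> 0"
  proof
    assume "c s 1 1 = 0"
    then have "triple 1 1 s = 0" using triple_c[OF m1(1) m1(1) s(1)] by simp
    then have "triple s 1 1 = 0" unfolding triple_def by (simp add: mult_ac)
    then have T11: "T 1 1 = \<gamma>0 * g 1 m" using T[of 1 1] bil_e[OF m1(1) m1(1)] by simp
    have "g 1 m * ((4 * (\<theta> 1)\<^sup>2 - 1) * (\<gamma>0 + 1) - (2 * ?M + 3) * (\<theta> 1)\<^sup>2) = 0"
      using T_diag[OF m1(1)] unfolding T11 by algebra
    then have "(4 * (\<theta> 1)\<^sup>2 - 1) * (\<gamma>0 + 1) - (2 * ?M + 3) * (\<theta> 1)\<^sup>2 = 0" using g_m_nonzero[OF m1(1)] by simp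
    then have "(\<theta> 1 - (?M + 1)) * (\<theta> 1 - - (?M + 1)) = 0" using \<gamma>0 by algebra
    moreover have "\<theta> 1 \<noteq> ?M + 1" using \<theta>_inj[OF m1(1), of 0] \<theta>_0 by auto
    ultimately show False using \<theta>_neq_bipartite[OF m1(1)] by (simp only: mult_eq_0_iff right_minus_eq) blast
  qed
  then have "s \<le> 2" using krein_zero[OF s(1) m1(1) m1(1)] by (fastforce simp: c_def)
  then consider "s = 1" | "s = 2" using s(2) by linarith
  then show ?thesis
  proof cases
    case 1
    have step: "\<theta> (Suc j) = of_int (odd_eigenvalue m (Suc j)) \<and> \<theta> j = of_int (odd_eigenvalue m j)" if "Suc j \<le> m" for j
      using that
    proof (induction j)
      case 0
      then show ?case using s(3) 1 \<theta>_0 by (simp add: odd_eigenvalue_def)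
    next
      case (Suc j)
      then have IH: "\<theta> (Suc j) = of_int (odd_eigenvalue m (Suc j))" "\<theta> j = of_int (odd_eigenvalue m j)" by auto
      \<comment> \<open>The resulting equation leaves two values for the next eigenvalue: the
        expected one and \<open>\<theta> j\<close>, which \<open>\<theta>_inj\<close>
        excludes.\<close>
      have "c (Suc (Suc j)) s (Suc j) \<noteq> 0"
        unfolding c_nonzero_iff using Suc.prems s(1) by (intro krein_nonzero) (auto simp: 1)
      then have "(\<theta> (Suc j) + \<theta> (Suc (Suc j)))\<^sup>2 = 1" using Suc.prems by (intro T_off) auto
      then consider "\<theta> (Suc j) + \<theta> (Suc (Suc j)) = 1" | "\<theta> (Suc j) + \<theta> (Suc (Suc j)) = -1"
        by (auto simp: power2_eq_1_iff)
      moreover have "\<theta> (Suc (Suc j)) \<noteq> \<theta> j" using \<theta>_inj[of "Suc (Suc j)" j] Suc.prems by auto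
      ultimately have "\<theta> (Suc (Suc j)) = of_int (odd_eigenvalue m (Suc (Suc j)))"
      proof cases
        case 1
        then have "\<theta> (Suc (Suc j)) = 1 - of_int (odd_eigenvalue m (Suc j))" using IH by (simp add: algebra_simps)
        then show ?thesis using \<open>\<theta> (Suc (Suc j)) \<noteq> \<theta> j\<close> IH
          by (cases "even j") (auto simp: odd_eigenvalue_def algebra_simps)
      next
        case 2
        then have "\<theta> (Suc (Suc j)) = -1 - of_int (odd_eigenvalue m (Suc j))" using IH by (simp add: algebra_simps)
        then show ?thesis using \<open>\<theta> (Suc (Suc j)) \<noteq> \<theta> j\<close> IH
          by (cases "even j") (auto simp: odd_eigenvalue_def algebra_simps)
      qed
      then show ?case using IH by simp
    qed
    show ?thesis
    proof (cases j)
      case 0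
      then show ?thesis using step[of 0] m1 by simp
    next
      case (Suc k)
      then show ?thesis using step[of k] assms by simp
    qed
  next
    case 2
    \<comment> \<open>The cosine sequence of \<open>E j\<close>, normalised at level
      \<open>m\<close>, that is at distance \<open>0\<close>.\<close>
    define u where "u j t = g j t / g j m" for j t
    have u_rec: "(?M + 1) * u j 0 = \<theta> j" "1 + ?M * u j (m - 1) = \<theta> j * u j 0" "?M * u j 1 + u j 0 = \<theta> j * u j (m - 1)"
      if j: "j \<le> m" for j
    proof -
      have gm: "g j m \<noteq> 0" by (rule g_m_nonzero[OF j])
      have r: "(of_nat t + 1) * g j (m - t) + of_nat (m - t) * g j (m - 1 - t) = \<theta> j * g j t" if "t \<le> m" for t
        using rec_g[OF j] that by (simp add: odd_recurrence_def)
      show "(?M + 1) * u j 0 = \<theta> j" using r[of m] gm by (simp add: u_def)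
      have "g j m + ?M * g j (m - 1) = \<theta> j * g j 0" using r[of 0] by simp
      then show "1 + ?M * u j (m - 1) = \<theta> j * u j 0" using gm by (simp add: u_def field_simps)
      have "m - (m - 1) = 1" "m - 1 - (m - 1) = 0" "complex_of_nat (m - 1) + 1 = ?M" using m3 by (simp_all add: of_nat_diff)
      then have "?M * g j 1 + g j 0 = \<theta> j * g j (m - 1)" using r[of "m - 1"] by simp
      then show "?M * u j 1 + u j 0 = \<theta> j * u j (m - 1)" using gm by (simp add: u_def field_simps)
    qed
    have u_m: "u j m = 1" if "j \<le> m" for j using g_m_nonzero[OF that] by (simp add: u_def)
    have g_mult: "g i t * g j t = (\<Sum>h\<le>m. c h i j * g h t)" if "i \<le> m" "j \<le> m" "t \<le> m" for i j t
    proof -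
      obtain y where "y \<in> X" "card (x \<inter> y) = t" using ex_level[OF \<open>t \<le> m\<close>] .
      then show ?thesis using e_mult[OF that(1,2), of y] by (simp add: e_def levfun_def)
    qed
    have g_s: "\<gamma> * g 2 t = of_nat t - \<gamma>0" if t: "t \<le> m" for t
    proof -
      obtain y where "y \<in> X" "card (x \<inter> y) = t" using ex_level[OF t] .
      then show ?thesis using lev[of y] 2 by (simp add: e_def levfun_def \<gamma>0_def)
    qed
    have g_0: "g 0 t = g 0 m" if t: "t \<le> m" for t
    proof -
      obtain y where "y \<in> X" "card (x \<inter> y) = t" using ex_level[OF t] .
      then show ?thesis using fun_cong[OF e_0, of y] g_0_m by (simp add: e_def levfun_def)
    qed
    have g1: "g 1 m \<noteq> 0" by (rule g_m_nonzero[OF m1(1)])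
    \<comment> \<open>Coefficients of the parabola, obtained from the Krein expansion of
      \<open>(g 1 t)^2\<close> by writing \<open>g 2 t\<close> as an affine function of
      \<open>t\<close> and dividing by \<open>(g 1 m)^2\<close>.\<close>
    define a where "a = c 1 1 1 / g 1 m"
    define b where "b = c 2 1 1 / (\<gamma> * (g 1 m)\<^sup>2)"
    define C where "C = (c 0 1 1 * g 0 m - c 2 1 1 * \<gamma>0 / \<gamma>) / (g 1 m)\<^sup>2"
    have par: "(u 1 t)\<^sup>2 = C + a * u 1 t + b * of_nat t" if t: "t \<le> m" for t
    proof -
      have "g 1 t * g 1 t = (\<Sum>h\<in>{0,1,2}. c h 1 1 * g h t)"
        unfolding g_mult[OF m1(1) m1(1) t] using m3 krein_zero[OF _ m1(1) m1(1)]
        by (intro sum.mono_neutral_right) (auto simp: c_def)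
      also have "\<dots> = c 0 1 1 * g 0 m + c 1 1 1 * g 1 t + c 2 1 1 * ((of_nat t - \<gamma>0) / \<gamma>)"
      proof -
        have "g 2 t = (of_nat t - \<gamma>0) / \<gamma>" using g_s[OF t] s(4) by (simp add: field_simps)
        then show ?thesis using g_0[OF t] by simp
      qed
      finally show ?thesis using g1 s(4)
        by (simp add: u_def a_def b_def C_def field_simps power2_eq_square)
    qed
    have parabola: "\<not> (\<theta> 1 = ?M - 1 \<or> \<theta> 1 = 1 \<or> \<theta> 1 = -1)"
    proof
      assume "\<theta> 1 = ?M - 1 \<or> \<theta> 1 = 1 \<or> \<theta> 1 = -1"
      from parabola_contradiction[OF refl m3 this u_rec[OF m1(1)], of C a b]
      show False using par[of m] par[of 0] par[of "m - 1"] par[of 1] u_m[OF m1(1)] m3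
        by (simp add: of_nat_diff)
    qed
    \<comment> \<open>A nonzero value would couple \<open>\<theta> 1\<close> with
      \<open>\<theta> 2 = - m\<close>, making \<open>\<theta> 1\<close> either \<open>m + 1\<close>,
      which is \<open>\<theta> 0\<close>, or \<open>m - 1\<close>, which the parabola
      excludes.\<close>
    have "c 2 2 1 = 0"
    proof (rule ccontr)
      assume "c 2 2 1 \<noteq> 0"
      then have "(\<theta> 1 + \<theta> 2)\<^sup>2 = 1" using T_off[of 2 1] m1 2 by simp
      then have "(\<theta> 1 - ?M) = 1 \<or> \<theta> 1 - ?M = -1" using s(3) 2 by (simp add: power2_eq_1_iff)
      moreover have "\<theta> 1 \<noteq> ?M + 1" using \<theta>_inj[OF m1(1), of 0] \<theta>_0 by auto
      ultimately have "\<theta> 1 = ?M - 1" by (auto simp: algebra_simps)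
      then show False using parabola by simp
    qed
    have c3: "c 3 2 1 \<noteq> 0" unfolding c_nonzero_iff using m3 by (intro krein_nonzero) auto
    then have "(\<theta> 1 + \<theta> 3)\<^sup>2 = 1" using T_off[of 3 1] m3 2 by simp
    then obtain \<epsilon> where \<epsilon>: "\<epsilon> = 1 \<or> \<epsilon> = -1" "\<theta> 3 = \<epsilon> - \<theta> 1"
      by (metis add_diff_cancel_left' power2_eq_1_iff)
    define a' where "a' = c 1 2 1 / g 2 m"
    define b' where "b' = c 3 2 1 * g 3 m / (g 1 m * g 2 m)"
    have g23: "g 2 m \<noteq> 0" "g 3 m \<noteq> 0" using g_m_nonzero m3 by auto
    \<comment> \<open>The triangle condition removes \<open>E 0\<close> and everything beyond
      \<open>E 3\<close> from the product of \<open>E 2\<close> and \<open>E 1\<close>, and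
      \<open>E 2\<close> has just been removed.\<close>
    have prod: "u 1 t * u 2 t = a' * u 1 t + b' * u 3 t" if t: "t \<le> m" for t
    proof -
      have "g 2 t * g 1 t = (\<Sum>h\<in>{1,3}. c h 2 1 * g h t)"
        unfolding g_mult[OF m1(2) m1(1) t]
      proof (intro sum.mono_neutral_right ballI)
        fix h assume h: "h \<in> {..m} - {1, 3}"
        then consider "h = 0" | "h = 2" | "h > 3" by fastforce
        then show "c h 2 1 * g h t = 0"
          using krein_zero[of h 2 1] h m1 \<open>c 2 2 1 = 0\<close> by cases (auto simp: c_def)
      qed (use m3 in auto)
      then show ?thesis using g1 g23 by (simp add: u_def a'_def b'_def field_simps)
    qed
    have "(\<theta> 1 - \<epsilon> * (?M + 1)) * (\<theta> 1 + \<epsilon>) = 0"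
    proof (rule cosine_product[OF M0 M2 _ u_rec(1,2)[OF m1(1)]])
      show "\<epsilon>\<^sup>2 = 1" using \<epsilon>(1) by auto
      show "(?M + 1) * u 2 0 = - ?M" "1 + ?M * u 2 (m - 1) = - ?M * u 2 0"
        using u_rec(1,2)[OF m1(2)] s(3) 2 by auto
      show "(?M + 1) * u 3 0 = \<epsilon> - \<theta> 1" "1 + ?M * u 3 (m - 1) = (\<epsilon> - \<theta> 1) * u 3 0"
        using u_rec(1,2)[OF m3] \<epsilon>(2) by auto
      show "1 = a' + b'" using prod[of m] u_m m3 by simp
      show "u 1 0 * u 2 0 = a' * u 1 0 + b' * u 3 0" "u 1 (m - 1) * u 2 (m - 1) = a' * u 1 (m - 1) + b' * u 3 (m - 1)"
        using prod by auto
    qed (rule M1)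
    then have "\<theta> 1 = \<epsilon> * (?M + 1) \<or> \<theta> 1 = - \<epsilon>" by (auto simp: eq_neg_iff_add_eq_0)
    moreover have "\<theta> 1 \<noteq> ?M + 1" using \<theta>_inj[OF m1(1), of 0] \<theta>_0 by auto
    ultimately show ?thesis using \<epsilon>(1) parabola \<theta>_neq_bipartite[OF m1(1)] by auto
  qed
qed

lemma odd_spectrum: "odd_spectrum m E"
proof
  show "m \<ge> 1" by (rule m_pos)
  show "A (mvec m (E j) v) = (\<lambda>y. of_int (odd_eigenvalue m j) * mvec m (E j) v y)" if "j \<le> m" for j v
    unfolding A_mvec_E[OF that] eigenvalues_odd[OF that] ..
  show "mvec m (E j) (A v) = (\<lambda>y. of_int (odd_eigenvalue m j) * mvec m (E j) v y)" if "j \<le> m" for j v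
    unfolding mvec_E_A[OF that] eigenvalues_odd[OF that] ..
qed (rule mvec_E_sum)

end

lemma Q_polynomial_odd_spectrum:
  assumes "m \<ge> 3" "Q_polynomial m E"
  shows "odd_spectrum m E"
proof -
  note Q = assms(2)[unfolded Q_polynomial_def]
  obtain q where q:
    "(\<forall>i\<le>m. \<forall>j\<le>m. hadamard m (E i) (E j) = (\<lambda>y z. (\<Sum>h\<le>m. q h i j * E h y z) / of_nat (card (Xset m))))
     \<and> (\<forall>h\<le>m. \<forall>i\<le>m. \<forall>j\<le>m. (h > i + j \<or> i > h + j \<or> j > h + i) \<longrightarrow> q h i j = 0)
     \<and> (\<forall>h\<le>m. \<forall>i\<le>m. \<forall>j\<le>m. (h = i + j \<or> i = h + j \<or> j = h + i) \<longrightarrow> q h i j \<noteq> 0)"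
    using Q[THEN conjunct2, THEN conjunct2] by (rule exE)
  have "odd_Q_polynomial m E q"
  proof (intro odd_Q_polynomial.intro odd_idempotents.intro odd_Q_polynomial_axioms.intro)
    show "1 \<le> m" using assms(1) by simp
    show "primitive_idempotents m E" by (rule Q[THEN conjunct1])
    show "E 0 = (\<lambda>y z. Jm m y z / of_nat (card (Xset m)))" by (rule Q[THEN conjunct2, THEN conjunct1])
    show "3 \<le> m" by (rule assms(1))
    show "hadamard m (E i) (E j) = (\<lambda>y z. (\<Sum>h\<le>m. q h i j * E h y z) / of_nat (card (Xset m)))"
      if "i \<le> m" "j \<le> m" for i j using q[THEN conjunct1, rule_format, OF that] .
    show "q h i j = 0" if "h \<le> m" "i \<le> m" "j \<le> m" "h > i + j \<or> i > h + j \<or> j > h + i" for h i j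
      using q[THEN conjunct2, THEN conjunct1, rule_format, OF that] .
    show "q h i j \<noteq> 0" if "h \<le> m" "i \<le> m" "j \<le> m" "h = i + j \<or> i = h + j \<or> j = h + i" for h i j
      using q[THEN conjunct2, THEN conjunct2, rule_format, OF that] .
  qed
  then show ?thesis by (rule odd_Q_polynomial.odd_spectrum)
qed

theorem theorem4p2:
  fixes m :: nat and E :: "nat \<Rightarrow> mat" and \<mu> d :: int
  assumes "m \<ge> 3"
    and "Q_polynomial m E"
  shows "(\<exists>W. irreducible_T_module m W \<and> int (dual_endpoint m E W) = \<mu>
              \<and> int (diameter m W) = d)
     \<longleftrightarrow> (0 \<le> d \<and> d \<le> int m \<and> int m - d \<le> 2 * \<mu> \<and> \<mu> \<le> int m - d)"
  by (rule odd_spectrum.irreducible_iff[OF Q_polynomial_odd_spectrum[OF assms]])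

end
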